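(* Let $E$ be a row-finite graph and $\mathsf k$ a field. The following are equivalent: (1) the talented monoid $T_E$ is decomposable; (2) the Leavitt path algebra $L_{\mathsf k}(E)$ is decomposable; (3) the graph $C^*$-algebra $C^*(E)$ is decomposable.
   Context: A graph $E=(E^0,E^1,r,s)$ is a directed graph with countable vertex set $E^0$, countable edge set $E^1$, and range and source maps $r,s:E^1\to E^0$; it is row-finite if $s^{-1}(v)$ is finite for every vertex $v$. A vertex $v$ is regular if $s^{-1}(v)\ne\varnothing$. The talented monoid $T_E$ is the commutative monoid generated by $\{v(i)\mid v\in E^0,i\in\mathbb Z\}$ subject to $v(i)=\sum_{e\in s^{-1}(v)}r(e)(i+1)$ for all $i\in\mathbb Z$ and all regular vertices $v$; $\mathbb Z$ acts by ${}^n v(i)=v(i+n)$. On a commutative monoid, $a\le b$ iff $b=a+c$ for some $c$. A $\mathbb Z$-order ideal of $T_E$ is a submonoid $I$ closed under the $\mathbb Z$-action and such that $x\in I$, $y\le x$ imply $y\in I$. $T_E$ is decomposable if $T_E=I\oplus J$, i.e. $T_E=I+J$ and $I\cap J=\{0\}$, for some nonzero $\mathbb Z$-order ideals $I,J$. $L_{\mathsf k}(E)$ is the $\mathsf k$-algebra generated by pairwise orthogonal idempotents $v\in E^0$ and elements $e,e^*$ ($e\in E^1$) with $s(e)e=e=er(e)$, $r(e)e^*=e^*=e^*s(e)$, $e^*f=\delta_{e,f}r(e)$, and $v=\sum_{e\in s^{-1}(v)}ee^*$ for every regular $v$. It is decomposable if it is the direct sum of two nonzero two-sided ideals. $C^*(E)$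 is the universal $C^*$-algebra generated by mutually orthogonal projections $p_v$ ($v\in E^0$) and partial isometries $s_e$ ($e\in E^1$) with mutually orthogonal ranges satisfying $s_e^*s_e=p_{r(e)}$, $s_es_e^*\le p_{s(e)}$, and $p_v=\sum_{e\in s^{-1}(v)}s_es_e^*$ for regular $v$. It is decomposable if it is the direct sum of two nonzero closed two-sided ideals. *)

theory Defs
  imports
    Complex_Main
    "HOL-Library.Multiset"
    "HOL-Library.Poly_Mapping"
    "HOL-Library.Countable_Set"
    "HOL-Algebra.Divisibility"
    "Graph_Theory.Digraph"
begin

section \<open>Row-finite graphs\<close>

text \<open>
  A graph is a \<^locale>\<open>wf_digraph\<close>; the source map is \<^const>\<open>tail\<close>, the range map is \<^const>\<open>head\<close>,
  and the set of edges with source \<open>v\<close> is \<^term>\<open>out_arcs E v\<close>.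
\<close>

definition row_finite :: "('v, 'e) pre_digraph \<Rightarrow> bool" where
  "row_finite E \<longleftrightarrow> (\<forall>v \<in> verts E. finite (out_arcs E v))"

definition regular_vertices :: "('v, 'e) pre_digraph \<Rightarrow> 'v set" where
  "regular_vertices E = {v \<in> verts E. out_arcs E v \<noteq> {}}"

definition quotient_op1 :: "('a \<times> 'a) set \<Rightarrow> ('a \<Rightarrow> 'a) \<Rightarrow> 'a set \<Rightarrow> 'a set" where
  "quotient_op1 r f A = (\<Union>a\<in>A. r `` {f a})"

definition quotient_op2 :: "('a \<times> 'a) set \<Rightarrow> ('a \<Rightarrow> 'a \<Rightarrow> 'a) \<Rightarrow> 'a set \<Rightarrow> 'a set \<Rightarrow> 'a set" where
  "quotient_op2 r f A B = (\<Union>a\<in>A. \<Union>b\<in>B. r `` {f a b})"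


section \<open>The talented monoid\<close>

text \<open>
  The free commutative monoid on the symbols \<open>v(i)\<close> consists of the finite multisets of pairs
  \<open>(v, i)\<close>, with multiset sum as the operation.
\<close>

definition talented_free :: "('v, 'e) pre_digraph \<Rightarrow> ('v \<times> int) multiset set" where
  "talented_free E = {a. set_mset a \<subseteq> verts E \<times> UNIV}"

inductive_set talented_cong ::
  "('v, 'e) pre_digraph \<Rightarrow> (('v \<times> int) multiset \<times> ('v \<times> int) multiset) set"
  for E :: "('v, 'e) pre_digraph" where
  expand: "v \<in> regular_vertices E \<Longrightarrow>
     ({#(v, i)#}, image_mset (\<lambda>e. (head E e, i + 1)) (mset_set (out_arcs E v))) \<in> talented_cong E"
| refl: "a \<in> talented_free E \<Longrightarrow> (a, a) \<in> talented_cong E"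
| sym: "(a, b) \<in> talented_cong E \<Longrightarrow> (b, a) \<in> talented_cong E"
| trans: "(a, b) \<in> talented_cong E \<Longrightarrow> (b, c) \<in> talented_cong E \<Longrightarrow> (a, c) \<in> talented_cong E"
| add: "(a, b) \<in> talented_cong E \<Longrightarrow> c \<in> talented_free E \<Longrightarrow> (a + c, b + c) \<in> talented_cong E"

text \<open>
  The monoid record of HOL-Algebra is written multiplicatively: the operation of \<open>T\<^sub>E\<close>, written
  \<open>+\<close> in the literature, is its \<open>\<otimes>\<close>, the neutral element \<open>0\<close> is its \<open>\<one>\<close>,
  and the algebraic preorder \<open>a \<le> b\<close> is its divisibility relation.
\<close>

definition talented_monoid :: "('v, 'e) pre_digraph \<Rightarrow> ('v \<times> int) multiset set monoid" where
  "talented_monoid E =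
     \<lparr> carrier = talented_free E // talented_cong E,
       mult = quotient_op2 (talented_cong E) (+),
       one = talented_cong E `` {{#}} \<rparr>"

definition talented_shift ::
  "('v, 'e) pre_digraph \<Rightarrow> int \<Rightarrow> ('v \<times> int) multiset set \<Rightarrow> ('v \<times> int) multiset set" where
  "talented_shift E n = quotient_op1 (talented_cong E) (image_mset (\<lambda>(v, i). (v, i + n)))"

definition Z_order_ideal :: "('v, 'e) pre_digraph \<Rightarrow> ('v \<times> int) multiset set set \<Rightarrow> bool" where
  "Z_order_ideal E I \<longleftrightarrow>
     submonoid I (talented_monoid E) \<and>
     (\<forall>n. \<forall>x\<in>I. talented_shift E n x \<in> I) \<and>
     (\<forall>x\<in>I. \<forall>y\<in>carrier (talented_monoid E). y divides\<^bsub>talented_monoid E\<^esub> x \<longrightarrow> y \<in> I)"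

definition talented_decomposable :: "('v, 'e) pre_digraph \<Rightarrow> bool" where
  "talented_decomposable E \<longleftrightarrow>
     (\<exists>I J. Z_order_ideal E I \<and> Z_order_ideal E J \<and>
        I \<noteq> {\<one>\<^bsub>talented_monoid E\<^esub>} \<and> J \<noteq> {\<one>\<^bsub>talented_monoid E\<^esub>} \<and>
        I <#>\<^bsub>talented_monoid E\<^esub> J = carrier (talented_monoid E) \<and>
        I \<inter> J = {\<one>\<^bsub>talented_monoid E\<^esub>})"


section \<open>Not necessarily unital algebras\<close>

record ('k, 'a) nu_algebra = "'a partial_object" +
  alg_zero :: 'a
  alg_add :: "'a \<Rightarrow> 'a \<Rightarrow> 'a"
  alg_mult :: "'a \<Rightarrow> 'a \<Rightarrow> 'a"
  alg_scale :: "'k \<Rightarrow> 'a \<Rightarrow> 'a"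

definition two_sided_ideal :: "('k, 'a, 'm) nu_algebra_scheme \<Rightarrow> 'a set \<Rightarrow> bool" where
  "two_sided_ideal A I \<longleftrightarrow>
     I \<subseteq> carrier A \<and> alg_zero A \<in> I \<and>
     (\<forall>x\<in>I. \<forall>y\<in>I. alg_add A x y \<in> I) \<and>
     (\<forall>c. \<forall>x\<in>I. alg_scale A c x \<in> I) \<and>
     (\<forall>a\<in>carrier A. \<forall>x\<in>I. alg_mult A a x \<in> I \<and> alg_mult A x a \<in> I)"

definition direct_sum_of :: "('k, 'a, 'm) nu_algebra_scheme \<Rightarrow> 'a set \<Rightarrow> 'a set \<Rightarrow> bool" where
  "direct_sum_of A I J \<longleftrightarrow>
     carrier A = {alg_add A x y | x y. x \<in> I \<and> y \<in> J} \<and> I \<inter> J = {alg_zero A}"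

definition decomposable_algebra :: "('k, 'a, 'm) nu_algebra_scheme \<Rightarrow> bool" where
  "decomposable_algebra A \<longleftrightarrow>
     (\<exists>I J. two_sided_ideal A I \<and> two_sided_ideal A J \<and>
        I \<noteq> {alg_zero A} \<and> J \<noteq> {alg_zero A} \<and> direct_sum_of A I J)"


section \<open>Free algebras and algebras given by generators and relations\<close>

text \<open>
  With concatenation as addition, words form the free monoid, so the type \<open>'g free_word \<Rightarrow>\<^sub>0 'k\<close>
  with the convolution product of \<^theory>\<open>HOL-Library.Poly_Mapping\<close> is the free unital algebra
  on \<open>'g\<close>.
\<close>

datatype 'g free_word = Word (letters: "'g list")

instantiation free_word :: (type) monoid_add
begin

definition zero_free_word :: "'a free_word" where "0 = Word []"

definition plus_free_word :: "'a free_word \<Rightarrow> 'a free_word \<Rightarrow> 'a free_word" where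
  "x + y = Word (letters x @ letters y)"

instance
  by standard (simp_all add: zero_free_word_def plus_free_word_def)

end

text \<open>
  The algebras in question have no unit in general. The free non-unital algebra on the set \<open>X\<close>
  is spanned by the non-empty words in letters from \<open>X\<close>.
\<close>

definition free_algebra :: "'g set \<Rightarrow> ('g free_word \<Rightarrow>\<^sub>0 'k::ring_1) set" where
  "free_algebra X = {x. \<forall>w \<in> Poly_Mapping.keys x. letters w \<noteq> [] \<and> set (letters w) \<subseteq> X}"

definition gen :: "'g \<Rightarrow> ('g free_word \<Rightarrow>\<^sub>0 'k::ring_1)" where
  "gen g = Poly_Mapping.single (Word [g]) 1"

definition scale :: "'k::ring_1 \<Rightarrow> ('g free_word \<Rightarrow>\<^sub>0 'k) \<Rightarrow> ('g free_word \<Rightarrow>\<^sub>0 'k)" where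
  "scale c x = Poly_Mapping.map ((*) c) x"

inductive_set generated_ideal ::
  "'g set \<Rightarrow> ('g free_word \<Rightarrow>\<^sub>0 'k::ring_1) set \<Rightarrow> ('g free_word \<Rightarrow>\<^sub>0 'k) set"
  for X :: "'g set" and R :: "('g free_word \<Rightarrow>\<^sub>0 'k) set" where
  zero: "0 \<in> generated_ideal X R"
| rel: "x \<in> R \<Longrightarrow> x \<in> generated_ideal X R"
| add: "x \<in> generated_ideal X R \<Longrightarrow> y \<in> generated_ideal X R \<Longrightarrow> x + y \<in> generated_ideal X R"
| scale: "x \<in> generated_ideal X R \<Longrightarrow> scale c x \<in> generated_ideal X R"
| left: "x \<in> generated_ideal X R \<Longrightarrow> a \<in> free_algebra X \<Longrightarrow> a * x \<in> generated_ideal X R"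
| right: "x \<in> generated_ideal X R \<Longrightarrow> a \<in> free_algebra X \<Longrightarrow> x * a \<in> generated_ideal X R"

definition ideal_cong ::
  "'g set \<Rightarrow> ('g free_word \<Rightarrow>\<^sub>0 'k::ring_1) set \<Rightarrow>
   (('g free_word \<Rightarrow>\<^sub>0 'k) \<times> ('g free_word \<Rightarrow>\<^sub>0 'k)) set" where
  "ideal_cong X R =
     {(x, y). x \<in> free_algebra X \<and> y \<in> free_algebra X \<and> x - y \<in> generated_ideal X R}"

text \<open>Here \<open>R\<close> is a subset of \<^term>\<open>free_algebra X\<close>; its elements are the relators.\<close>

definition presented_algebra ::
  "'g set \<Rightarrow> ('g free_word \<Rightarrow>\<^sub>0 'k::ring_1) set \<Rightarrow> ('k, ('g free_word \<Rightarrow>\<^sub>0 'k) set) nu_algebra" where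
  "presented_algebra X R =
     \<lparr> carrier = free_algebra X // ideal_cong X R,
       alg_zero = ideal_cong X R `` {0},
       alg_add = quotient_op2 (ideal_cong X R) (+),
       alg_mult = quotient_op2 (ideal_cong X R) (*),
       alg_scale = (\<lambda>c. quotient_op1 (ideal_cong X R) (scale c)) \<rparr>"


section \<open>Leavitt path algebras\<close>

datatype ('v, 'e) leavitt_gen = Vertex 'v | Edge 'e | Ghost 'e

definition leavitt_gens :: "('v, 'e) pre_digraph \<Rightarrow> ('v, 'e) leavitt_gen set" where
  "leavitt_gens E = Vertex ` verts E \<union> Edge ` arcs E \<union> Ghost ` arcs E"

definition leavitt_relators ::
  "('v, 'e) pre_digraph \<Rightarrow> (('v, 'e) leavitt_gen free_word \<Rightarrow>\<^sub>0 'k::field) set" where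
  "leavitt_relators E =
     {gen (Vertex v) * gen (Vertex w) - (if v = w then gen (Vertex v) else 0)
        | v w. v \<in> verts E \<and> w \<in> verts E} \<union>
     {gen (Vertex (tail E e)) * gen (Edge e) - gen (Edge e) | e. e \<in> arcs E} \<union>
     {gen (Edge e) * gen (Vertex (head E e)) - gen (Edge e) | e. e \<in> arcs E} \<union>
     {gen (Vertex (head E e)) * gen (Ghost e) - gen (Ghost e) | e. e \<in> arcs E} \<union>
     {gen (Ghost e) * gen (Vertex (tail E e)) - gen (Ghost e) | e. e \<in> arcs E} \<union>
     {gen (Ghost e) * gen (Edge f) - (if e = f then gen (Vertex (head E e)) else 0)
        | e f. e \<in> arcs E \<and> f \<in> arcs E} \<union>
     {gen (Vertex v) - (\<Sum>e\<in>out_arcs E v. gen (Edge e) * gen (Ghost e))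
        | v. v \<in> regular_vertices E}"

definition leavitt_path_algebra ::
  "('v, 'e) pre_digraph \<Rightarrow>
   ('k::field, (('v, 'e) leavitt_gen free_word \<Rightarrow>\<^sub>0 'k) set) nu_algebra" where
  "leavitt_path_algebra E = presented_algebra (leavitt_gens E) (leavitt_relators E)"


section \<open>Universal C*-algebras\<close>

text \<open>
  The free *-algebra over \<open>\<complex>\<close> on the set \<open>X\<close> is the free algebra on the letters \<open>x\<close> and
  \<open>x\<^sup>*\<close> for \<open>x \<in> X\<close>, with the conjugate-linear involution that reverses words
  and exchanges \<open>x\<close> and \<open>x\<^sup>*\<close>.
\<close>

datatype 'x star_letter = Plain 'x | Starred 'x

primrec letter_star :: "'x star_letter \<Rightarrow> 'x star_letter" where
  "letter_star (Plain x) = Starred x"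
| "letter_star (Starred x) = Plain x"

definition word_star :: "'x star_letter free_word \<Rightarrow> 'x star_letter free_word" where
  "word_star w = Word (rev (map letter_star (letters w)))"

type_synonym 'x star_poly = "'x star_letter free_word \<Rightarrow>\<^sub>0 complex"

definition free_star_algebra :: "'x set \<Rightarrow> 'x star_poly set" where
  "free_star_algebra X = free_algebra (Plain ` X \<union> Starred ` X)"

text \<open>
  As \<^const>\<open>word_star\<close> is an involution, the coefficient of \<open>x\<^sup>*\<close> at a word \<open>w\<close>
  is the conjugate of the coefficient of \<open>x\<close> at \<open>word_star w\<close>.
\<close>

definition star :: "'x star_poly \<Rightarrow> 'x star_poly" where
  "star x = Poly_Mapping.map cnj (Poly_Mapping.map_key word_star x)"

text \<open>
  A C*-seminorm on the free *-algebra that vanishes on the relators \<open>R\<close> is the same thing as the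
  seminorm \<open>x \<mapsto> \<parallel>\<pi>(x)\<parallel>\<close> of a *-homomorphism \<open>\<pi>\<close> into some C*-algebra that satisfies the
  relations, that is, of a representation of \<open>(X, R)\<close>: given the seminorm, divide out its
  null space and complete.
\<close>

definition cstar_seminorm :: "'x set \<Rightarrow> 'x star_poly set \<Rightarrow> ('x star_poly \<Rightarrow> real) \<Rightarrow> bool" where
  "cstar_seminorm X R \<rho> \<longleftrightarrow>
     (\<forall>x\<in>free_star_algebra X. \<forall>y\<in>free_star_algebra X.
        \<rho> (x + y) \<le> \<rho> x + \<rho> y \<and> \<rho> (x * y) \<le> \<rho> x * \<rho> y) \<and>
     (\<forall>c. \<forall>x\<in>free_star_algebra X. \<rho> (scale c x) = cmod c * \<rho> x) \<and>
     (\<forall>x\<in>free_star_algebra X. \<rho> (star x * x) = (\<rho> x)\<^sup>2) \<and>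
     (\<forall>x\<in>R. \<rho> x = 0)"

text \<open>
  The universal seminorm is the supremum over all representations; it is meaningful only
  when the relations bound the generators; Cuntz--Krieger relations force norm at most \<open>1\<close>.
\<close>

definition universal_seminorm :: "'x set \<Rightarrow> 'x star_poly set \<Rightarrow> 'x star_poly \<Rightarrow> real" where
  "universal_seminorm X R x = Sup {\<rho> x | \<rho>. cstar_seminorm X R \<rho>}"

definition universal_cauchy :: "'x set \<Rightarrow> 'x star_poly set \<Rightarrow> (nat \<Rightarrow> 'x star_poly) set" where
  "universal_cauchy X R =
     {f. (\<forall>n. f n \<in> free_star_algebra X) \<and>
         (\<forall>\<epsilon>>0. \<exists>N. \<forall>m\<ge>N. \<forall>n\<ge>N. universal_seminorm X R (f m - f n) < \<epsilon>)}"

definition universal_cong ::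
  "'x set \<Rightarrow> 'x star_poly set \<Rightarrow> ((nat \<Rightarrow> 'x star_poly) \<times> (nat \<Rightarrow> 'x star_poly)) set" where
  "universal_cong X R =
     {(f, g). f \<in> universal_cauchy X R \<and> g \<in> universal_cauchy X R \<and>
              (\<lambda>n. universal_seminorm X R (f n - g n)) \<longlonglongrightarrow> 0}"

record 'a star_normed_algebra = "(complex, 'a) nu_algebra" +
  alg_star :: "'a \<Rightarrow> 'a"
  alg_norm :: "'a \<Rightarrow> real"

text \<open>
  The universal C*-algebra generated by \<open>X\<close> subject to \<open>R\<close> is the Hausdorff completion of the free
  *-algebra in the universal seminorm, realised by Cauchy sequences modulo null sequences. The
  limit defining the norm does not depend on the chosen representative.
\<close>

definition universal_cstar_algebra ::
  "'x set \<Rightarrow> 'x star_poly set \<Rightarrow> (nat \<Rightarrow> 'x star_poly) set star_normed_algebra" where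
  "universal_cstar_algebra X R =
     \<lparr> carrier = universal_cauchy X R // universal_cong X R,
       alg_zero = universal_cong X R `` {\<lambda>n. 0},
       alg_add = quotient_op2 (universal_cong X R) (\<lambda>f g n. f n + g n),
       alg_mult = quotient_op2 (universal_cong X R) (\<lambda>f g n. f n * g n),
       alg_scale = (\<lambda>c. quotient_op1 (universal_cong X R) (\<lambda>f n. scale c (f n))),
       alg_star = quotient_op1 (universal_cong X R) (\<lambda>f n. star (f n)),
       alg_norm = (\<lambda>A. lim (\<lambda>n. universal_seminorm X R ((SOME f. f \<in> A) n))) \<rparr>"

definition closed_ideal :: "('a, 'm) star_normed_algebra_scheme \<Rightarrow> 'a set \<Rightarrow> bool" where
  "closed_ideal A I \<longleftrightarrow>
     two_sided_ideal A I \<and>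
     (\<forall>f. \<forall>x\<in>carrier A. (\<forall>n. f n \<in> I) \<longrightarrow>
        (\<lambda>n::nat. alg_norm A (alg_add A (f n) (alg_scale A (- 1) x))) \<longlonglongrightarrow> 0 \<longrightarrow> x \<in> I)"

definition decomposable_cstar_algebra :: "('a, 'm) star_normed_algebra_scheme \<Rightarrow> bool" where
  "decomposable_cstar_algebra A \<longleftrightarrow>
     (\<exists>I J. closed_ideal A I \<and> closed_ideal A J \<and>
        I \<noteq> {alg_zero A} \<and> J \<noteq> {alg_zero A} \<and> direct_sum_of A I J)"


section \<open>Graph C*-algebras\<close>

datatype ('v, 'e) ck_gen = CK_Proj 'v | CK_Iso 'e

definition ck_gens :: "('v, 'e) pre_digraph \<Rightarrow> ('v, 'e) ck_gen set" where
  "ck_gens E = CK_Proj ` verts E \<union> CK_Iso ` arcs E"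

definition ck_p :: "'v \<Rightarrow> ('v, 'e) ck_gen star_poly" where
  "ck_p v = gen (Plain (CK_Proj v))"

definition ck_s :: "'e \<Rightarrow> ('v, 'e) ck_gen star_poly" where
  "ck_s e = gen (Plain (CK_Iso e))"

text \<open>
  In order of appearance: the \<open>p\<^sub>v\<close> are self-adjoint, and idempotent and mutually orthogonal;
  the \<open>s\<^sub>e\<close> are partial isometries; their range projections are mutually orthogonal;
  \<open>s\<^sub>e\<^sup>* s\<^sub>e = p\<^bsub>r(e)\<^esub>\<close>; \<open>s\<^sub>e s\<^sub>e\<^sup>* \<le> p\<^bsub>s(e)\<^esub>\<close>, where \<open>q \<le> p\<close> for
  projections means \<open>p q = q\<close>; and the Cuntz--Krieger relation at regular vertices.
\<close>

definition ck_relators :: "('v, 'e) pre_digraph \<Rightarrow> ('v, 'e) ck_gen star_poly set" where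
  "ck_relators E =
     {star (ck_p v) - ck_p v | v. v \<in> verts E} \<union>
     {ck_p v * ck_p w - (if v = w then ck_p v else 0) | v w. v \<in> verts E \<and> w \<in> verts E} \<union>
     {ck_s e * star (ck_s e) * ck_s e - ck_s e | e. e \<in> arcs E} \<union>
     {(ck_s e * star (ck_s e)) * (ck_s f * star (ck_s f))
        | e f. e \<in> arcs E \<and> f \<in> arcs E \<and> e \<noteq> f} \<union>
     {star (ck_s e) * ck_s e - ck_p (head E e) | e. e \<in> arcs E} \<union>
     {ck_p (tail E e) * (ck_s e * star (ck_s e)) - ck_s e * star (ck_s e) | e. e \<in> arcs E} \<union>
     {ck_p v - (\<Sum>e\<in>out_arcs E v. ck_s e * star (ck_s e)) | v. v \<in> regular_vertices E}"

definition graph_cstar_algebra ::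
  "('v, 'e) pre_digraph \<Rightarrow> (nat \<Rightarrow> ('v, 'e) ck_gen star_poly) set star_normed_algebra" where
  "graph_cstar_algebra E = universal_cstar_algebra (ck_gens E) (ck_relators E)"

end

theory Submission
  imports Defs "HOL-Library.Function_Algebras" "HOL-Library.Sublist" "HOL-Analysis.L2_Norm"
    "Graph_Theory.Arc_Walk"
begin

text \<open>
  All three properties say the same thing about the graph alone: there are disjoint nonempty
  hereditary sets \<open>H\<close>, \<open>L\<close> of vertices such that every vertex lies in the saturation of \<open>H \<union> L\<close>
  (\<open>graph_splits\<close>). Informally, every walk that goes on long enough is caught by one of two parts
  that do not see each other.

  For the talented monoid this is elementary. A relation \<open>v(i) = \<Sum> r(e)(i + 1)\<close> neither enters nor leaves
  the multisets supported in a hereditary saturated set (\<open>talented_cong_support\<close>), so statements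
  about classes of multisets become statements about vertices.

  Both algebras are quotients \<open>S/K\<close>, where \<open>S\<close> is a subring without unit of a ring and \<open>K\<close> an ideal
  of \<open>S\<close>: for the Leavitt path algebra, \<open>S\<close> is the free algebra and \<open>K\<close> the ideal generated by the relators;
  for the C*-algebra, \<open>S\<close> consists of the Cauchy sequences in the free *-algebra and \<open>K\<close> of the null
  sequences. In both, the vertices \<open>p\<close>, edges \<open>s\<close> and ghost edges \<open>t\<close> satisfy the Leavitt relations
  modulo \<open>K\<close> (locale \<open>ck_relations\<close>), and a decomposition is a pair of ideals \<open>I\<close>, \<open>J\<close> of \<open>S\<close> with
  \<open>I + J = S\<close> and \<open>I \<inter> J = K\<close>.

  Given \<open>H\<close> and \<open>L\<close>, take for \<open>I\<close> and \<open>J\<close> the annihilators of \<open>L\<close> and \<open>H\<close>. They are two-sided ideals,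
  they meet in \<open>K\<close> because \<open>H \<union> L\<close> saturates everything, and they contain \<open>H\<close> and \<open>L\<close> because
  \<open>p\<^sub>v S p\<^sub>w = 0\<close> when no vertex is reachable from both \<open>v\<close> and \<open>w\<close> (\<open>hereditary_orthogonal\<close>). In the
  free algebra they add up to everything, because their sum is an ideal that contains all vertices. In
  the C*-algebra they are closed, and they still add up to everything, because \<open>\<parallel>x\<parallel> \<le> \<parallel>x + y\<parallel>\<close> for
  \<open>x \<in> I\<close>, \<open>y \<in> J\<close>: hence the two parts of a Cauchy sequence are Cauchy (\<open>orthogonal_norm_le\<close>).

  Conversely, let \<open>a\<^sub>v\<close> be the component of \<open>p\<^sub>v\<close> in \<open>I\<close>. For a walk \<open>\<gamma>\<close> from \<open>v\<close> to \<open>w\<close> one has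
  \<open>t\<^sub>\<gamma> a\<^sub>v s\<^sub>\<gamma> = a\<^sub>w\<close> (\<open>part_transport\<close>). Elements of the free algebra are combinations of monomials
  \<open>s\<^sub>\<alpha> t\<^sub>\<beta>\<close>, and when \<open>\<gamma>\<close> is longer than all \<open>\<alpha>\<close> and \<open>\<beta>\<close> that occur, \<open>t\<^sub>\<gamma> x s\<^sub>\<gamma>\<close> is a
  combination of closed walks \<open>s\<^sub>\<delta>\<close>, \<open>t\<^sub>\<delta>\<close> at \<open>w\<close> (\<open>compress\<close>). So the idempotent \<open>a\<^sub>w\<close> is of this form,
  or close to an element of this form. Then \<open>a\<^sub>w\<close> is \<open>0\<close> or \<open>p\<^sub>w\<close>: in the Leavitt path algebra by
  comparing terms of top degree (\<open>loop_idempotent\<close>); in the C*-algebra because the idempotents \<open>a\<^sub>w\<close>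
  and \<open>\<gamma>\<^sub>z(a\<^sub>w)\<close> commute and are close for \<open>z\<close> near \<open>1\<close> under the gauge action, hence equal, so that
  averaging over roots of unity leaves only the terms of degree \<open>0\<close> (\<open>loop_idempotent_close\<close>).
  Therefore every sufficiently long walk from \<open>v\<close> ends in a vertex \<open>w\<close> with \<open>p\<^sub>w \<in> I\<close> or \<open>p\<^sub>w \<in> J\<close>,
  and every sink is such a vertex; these two sets of vertices split the graph.

  That no vertex vanishes in either algebra is seen from one representation on functions on
  \<open>V \<times> \<nat> \<times> \<int>\<close>, in which the copy of \<open>\<nat>\<close> over a regular vertex is divided into residue classes, one
  for each outgoing edge.
\<close>

section \<open>Hereditary sets and their saturations\<close>

definition hereditary :: "('v, 'e) pre_digraph \<Rightarrow> 'v set \<Rightarrow> bool" where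
  "hereditary E H \<longleftrightarrow> H \<subseteq> verts E \<and> (\<forall>e\<in>arcs E. tail E e \<in> H \<longrightarrow> head E e \<in> H)"

inductive_set saturation :: "('v, 'e) pre_digraph \<Rightarrow> 'v set \<Rightarrow> 'v set"
  for E :: "('v, 'e) pre_digraph" and H :: "'v set" where
  base: "v \<in> H \<Longrightarrow> v \<in> saturation E H"
| step: "v \<in> regular_vertices E \<Longrightarrow> (\<And>e. e \<in> out_arcs E v \<Longrightarrow> head E e \<in> saturation E H) \<Longrightarrow>
    v \<in> saturation E H"

definition graph_splits :: "('v, 'e) pre_digraph \<Rightarrow> bool" where
  "graph_splits E \<longleftrightarrow>
     (\<exists>H1 H2. hereditary E H1 \<and> hereditary E H2 \<and> H1 \<noteq> {} \<and> H2 \<noteq> {} \<and> H1 \<inter> H2 = {} \<and>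
        verts E \<subseteq> saturation E (H1 \<union> H2))"

locale row_finite_graph = wf_digraph E for E :: "('v, 'e) pre_digraph" +
  assumes row_finite: "row_finite E"
begin

lemma finite_out_arcs: "v \<in> verts E \<Longrightarrow> finite (out_arcs E v)"
  using row_finite by (simp add: row_finite_def)

lemma regular_in_verts: "v \<in> regular_vertices E \<Longrightarrow> v \<in> verts E"
  by (simp add: regular_vertices_def)

lemma regularE:
  assumes "v \<in> regular_vertices E"
  obtains e where "e \<in> out_arcs E v"
  using assms unfolding regular_vertices_def by blast

lemma hereditary_headD: "hereditary E H \<Longrightarrow> v \<in> H \<Longrightarrow> e \<in> out_arcs E v \<Longrightarrow> head E e \<in> H"
  by (auto simp: hereditary_def)

lemma hereditary_Un: "hereditary E H \<Longrightarrow> hereditary E H' \<Longrightarrow> hereditary E (H \<union> H')"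
  by (auto simp: hereditary_def)

lemma hereditary_saturation:
  assumes H: "hereditary E H"
  shows "hereditary E (saturation E H)"
proof -
  have *: "v \<in> verts E \<and> (\<forall>e\<in>out_arcs E v. head E e \<in> saturation E H)"
    if "v \<in> saturation E H" for v
    using that
  proof cases
    case base
    then show ?thesis
      using H by (auto simp: hereditary_def intro: saturation.base)
  next
    case step
    then show ?thesis by (auto simp: regular_vertices_def)
  qed
  show ?thesis unfolding hereditary_def using * by (auto simp: out_arcs_def)
qed

text \<open>
  Descending along an edge from a regular vertex stays inside a hereditary set, while a vertex of a
  saturation reaches the original set after finitely many such steps. Two inductions, one for each
  set, turn a common vertex of the saturations into a common vertex of the sets.
\<close>

lemma saturation_disjoint:
  assumes H: "hereditary E H" and K: "hereditary E K" and disj: "H \<inter> K = {}"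
  shows "saturation E H \<inter> saturation E K = {}"
proof -
  have *: "v \<in> saturation E K \<Longrightarrow> v \<notin> H'"
    if H': "hereditary E H'" and d: "H' \<inter> K = {}" for v H'
  proof (induction rule: saturation.induct)
    case (base v)
    then show ?case using d by auto
  next
    case (step v)
    then obtain e where "e \<in> out_arcs E v" by (elim regularE)
    with step show ?case using hereditary_headD[OF H'] by blast
  qed
  have **: "v \<in> saturation E H \<Longrightarrow> v \<notin> saturation E K" for v
  proof (induction rule: saturation.induct)
    case (base v)
    then show ?case using *[OF H disj] by auto
  next
    case (step v)
    then obtain e where "e \<in> out_arcs E v" by (elim regularE)
    with step show ?case using hereditary_headD[OF hereditary_saturation[OF K]] by blast
  qed
  then show ?thesis by auto
qed

lemma regular_in_saturation_iff:
  assumes H: "hereditary E H" and v: "v \<in> regular_vertices E"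
  shows "v \<in> saturation E H \<longleftrightarrow> (\<forall>e\<in>out_arcs E v. head E e \<in> saturation E H)"
proof
  assume "v \<in> saturation E H"
  then show "\<forall>e\<in>out_arcs E v. head E e \<in> saturation E H"
    using hereditary_headD[OF hereditary_saturation[OF H]] by blast
next
  assume "\<forall>e\<in>out_arcs E v. head E e \<in> saturation E H"
  then show "v \<in> saturation E H" using v by (blast intro: saturation.step[OF v])
qed

end

section \<open>The talented monoid\<close>

lemma quotient_op2_class:
  assumes "equiv S r"
    and "\<And>a a' b b'. (a, a') \<in> r \<Longrightarrow> (b, b') \<in> r \<Longrightarrow> (f a b, f a' b') \<in> r"
    and "a \<in> S" "b \<in> S"
  shows "quotient_op2 r f (r `` {a}) (r `` {b}) = r `` {f a b}"
proof -
  have "congruent2 r r (\<lambda>x y. r `` {f x y})"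
    using assms(1,2) by (auto simp: congruent2_def intro!: equiv_class_eq)
  from UN_equiv_class2[OF assms(1,1) this assms(3,4)]
  show ?thesis unfolding quotient_op2_def .
qed

lemma quotient_op1_class:
  assumes "equiv S r" and "\<And>a a'. (a, a') \<in> r \<Longrightarrow> (f a, f a') \<in> r" and "a \<in> S"
  shows "quotient_op1 r f (r `` {a}) = r `` {f a}"
proof -
  have "congruent r (\<lambda>x. r `` {f x})"
    using assms(1,2) by (auto simp: congruent_def intro!: equiv_class_eq)
  from UN_equiv_class[OF assms(1) this assms(3)]
  show ?thesis unfolding quotient_op1_def .
qed

context row_finite_graph
begin

abbreviation tcong where "tcong \<equiv> talented_cong E"
abbreviation tclass where "tclass a \<equiv> talented_cong E `` {a}"

lemma talented_cong_in_free:
  "(a, b) \<in> tcong \<Longrightarrow> a \<in> talented_free E \<and> b \<in> talented_free E"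
proof (induction rule: talented_cong.induct)
  case (expand v i)
  then show ?case
    using finite_out_arcs[of v] by (auto simp: talented_free_def regular_vertices_def)
qed (auto simp: talented_free_def)

lemma equiv_talented_cong: "equiv (talented_free E) tcong"
proof (rule equivI)
  show "tcong \<subseteq> talented_free E \<times> talented_free E"
    using talented_cong_in_free by auto
qed (auto simp: refl_on_def sym_def trans_def intro: talented_cong.refl talented_cong.sym
    dest: talented_cong.trans)

lemma talented_cong_add:
  assumes "(a, a') \<in> tcong" "(b, b') \<in> tcong"
  shows "(a + b, a' + b') \<in> tcong"
proof -
  have "(a + b, a' + b) \<in> tcong"
    using assms talented_cong_in_free by (blast intro: talented_cong.add)
  moreover have "(b + a', b' + a') \<in> tcong"
    using assms talented_cong_in_free by (blast intro: talented_cong.add)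
  ultimately show ?thesis by (metis add.commute talented_cong.trans)
qed

abbreviation mshift :: "int \<Rightarrow> ('v \<times> int) multiset \<Rightarrow> ('v \<times> int) multiset" where
  "mshift n \<equiv> image_mset (\<lambda>(v, i). (v, i + n))"

lemma talented_cong_shift: "(a, b) \<in> tcong \<Longrightarrow> (mshift n a, mshift n b) \<in> tcong"
proof (induction rule: talented_cong.induct)
  case (expand v i)
  have "mshift n (image_mset (\<lambda>e. (head E e, i + 1)) (mset_set (out_arcs E v))) =
    image_mset (\<lambda>e. (head E e, i + n + 1)) (mset_set (out_arcs E v))"
    by (simp add: multiset.map_comp o_def algebra_simps)
  then show ?case using talented_cong.expand[OF expand, of "i + n"] by simp
next
  case (refl a)
  then have "mshift n a \<in> talented_free E" by (auto simp: talented_free_def)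
  then show ?case by (rule talented_cong.refl)
next
  case (add a b c)
  have "mshift n c \<in> talented_free E"
    using add.hyps(2) by (auto simp: talented_free_def)
  then show ?case using add.IH by (simp add: talented_cong.add)
qed (blast intro: talented_cong.sym talented_cong.trans)+

lemma talented_carrier: "carrier (talented_monoid E) = tclass ` talented_free E"
  by (auto simp: talented_monoid_def quotient_def)

lemma talented_carrierE:
  assumes "x \<in> carrier (talented_monoid E)"
  obtains a where "a \<in> talented_free E" "x = tclass a"
  using assms unfolding talented_carrier by blast

lemma tclass_eq_iff:
  "a \<in> talented_free E \<Longrightarrow> b \<in> talented_free E \<Longrightarrow> tclass a = tclass b \<longleftrightarrow> (a, b) \<in> tcong"
  by (rule eq_equiv_class_iff[OF equiv_talented_cong])

lemma tclass_mult:
  "a \<in> talented_free E \<Longrightarrow> b \<in> talented_free E \<Longrightarrow>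
    tclass a \<otimes>\<^bsub>talented_monoid E\<^esub> tclass b = tclass (a + b)"
  unfolding talented_monoid_def
  by (simp add: quotient_op2_class[OF equiv_talented_cong talented_cong_add])

lemma talented_shift_class:
  "a \<in> talented_free E \<Longrightarrow> talented_shift E n (tclass a) = tclass (mshift n a)"
  unfolding talented_shift_def
  by (rule quotient_op1_class[OF equiv_talented_cong talented_cong_shift])

lemma talented_one: "\<one>\<^bsub>talented_monoid E\<^esub> = tclass {#}"
  by (simp add: talented_monoid_def)

lemma talented_free_simps [simp]:
  "{#} \<in> talented_free E"
  "a + b \<in> talented_free E \<longleftrightarrow> a \<in> talented_free E \<and> b \<in> talented_free E"
  "add_mset (v, i) a \<in> talented_free E \<longleftrightarrow> v \<in> verts E \<and> a \<in> talented_free E"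
  by (auto simp: talented_free_def)

text \<open>
  Both directions of a rewriting step \<open>v(i) = \<Sum> r(e)(i + 1)\<close> keep a multiset inside a set of
  vertices that is hereditary and saturated. This invariant turns statements about classes of
  multisets into statements about vertices.
\<close>

lemma talented_cong_support:
  assumes H: "hereditary E H"
  shows "(a, b) \<in> tcong \<Longrightarrow>
    set_mset a \<subseteq> saturation E H \<times> UNIV \<longleftrightarrow> set_mset b \<subseteq> saturation E H \<times> UNIV"
proof (induction rule: talented_cong.induct)
  case (expand v i)
  then show ?case
    using finite_out_arcs[OF regular_in_verts[OF expand]] regular_in_saturation_iff[OF H expand]
    by auto
qed auto

text \<open>
  The support invariant for the empty set: its saturation is empty, as a regular vertex emits an edge.
\<close>

lemma talented_cong_empty_iff: "(a, b) \<in> tcong \<Longrightarrow> a = {#} \<longleftrightarrow> b = {#}"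
proof -
  have "v \<in> saturation E {} \<Longrightarrow> False" for v
  proof (induction rule: saturation.induct)
    case (step v)
    then show ?case by (blast elim: regularE)
  qed simp
  then have "saturation E {} = {}" by auto
  moreover assume "(a, b) \<in> tcong"
  ultimately show ?thesis
    using talented_cong_support[of "{}" a b] by (auto simp: hereditary_def)
qed

lemma tclass_eq_one_iff:
  "a \<in> talented_free E \<Longrightarrow> tclass a = tclass {#} \<longleftrightarrow> a = {#}"
  using tclass_eq_iff[of a "{#}"] talented_cong_empty_iff[of a "{#}"] talented_cong.refl[of a E]
  by auto

text \<open>
  This is where closure under the algebraic preorder is used: it splits off single generators
  \<open>v(i)\<close> from an element of the ideal.
\<close>

lemma order_ideal_divisor:
  assumes I: "Z_order_ideal E I" and "a \<in> talented_free E" "b \<in> talented_free E"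
    and "tclass (a + b) \<in> I"
  shows "tclass a \<in> I"
proof -
  have "tclass a divides\<^bsub>talented_monoid E\<^esub> tclass (a + b)"
    using assms by (auto simp: factor_def talented_carrier tclass_mult)
  then show ?thesis
    using assms by (auto simp: Z_order_ideal_def talented_carrier)
qed

lemma order_ideal_shift:
  assumes I: "Z_order_ideal E I" and "v \<in> verts E" "tclass {#(v, i)#} \<in> I"
  shows "tclass {#(v, j)#} \<in> I"
proof -
  have "talented_shift E (j - i) (tclass {#(v, i)#}) \<in> I"
    using assms by (auto simp: Z_order_ideal_def)
  then show ?thesis using assms(2) by (simp add: talented_shift_class)
qed

text \<open>
  Level \<open>0\<close> stands for all levels, since order ideals are invariant under the shift.
\<close>

definition ideal_verts :: "('v \<times> int) multiset set set \<Rightarrow> 'v set" where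
  "ideal_verts I = {v \<in> verts E. tclass {#(v, 0)#} \<in> I}"

lemma ideal_verts_support:
  assumes I: "Z_order_ideal E I" and a: "a \<in> talented_free E" and "tclass a \<in> I"
  shows "set_mset a \<subseteq> ideal_verts I \<times> UNIV"
proof safe
  fix v i assume "(v, i) \<in># a"
  then obtain b where b: "a = {#(v, i)#} + b" by (metis insert_DiffM add_mset_add_single add.commute)
  then have v: "v \<in> verts E" "b \<in> talented_free E" using a by auto
  then have "tclass {#(v, i)#} \<in> I"
    using order_ideal_divisor[OF I, of "{#(v, i)#}" b] assms(3) b by simp
  then show "v \<in> ideal_verts I"
    using order_ideal_shift[OF I v(1)] v(1) by (simp add: ideal_verts_def)
qed simp

lemma ideal_verts_nonempty:
  assumes I: "Z_order_ideal E I" and ne: "I \<noteq> {\<one>\<^bsub>talented_monoid E\<^esub>}"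
  shows "ideal_verts I \<noteq> {}"
proof -
  have "\<one>\<^bsub>talented_monoid E\<^esub> \<in> I" "I \<subseteq> carrier (talented_monoid E)"
    using I by (auto simp: Z_order_ideal_def submonoid_def)
  moreover from this obtain x where "x \<in> I" "x \<noteq> tclass {#}"
    using ne talented_one by blast
  ultimately obtain a where a: "a \<in> talented_free E" "tclass a \<in> I" "tclass a \<noteq> tclass {#}"
    unfolding talented_carrier by blast
  then have "a \<noteq> {#}" by auto
  then show ?thesis using ideal_verts_support[OF I a(1,2)] by fastforce
qed

lemma ideal_verts_hereditary:
  assumes I: "Z_order_ideal E I"
  shows "hereditary E (ideal_verts I)"
  unfolding hereditary_def
proof (intro conjI ballI impI)
  fix e assume e: "e \<in> arcs E" "tail E e \<in> ideal_verts I"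
  let ?v = "tail E e"
  let ?b = "image_mset (\<lambda>e. (head E e, 0 + 1 :: int)) (mset_set (out_arcs E ?v))"
  have "(({#(?v, 0)#}), ?b) \<in> tcong"
    using e by (intro talented_cong.expand) (auto simp: regular_vertices_def)
  then have "tclass ?b \<in> I" "?b \<in> talented_free E"
    using e talented_cong_in_free equiv_class_eq[OF equiv_talented_cong]
    by (auto simp: ideal_verts_def)
  from ideal_verts_support[OF I this(2,1)] have "(head E e, 1) \<in> ideal_verts I \<times> UNIV"
    using e finite_out_arcs[of ?v] by (auto simp: out_arcs_def)
  then show "head E e \<in> ideal_verts I" by simp
qed (auto simp: ideal_verts_def)

definition supported_classes :: "'v set \<Rightarrow> ('v \<times> int) multiset set set" where
  "supported_classes H = tclass ` {a. set_mset a \<subseteq> saturation E H \<times> UNIV}"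

lemma supported_classes_mem:
  assumes H: "hereditary E H" and a: "a \<in> talented_free E"
  shows "tclass a \<in> supported_classes H \<longleftrightarrow> set_mset a \<subseteq> saturation E H \<times> UNIV"
proof
  assume "tclass a \<in> supported_classes H"
  then obtain b where b: "set_mset b \<subseteq> saturation E H \<times> UNIV" "tclass a = tclass b"
    by (auto simp: supported_classes_def)
  then have "b \<in> talented_free E"
    using hereditary_saturation[OF H] by (auto simp: talented_free_def hereditary_def)
  then have "(a, b) \<in> tcong" using b a tclass_eq_iff by simp
  then show "set_mset a \<subseteq> saturation E H \<times> UNIV"
    using talented_cong_support[OF H] b by simp
qed (simp add: supported_classes_def)

lemma supported_classes_carrier:
  "hereditary E H \<Longrightarrow> supported_classes H \<subseteq> carrier (talented_monoid E)"
  using hereditary_saturation[of H]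
  unfolding supported_classes_def talented_carrier talented_free_def hereditary_def by blast

lemma supported_classes_ideal:
  assumes H: "hereditary E H"
  shows "Z_order_ideal E (supported_classes H)"
  unfolding Z_order_ideal_def
proof (intro conjI allI ballI impI)
  note mem = supported_classes_mem[OF H]
  note sub = supported_classes_carrier[OF H]
  show "submonoid (supported_classes H) (talented_monoid E)"
  proof
    fix x y assume xy: "x \<in> supported_classes H" "y \<in> supported_classes H"
    then obtain a b where "a \<in> talented_free E" "b \<in> talented_free E" "x = tclass a" "y = tclass b"
      using sub by (meson subsetD talented_carrierE)
    then show "x \<otimes>\<^bsub>talented_monoid E\<^esub> y \<in> supported_classes H"
      using xy mem by (simp add: tclass_mult)
  qed (use sub mem[of "{#}"] in \<open>auto simp: talented_one\<close>)
  fix n x assume x: "x \<in> supported_classes H"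
  then obtain a where a: "a \<in> talented_free E" "x = tclass a"
    using sub by (meson subsetD talented_carrierE)
  then have "mshift n a \<in> talented_free E" by (auto simp: talented_free_def)
  then show "talented_shift E n x \<in> supported_classes H"
    using x a mem by (fastforce simp: talented_shift_class)
next
  note mem = supported_classes_mem[OF H]
  note sub = supported_classes_carrier[OF H]
  fix x y assume x: "x \<in> supported_classes H" and y: "y \<in> carrier (talented_monoid E)"
    and "y divides\<^bsub>talented_monoid E\<^esub> x"
  then obtain a b where "a \<in> talented_free E" "b \<in> talented_free E" "y = tclass a" "x = tclass (a + b)"
    by (auto simp: factor_def talented_carrier tclass_mult)
  then show "y \<in> supported_classes H" using x mem by simp
qed

lemma supported_classes_nonzero:
  assumes H: "hereditary E H" and ne: "H \<noteq> {}"
  shows "supported_classes H \<noteq> {\<one>\<^bsub>talented_monoid E\<^esub>}"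
proof -
  obtain v where v: "v \<in> H" "v \<in> verts E" using H ne by (auto simp: hereditary_def)
  then have "tclass {#(v, 0)#} \<in> supported_classes H"
    using supported_classes_mem[OF H, of "{#(v, 0)#}"] by (simp add: saturation.base)
  moreover have "tclass {#(v, 0)#} \<noteq> tclass {#}"
    using v tclass_eq_one_iff[of "{#(v, 0)#}"] by simp
  ultimately show ?thesis by (auto simp: talented_one)
qed

text \<open>
  The generator \<open>v(0)\<close> is congruent to a multiset supported on the vertices of the two ideals; the
  support invariant, read backwards, puts \<open>v\<close> into the saturation of these vertices.
\<close>

lemma talented_splits_imp:
  assumes "talented_decomposable E"
  shows "graph_splits E"
proof -
  obtain I J where I: "Z_order_ideal E I" "I \<noteq> {\<one>\<^bsub>talented_monoid E\<^esub>}"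
    and J: "Z_order_ideal E J" "J \<noteq> {\<one>\<^bsub>talented_monoid E\<^esub>}"
    and sum: "I <#>\<^bsub>talented_monoid E\<^esub> J = carrier (talented_monoid E)"
    and int: "I \<inter> J = {\<one>\<^bsub>talented_monoid E\<^esub>}"
    using assms by (auto simp: talented_decomposable_def)
  let ?H = "ideal_verts I \<union> ideal_verts J"
  have her: "hereditary E ?H"
    using I J by (intro hereditary_Un ideal_verts_hereditary)
  have "ideal_verts I \<inter> ideal_verts J = {}"
  proof (rule ccontr)
    assume "ideal_verts I \<inter> ideal_verts J \<noteq> {}"
    then obtain v where "v \<in> verts E" "tclass {#(v, 0)#} \<in> I \<inter> J"
      by (auto simp: ideal_verts_def)
    then show False using int tclass_eq_one_iff[of "{#(v, 0)#}"] by (simp add: talented_one)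
  qed
  moreover have "v \<in> saturation E ?H" if v: "v \<in> verts E" for v
  proof -
    have "tclass {#(v, 0)#} \<in> I <#>\<^bsub>talented_monoid E\<^esub> J"
      using v by (simp add: sum talented_carrier)
    moreover have "I \<subseteq> carrier (talented_monoid E)" "J \<subseteq> carrier (talented_monoid E)"
      using I J by (auto simp: Z_order_ideal_def submonoid_def)
    ultimately obtain x y where xy: "x \<in> I" "y \<in> J" "x \<in> carrier (talented_monoid E)"
        "y \<in> carrier (talented_monoid E)" "tclass {#(v, 0)#} = x \<otimes>\<^bsub>talented_monoid E\<^esub> y"
      unfolding set_mult_def by blast
    obtain a where a: "a \<in> talented_free E" "x = tclass a" using xy(3) by (rule talented_carrierE)
    obtain b where b: "b \<in> talented_free E" "y = tclass b" using xy(4) by (rule talented_carrierE)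
    have ab: "a \<in> talented_free E" "b \<in> talented_free E"
        "tclass a \<in> I" "tclass b \<in> J" "tclass {#(v, 0)#} = tclass (a + b)"
      using xy a b tclass_mult by auto
    then have "({#(v, 0)#}, a + b) \<in> tcong" using v tclass_eq_iff by simp
    moreover have "set_mset (a + b) \<subseteq> saturation E ?H \<times> UNIV"
      using ideal_verts_support[OF I(1) ab(1,3)] ideal_verts_support[OF J(1) ab(2,4)]
      by (fastforce intro: saturation.base)
    ultimately have "set_mset {#(v, 0 :: int)#} \<subseteq> saturation E ?H \<times> UNIV"
      using talented_cong_support[OF her, of "{#(v, 0)#}" "a + b"] by blast
    then show ?thesis by simp
  qed
  ultimately show ?thesis
    unfolding graph_splits_def
    using ideal_verts_hereditary[OF I(1)] ideal_verts_hereditary[OF J(1)]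
      ideal_verts_nonempty[OF I] ideal_verts_nonempty[OF J] by blast
qed

text \<open>
  A generator \<open>v(i)\<close> with \<open>v\<close> in the saturation of \<open>H \<union> K\<close> can be expanded until only vertices of
  \<open>H \<union> K\<close> remain, which gives the decomposition into a sum; the intersection is trivial because the
  saturations are disjoint.
\<close>

lemma splits_imp_talented:
  assumes "graph_splits E"
  shows "talented_decomposable E"
proof -
  obtain H K where H: "hereditary E H" "H \<noteq> {}" and K: "hereditary E K" "K \<noteq> {}"
    and disj: "H \<inter> K = {}" and sat: "verts E \<subseteq> saturation E (H \<union> K)"
    using assms by (auto simp: graph_splits_def)
  let ?I = "supported_classes H" and ?J = "supported_classes K"
  let ?T = "talented_monoid E"
  have sub: "?I \<subseteq> carrier ?T" "?J \<subseteq> carrier ?T"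
    using supported_classes_carrier H K by auto
  \<comment> \<open>The multisets whose class lies in the sum of the two ideals.\<close>
  define S where "S = {a. \<exists>b c. set_mset b \<subseteq> saturation E H \<times> UNIV \<and>
      set_mset c \<subseteq> saturation E K \<times> UNIV \<and> (a, b + c) \<in> tcong}"
  have S_add: "a + a' \<in> S" if a: "a \<in> S" and a': "a' \<in> S" for a a'
  proof -
    obtain b c where bc: "set_mset b \<subseteq> saturation E H \<times> UNIV"
      "set_mset c \<subseteq> saturation E K \<times> UNIV" "(a, b + c) \<in> tcong"
      using a by (auto simp: S_def)
    obtain b' c' where bc': "set_mset b' \<subseteq> saturation E H \<times> UNIV"
      "set_mset c' \<subseteq> saturation E K \<times> UNIV" "(a', b' + c') \<in> tcong"
      using a' by (auto simp: S_def)
    have "(a + a', (b + b') + (c + c')) \<in> tcong"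
      using talented_cong_add[OF bc(3) bc'(3)] by (simp add: add_ac)
    moreover have "set_mset (b + b') \<subseteq> saturation E H \<times> UNIV"
      "set_mset (c + c') \<subseteq> saturation E K \<times> UNIV" using bc bc' by auto
    ultimately show ?thesis unfolding S_def by blast
  qed
  have S_0: "{#} \<in> S" unfolding S_def
    using talented_cong.refl[of "{#}" E] by (auto intro!: exI[of _ "{#}"])
  have S_v: "{#(v, i)#} \<in> S" if "v \<in> saturation E (H \<union> K)" for v i
    using that
  proof (induction arbitrary: i rule: saturation.induct)
    case (base v)
    have "v \<in> verts E" using base H K by (auto simp: hereditary_def)
    then have r: "({#(v, i)#}, {#(v, i)#}) \<in> tcong" by (intro talented_cong.refl) simp
    from base show ?case
    proof
      assume "v \<in> H"
      then show ?thesis unfolding S_def using r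
        by (intro CollectI exI[of _ "{#(v, i)#}"] exI[of _ "{#}"]) (auto intro: saturation.base)
    next
      assume "v \<in> K"
      then show ?thesis unfolding S_def using r
        by (intro CollectI exI[of _ "{#}"] exI[of _ "{#(v, i)#}"]) (auto intro: saturation.base)
    qed
  next
    case (step v)
    have "image_mset (\<lambda>e. (head E e, i + 1)) (mset_set A) \<in> S" if "A \<subseteq> out_arcs E v" "finite A" for A
      using that(2,1)
    proof (induction A rule: finite_induct)
      case (insert e A)
      then show ?case
        using S_add[OF step.IH[of e "i + 1"], of "image_mset (\<lambda>e. (head E e, i + 1)) (mset_set A)"]
        by simp
    qed (simp add: S_0)
    then have "image_mset (\<lambda>e. (head E e, i + 1)) (mset_set (out_arcs E v)) \<in> S"
      using finite_out_arcs[OF regular_in_verts[OF step.hyps(1)]] by simp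
    then show ?case unfolding S_def
      using talented_cong.trans[OF talented_cong.expand[OF step.hyps(1), of i]] by blast
  qed
  have S_all: "a \<in> S" if "a \<in> talented_free E" for a
    using that
  proof (induction a)
    case (add x a)
    obtain v i where x: "x = (v, i)" by force
    have "{#(v, i)#} \<in> S" using add.prems sat x by (intro S_v) auto
    from S_add[OF this, of a] show ?case using add x by simp
  qed (rule S_0)
  have "?I <#>\<^bsub>?T\<^esub> ?J = carrier ?T"
  proof (rule antisym)
    show "?I <#>\<^bsub>?T\<^esub> ?J \<subseteq> carrier ?T"
      using sub by (force simp: set_mult_def talented_carrier tclass_mult)
    show "carrier ?T \<subseteq> ?I <#>\<^bsub>?T\<^esub> ?J"
    proof
      fix x assume "x \<in> carrier ?T"
      then obtain a where a: "a \<in> talented_free E" "x = tclass a" by (rule talented_carrierE)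
      from S_all[OF a(1)] obtain b c where bc: "set_mset b \<subseteq> saturation E H \<times> UNIV"
          "set_mset c \<subseteq> saturation E K \<times> UNIV" "(a, b + c) \<in> tcong"
        unfolding S_def by blast
      then have f: "b \<in> talented_free E" "c \<in> talented_free E"
        using talented_cong_in_free[OF bc(3)] by simp_all
      have "x = tclass b \<otimes>\<^bsub>?T\<^esub> tclass c"
        using bc a f by (simp add: tclass_mult tclass_eq_iff)
      moreover have "tclass b \<in> ?I" "tclass c \<in> ?J" using bc by (auto simp: supported_classes_def)
      ultimately show "x \<in> ?I <#>\<^bsub>?T\<^esub> ?J" by (auto simp: set_mult_def)
    qed
  qed
  moreover have "?I \<inter> ?J = {\<one>\<^bsub>?T\<^esub>}"
  proof (rule antisym)
    show "{\<one>\<^bsub>?T\<^esub>} \<subseteq> ?I \<inter> ?J"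
      using supported_classes_mem[of H "{#}"] supported_classes_mem[of K "{#}"] H K
      by (simp add: talented_one)
    show "?I \<inter> ?J \<subseteq> {\<one>\<^bsub>?T\<^esub>}"
    proof
      fix x assume x: "x \<in> ?I \<inter> ?J"
      then obtain a where a: "a \<in> talented_free E" "x = tclass a"
        using sub by (meson IntD1 subsetD talented_carrierE)
      then have "set_mset a \<subseteq> saturation E H \<times> UNIV" "set_mset a \<subseteq> saturation E K \<times> UNIV"
        using x supported_classes_mem[OF H(1)] supported_classes_mem[OF K(1)] by auto
      then have "set_mset a \<subseteq> {}"
        using saturation_disjoint[OF H(1) K(1) disj] by blast
      then have "a = {#}" by simp
      then show "x \<in> {\<one>\<^bsub>?T\<^esub>}" using a by (simp add: talented_one)
    qed
  qed
  ultimately show ?thesis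
    unfolding talented_decomposable_def
    using supported_classes_ideal[OF H(1)] supported_classes_ideal[OF K(1)]
      supported_classes_nonzero[OF H] supported_classes_nonzero[OF K] by blast
qed

theorem talented_decomposable_iff: "talented_decomposable E \<longleftrightarrow> graph_splits E"
  using talented_splits_imp splits_imp_talented by blast

end

section \<open>Quotients of rings by ideals\<close>

text \<open>
  \<open>S\<close> is a subring of the ambient ring and need not contain \<open>1\<close>; \<open>K\<close> is a two-sided ideal of \<open>S\<close>.
  Working with congruence modulo \<open>K\<close> in the ambient ring, instead of with classes in the quotient,
  keeps ring arithmetic available to automation. The scalar action \<open>sc\<close> is a parameter because on
  sequences it is taken pointwise.
\<close>

locale ring_quotient =
  fixes S K :: "'r::ring_1 set" and sc :: "'k::ring_1 \<Rightarrow> 'r \<Rightarrow> 'r"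
  assumes S_zero [simp]: "0 \<in> S"
    and S_add [simp]: "x \<in> S \<Longrightarrow> y \<in> S \<Longrightarrow> x + y \<in> S"
    and S_mult [simp]: "x \<in> S \<Longrightarrow> y \<in> S \<Longrightarrow> x * y \<in> S"
    and S_scale [simp]: "x \<in> S \<Longrightarrow> sc c x \<in> S"
    and K_sub: "K \<subseteq> S"
    and K_zero [simp]: "0 \<in> K"
    and K_add: "x \<in> K \<Longrightarrow> y \<in> K \<Longrightarrow> x + y \<in> K"
    and K_scale: "x \<in> K \<Longrightarrow> sc c x \<in> K"
    and K_left: "a \<in> S \<Longrightarrow> x \<in> K \<Longrightarrow> a * x \<in> K"
    and K_right: "a \<in> S \<Longrightarrow> x \<in> K \<Longrightarrow> x * a \<in> K"
    and scale_diff: "sc c (x - y) = sc c x - sc c y"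
    and scale_minus_one: "sc (- 1) x = - x"
    and scale_mult_left: "sc c x * y = sc c (x * y)"
    and scale_mult_right: "x * sc c y = sc c (x * y)"
begin

lemma S_uminus [simp]: "x \<in> S \<Longrightarrow> - x \<in> S"
  using S_scale[of x "- 1"] by (simp add: scale_minus_one)

lemma S_diff [simp]: "x \<in> S \<Longrightarrow> y \<in> S \<Longrightarrow> x - y \<in> S"
  using S_add[of x "- y"] by simp

lemma K_in_S: "x \<in> K \<Longrightarrow> x \<in> S"
  using K_sub by auto

lemma K_uminus: "x \<in> K \<Longrightarrow> - x \<in> K"
  using K_scale[of x "- 1"] by (simp add: scale_minus_one)

lemma K_diff: "x \<in> K \<Longrightarrow> y \<in> K \<Longrightarrow> x - y \<in> K"
  using K_add[of x "- y"] K_uminus[of y] by simp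

lemma K_sum: "(\<And>i. i \<in> A \<Longrightarrow> f i \<in> K) \<Longrightarrow> sum f A \<in> K"
  by (induction A rule: infinite_finite_induct) (auto intro: K_add)

lemma scale_add: "sc c (x + y) = sc c x + sc c y"
proof -
  have "sc c 0 = 0" using scale_diff[of c 0 0] by simp
  then have "sc c (- y) = - sc c y" using scale_diff[of c 0 y] by simp
  then show ?thesis using scale_diff[of c x "- y"] by simp
qed

definition eqK :: "'r \<Rightarrow> 'r \<Rightarrow> bool" (infix "\<approx>" 50) where
  "x \<approx> y \<longleftrightarrow> x - y \<in> K"

lemma eqK_refl [simp]: "x \<approx> x"
  by (simp add: eqK_def)

lemma eqK_sym: "x \<approx> y \<Longrightarrow> y \<approx> x"
  using K_uminus[of "x - y"] by (simp add: eqK_def)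

lemma eqK_trans [trans]: "x \<approx> y \<Longrightarrow> y \<approx> z \<Longrightarrow> x \<approx> z"
  using K_add[of "x - y" "y - z"] by (simp add: eqK_def)

lemma eqK_zero_iff: "x \<approx> 0 \<longleftrightarrow> x \<in> K"
  by (simp add: eqK_def)

lemma eqK_add: "x \<approx> x' \<Longrightarrow> y \<approx> y' \<Longrightarrow> x + y \<approx> x' + y'"
  using K_add[of "x - x'" "y - y'"] by (simp add: eqK_def algebra_simps)

lemma eqK_diff: "x \<approx> x' \<Longrightarrow> y \<approx> y' \<Longrightarrow> x - y \<approx> x' - y'"
  using K_diff[of "x - x'" "y - y'"] by (simp add: eqK_def algebra_simps)

lemma eqK_scale: "x \<approx> y \<Longrightarrow> sc c x \<approx> sc c y"
  using K_scale[of "x - y" c] by (simp add: eqK_def scale_diff)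

lemma eqK_left: "x \<approx> y \<Longrightarrow> a \<in> S \<Longrightarrow> a * x \<approx> a * y"
  using K_left[of a "x - y"] by (simp add: eqK_def algebra_simps)

lemma eqK_right: "x \<approx> y \<Longrightarrow> a \<in> S \<Longrightarrow> x * a \<approx> y * a"
  using K_right[of a "x - y"] by (simp add: eqK_def algebra_simps)

lemma eqK_mult: "x \<approx> x' \<Longrightarrow> y \<approx> y' \<Longrightarrow> y \<in> S \<Longrightarrow> x' \<in> S \<Longrightarrow> x * y \<approx> x' * y'"
  using eqK_trans[OF eqK_right[of x x' y] eqK_left[of y y' x']] by simp

lemma eqK_sum: "(\<And>i. i \<in> A \<Longrightarrow> f i \<approx> g i) \<Longrightarrow> sum f A \<approx> sum g A"
  using K_sum[of A "\<lambda>i. f i - g i"] by (simp add: eqK_def sum_subtractf)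

lemma eqK_in_K: "x \<approx> y \<Longrightarrow> x \<in> K \<longleftrightarrow> y \<in> K"
  by (metis eqK_sym eqK_trans eqK_zero_iff)

definition quotient_cong :: "('r \<times> 'r) set" where
  "quotient_cong = {(x, y). x \<in> S \<and> y \<in> S \<and> x - y \<in> K}"

abbreviation cl :: "'r \<Rightarrow> 'r set" where
  "cl x \<equiv> quotient_cong `` {x}"

lemma equiv_quotient_cong: "equiv S quotient_cong"
proof (rule equivI)
  show "quotient_cong \<subseteq> S \<times> S" by (auto simp: quotient_cong_def)
  show "refl_on S quotient_cong" by (auto simp: refl_on_def quotient_cong_def)
  show "sym quotient_cong"
    by (rule symI) (auto simp: quotient_cong_def simp flip: eqK_def intro: eqK_sym)
  show "trans quotient_cong"
    by (rule transI) (auto simp: quotient_cong_def simp flip: eqK_def intro: eqK_trans)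
qed

lemma cl_eq_iff: "x \<in> S \<Longrightarrow> y \<in> S \<Longrightarrow> cl x = cl y \<longleftrightarrow> x \<approx> y"
  using eq_equiv_class_iff[OF equiv_quotient_cong, of x y] by (simp add: quotient_cong_def eqK_def)

text \<open>
  The ideals of \<open>S\<close> that contain \<open>K\<close>; they correspond to the ideals of \<open>S/K\<close>.
\<close>

definition full_ideal :: "'r set \<Rightarrow> bool" where
  "full_ideal I \<longleftrightarrow> K \<subseteq> I \<and> I \<subseteq> S \<and> (\<forall>x\<in>I. \<forall>y\<in>I. x + y \<in> I) \<and> (\<forall>c. \<forall>x\<in>I. sc c x \<in> I) \<and>
     (\<forall>a\<in>S. \<forall>x\<in>I. a * x \<in> I \<and> x * a \<in> I)"

lemma full_idealD:
  assumes "full_ideal I"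
  shows "x \<in> K \<Longrightarrow> x \<in> I" "x \<in> I \<Longrightarrow> x \<in> S" "x \<in> I \<Longrightarrow> y \<in> I \<Longrightarrow> x + y \<in> I" "x \<in> I \<Longrightarrow> sc c x \<in> I"
    "a \<in> S \<Longrightarrow> x \<in> I \<Longrightarrow> a * x \<in> I" "a \<in> S \<Longrightarrow> x \<in> I \<Longrightarrow> x * a \<in> I"
    "x \<in> I \<Longrightarrow> - x \<in> I" "x \<in> I \<Longrightarrow> y \<in> I \<Longrightarrow> x - y \<in> I"
proof -
  note a = assms[unfolded full_ideal_def]
  show "x \<in> K \<Longrightarrow> x \<in> I" "x \<in> I \<Longrightarrow> x \<in> S" "x \<in> I \<Longrightarrow> sc c x \<in> I"
    "a \<in> S \<Longrightarrow> x \<in> I \<Longrightarrow> a * x \<in> I" "a \<in> S \<Longrightarrow> x \<in> I \<Longrightarrow> x * a \<in> I"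
    using a by auto
  show add: "x \<in> I \<Longrightarrow> y \<in> I \<Longrightarrow> x + y \<in> I" for x y using a by auto
  show um: "x \<in> I \<Longrightarrow> - x \<in> I" for x
    using a scale_minus_one[of x] by metis
  show "x \<in> I \<Longrightarrow> y \<in> I \<Longrightarrow> x - y \<in> I" using add[of x "- y"] um[of y] by simp
qed

lemma full_ideal_eqK: "full_ideal I \<Longrightarrow> x \<approx> y \<Longrightarrow> y \<in> I \<Longrightarrow> x \<in> I"
  using full_idealD(3)[of I "x - y" y] full_idealD(1)[of I "x - y"] by (simp add: eqK_def)

lemma full_ideal_sum: "full_ideal I \<Longrightarrow> (\<And>i. i \<in> A \<Longrightarrow> f i \<in> I) \<Longrightarrow> sum f A \<in> I"
  by (induction A rule: infinite_finite_induct) (auto intro: full_idealD)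

definition ideal_splitting :: "'r set \<Rightarrow> 'r set \<Rightarrow> bool" where
  "ideal_splitting I J \<longleftrightarrow> full_ideal I \<and> full_ideal J \<and> I \<noteq> K \<and> J \<noteq> K \<and>
     (\<forall>x\<in>S. \<exists>a\<in>I. \<exists>b\<in>J. x = a + b) \<and> I \<inter> J = K"

lemma ideal_splitting_sym: "ideal_splitting I J \<Longrightarrow> ideal_splitting J I"
  unfolding ideal_splitting_def by (metis Int_commute add.commute)

end

text \<open>
  The concrete algebras are records of classes. The last parameter of the scheme leaves room for
  the norm and the involution of a C*-algebra.
\<close>

locale quotient_algebra = ring_quotient S K sc
  for S K :: "'r::ring_1 set" and sc :: "'k::ring_1 \<Rightarrow> 'r \<Rightarrow> 'r" +
  fixes A :: "('k, 'r set, 'm) nu_algebra_scheme"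
  assumes carrier_A: "carrier A = S // quotient_cong"
    and zero_A: "alg_zero A = quotient_cong `` {0}"
    and add_A: "alg_add A = quotient_op2 quotient_cong (+)"
    and mult_A: "alg_mult A = quotient_op2 quotient_cong (*)"
    and scale_A: "alg_scale A = (\<lambda>c. quotient_op1 quotient_cong (sc c))"
begin

lemma carrier_A_image: "carrier A = cl ` S"
  by (auto simp: carrier_A quotient_def)

lemma add_cl: "x \<in> S \<Longrightarrow> y \<in> S \<Longrightarrow> alg_add A (cl x) (cl y) = cl (x + y)"
  unfolding add_A
  by (rule quotient_op2_class[OF equiv_quotient_cong])
    (auto simp: quotient_cong_def simp flip: eqK_def intro: eqK_add)

lemma mult_cl: "x \<in> S \<Longrightarrow> y \<in> S \<Longrightarrow> alg_mult A (cl x) (cl y) = cl (x * y)"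
  unfolding mult_A
  by (rule quotient_op2_class[OF equiv_quotient_cong])
    (auto simp: quotient_cong_def simp flip: eqK_def intro: eqK_mult)

lemma scale_cl: "x \<in> S \<Longrightarrow> alg_scale A c (cl x) = cl (sc c x)"
  unfolding scale_A
  by (rule quotient_op1_class[OF equiv_quotient_cong])
    (auto simp: quotient_cong_def simp flip: eqK_def intro: eqK_scale)

definition preim :: "'r set set \<Rightarrow> 'r set" where
  "preim I = {x \<in> S. cl x \<in> I}"

lemma cl_mem_image: "full_ideal I \<Longrightarrow> x \<in> S \<Longrightarrow> cl x \<in> cl ` I \<longleftrightarrow> x \<in> I"
  using cl_eq_iff full_ideal_eqK full_idealD(2) by blast

lemma preim_ideal:
  assumes I: "two_sided_ideal A I"
  shows "full_ideal (preim I)"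
proof -
  have zero: "cl 0 \<in> I" and add: "\<And>X Y. X \<in> I \<Longrightarrow> Y \<in> I \<Longrightarrow> alg_add A X Y \<in> I"
    and scale: "\<And>c X. X \<in> I \<Longrightarrow> alg_scale A c X \<in> I"
    and mult: "\<And>X Y. X \<in> carrier A \<Longrightarrow> Y \<in> I \<Longrightarrow> alg_mult A X Y \<in> I \<and> alg_mult A Y X \<in> I"
    using I unfolding two_sided_ideal_def zero_A by blast+
  have "cl x = cl 0" if "x \<in> K" for x
    using that cl_eq_iff[of x 0] by (simp add: K_in_S eqK_zero_iff)
  then have "K \<subseteq> preim I"
    using zero K_in_S unfolding preim_def by (metis (no_types, lifting) mem_Collect_eq subsetI)
  moreover have "cl (x + y) \<in> I" if "x \<in> S" "y \<in> S" "cl x \<in> I" "cl y \<in> I" for x y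
    using add[of "cl x" "cl y"] that add_cl by simp
  moreover have "cl (sc c x) \<in> I" if "x \<in> S" "cl x \<in> I" for x c
    using scale[of "cl x" c] that scale_cl by simp
  moreover have "cl (a * x) \<in> I \<and> cl (x * a) \<in> I" if "x \<in> S" "cl x \<in> I" "a \<in> S" for x a
    using mult[of "cl a" "cl x"] that mult_cl by (simp add: carrier_A_image)
  ultimately show ?thesis unfolding full_ideal_def preim_def by simp
qed

lemma image_ideal:
  assumes I: "full_ideal I"
  shows "two_sided_ideal A (cl ` I)"
proof -
  note d = full_idealD[OF I]
  have "cl 0 \<in> cl ` I" using d(1) by auto
  moreover have "alg_add A (cl x) (cl y) \<in> cl ` I" if "x \<in> I" "y \<in> I" for x y
    using that d add_cl by auto
  moreover have "alg_scale A c (cl x) \<in> cl ` I" if "x \<in> I" for x c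
    using that d scale_cl by auto
  moreover have "alg_mult A (cl a) (cl x) \<in> cl ` I \<and> alg_mult A (cl x) (cl a) \<in> cl ` I"
    if "x \<in> I" "a \<in> S" for x a
    using that d mult_cl by auto
  moreover have "cl ` I \<subseteq> carrier A"
    unfolding carrier_A_image by (intro image_mono subsetI d(2))
  ultimately show ?thesis
    unfolding two_sided_ideal_def zero_A carrier_A_image by blast
qed

lemma cl_zero_iff: "x \<in> S \<Longrightarrow> cl x = cl 0 \<longleftrightarrow> x \<in> K"
  using cl_eq_iff[of x 0] by (simp add: eqK_zero_iff)

lemma splitting_preim:
  assumes I: "two_sided_ideal A I" "I \<noteq> {alg_zero A}" and J: "two_sided_ideal A J" "J \<noteq> {alg_zero A}"
    and sum: "direct_sum_of A I J"
  shows "ideal_splitting (preim I) (preim J)"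
proof -
  have ne: "preim I \<noteq> K" if nz: "two_sided_ideal A I" "I \<noteq> {alg_zero A}" for I
  proof
    assume eq: "preim I = K"
    have sub: "I \<subseteq> cl ` S" "cl 0 \<in> I"
      using nz(1) by (simp_all add: two_sided_ideal_def carrier_A_image zero_A)
    then obtain X where X: "X \<in> I" "X \<noteq> cl 0" using nz(2) unfolding zero_A by blast
    then obtain x where x: "x \<in> S" "X = cl x" using sub by blast
    then have "x \<in> K" using X eq by (auto simp: preim_def)
    then show False using X x cl_zero_iff by simp
  qed
  have "\<exists>a\<in>preim I. \<exists>b\<in>preim J. x = a + b" if x: "x \<in> S" for x
  proof -
    have "cl x \<in> carrier A" using x by (simp add: carrier_A_image)
    then obtain a b where ab: "a \<in> I" "b \<in> J" "cl x = alg_add A a b"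
      using sum by (auto simp: direct_sum_of_def)
    moreover have "I \<subseteq> cl ` S" "J \<subseteq> cl ` S"
      using I J by (auto simp: two_sided_ideal_def carrier_A_image)
    ultimately obtain a' b' where ab': "a' \<in> S" "a = cl a'" "b' \<in> S" "b = cl b'" by blast
    then have "x \<approx> a' + b'" using ab x add_cl cl_eq_iff by simp
    then have "cl (x - b') = cl a'"
      using x ab' by (subst cl_eq_iff) (auto simp: eqK_def algebra_simps)
    then have "x - b' \<in> preim I" "b' \<in> preim J" using ab ab' x by (auto simp: preim_def)
    then show ?thesis by (metis diff_add_cancel)
  qed
  moreover have "preim I \<inter> preim J = K"
  proof -
    have "I \<inter> J = {cl 0}" using sum by (simp add: direct_sum_of_def zero_A)
    then have "x \<in> preim I \<inter> preim J \<longleftrightarrow> x \<in> S \<and> cl x = cl 0" for x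
      unfolding preim_def by (metis (no_types, lifting) IntI IntD1 IntD2 mem_Collect_eq singleton_iff)
    then have "x \<in> preim I \<inter> preim J \<longleftrightarrow> x \<in> K" for x
      using cl_zero_iff[of x] K_in_S[of x] by metis
    then show ?thesis by blast
  qed
  ultimately show ?thesis
    unfolding ideal_splitting_def using preim_ideal I J ne by blast
qed

lemma splitting_image:
  assumes "ideal_splitting I J"
  shows "cl ` I \<noteq> {alg_zero A}" "cl ` J \<noteq> {alg_zero A}" "direct_sum_of A (cl ` I) (cl ` J)"
proof -
  have I: "full_ideal I" "I \<noteq> K" and J: "full_ideal J" "J \<noteq> K"
    and sum: "\<And>x. x \<in> S \<Longrightarrow> \<exists>a\<in>I. \<exists>b\<in>J. x = a + b" and int: "I \<inter> J = K"
    using assms by (auto simp: ideal_splitting_def)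
  have ne: "cl ` I \<noteq> {alg_zero A}" if I: "full_ideal I" "I \<noteq> K" for I
  proof -
    obtain x where "x \<in> I" "x \<notin> K" using I full_idealD(1)[OF I(1)] by blast
    then have "cl x \<noteq> cl 0" using cl_zero_iff[of x] full_idealD(2)[OF I(1), of x] by simp
    then show ?thesis using \<open>x \<in> I\<close> unfolding zero_A by (metis imageI singletonD)
  qed
  show "cl ` I \<noteq> {alg_zero A}" "cl ` J \<noteq> {alg_zero A}" using ne I J by auto
  have "carrier A = {alg_add A x y | x y. x \<in> cl ` I \<and> y \<in> cl ` J}"
  proof (intro equalityI subsetI)
    fix X assume "X \<in> carrier A"
    then obtain x where x: "x \<in> S" "X = cl x" by (auto simp: carrier_A_image)
    then obtain a b where "a \<in> I" "b \<in> J" "x = a + b" using sum by blast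
    then show "X \<in> {alg_add A x y | x y. x \<in> cl ` I \<and> y \<in> cl ` J}"
      using x add_cl full_idealD(2)[OF I(1)] full_idealD(2)[OF J(1)] by blast
  next
    fix X assume "X \<in> {alg_add A x y | x y. x \<in> cl ` I \<and> y \<in> cl ` J}"
    then obtain a b where "a \<in> I" "b \<in> J" "X = alg_add A (cl a) (cl b)" by blast
    then show "X \<in> carrier A"
      using add_cl full_idealD(2)[OF I(1), of a] full_idealD(2)[OF J(1), of b]
      by (simp add: carrier_A_image)
  qed
  moreover have "cl ` I \<inter> cl ` J = {alg_zero A}"
  proof (intro equalityI subsetI)
    fix X assume X: "X \<in> cl ` I \<inter> cl ` J"
    then obtain x where x: "x \<in> I" "X = cl x" by blast
    then have "x \<in> J" using X cl_mem_image[OF J(1), of x] full_idealD(2)[OF I(1)] by blast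
    then have "x \<in> K" using x int by blast
    then show "X \<in> {alg_zero A}" using x cl_zero_iff K_in_S by (simp add: zero_A)
  next
    fix X assume "X \<in> {alg_zero A}"
    then show "X \<in> cl ` I \<inter> cl ` J"
      using full_idealD(1)[OF I(1), of 0] full_idealD(1)[OF J(1), of 0] by (auto simp: zero_A)
  qed
  ultimately show "direct_sum_of A (cl ` I) (cl ` J)" by (simp add: direct_sum_of_def)
qed

theorem decomposable_iff_splitting:
  "decomposable_algebra A \<longleftrightarrow> (\<exists>I J. ideal_splitting I J)"
proof
  assume "decomposable_algebra A"
  then obtain I J where "two_sided_ideal A I" "I \<noteq> {alg_zero A}"
      "two_sided_ideal A J" "J \<noteq> {alg_zero A}" "direct_sum_of A I J"
    unfolding decomposable_algebra_def by (elim exE conjE) (rule that)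
  from splitting_preim[OF this] show "\<exists>I J. ideal_splitting I J" by blast
next
  assume "\<exists>I J. ideal_splitting I J"
  then obtain I J where IJ: "ideal_splitting I J" by blast
  then have "full_ideal I" "full_ideal J" by (simp_all add: ideal_splitting_def)
  from this[THEN image_ideal] splitting_image[OF IJ] show "decomposable_algebra A"
    unfolding decomposable_algebra_def
    by (intro exI[of _ "cl ` I"] exI[of _ "cl ` J"] conjI)
qed

end

section \<open>Cuntz--Krieger families modulo an ideal\<close>

text \<open>
  The relations of a Leavitt path algebra, read modulo \<open>K\<close>. For row-finite graphs the Cuntz--Krieger
  relations of a C*-algebra imply them with \<open>t e = s e\<^sup>*\<close>, so that both algebras are instances.
\<close>

locale ck_relations = ring_quotient S K sc + row_finite_graph E
  for S K :: "'r::ring_1 set" and sc :: "'k::field \<Rightarrow> 'r \<Rightarrow> 'r"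
    and E :: "('v, 'e) pre_digraph" +
  fixes p :: "'v \<Rightarrow> 'r" and s t :: "'e \<Rightarrow> 'r"
  assumes p_in [simp]: "v \<in> verts E \<Longrightarrow> p v \<in> S"
    and s_in [simp]: "e \<in> arcs E \<Longrightarrow> s e \<in> S"
    and t_in [simp]: "e \<in> arcs E \<Longrightarrow> t e \<in> S"
    and p_mult: "v \<in> verts E \<Longrightarrow> w \<in> verts E \<Longrightarrow> p v * p w \<approx> (if v = w then p v else 0)"
    and tail_s: "e \<in> arcs E \<Longrightarrow> p (tail E e) * s e \<approx> s e"
    and s_head: "e \<in> arcs E \<Longrightarrow> s e * p (head E e) \<approx> s e"
    and head_t: "e \<in> arcs E \<Longrightarrow> p (head E e) * t e \<approx> t e"
    and t_tail: "e \<in> arcs E \<Longrightarrow> t e * p (tail E e) \<approx> t e"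
    and t_s: "e \<in> arcs E \<Longrightarrow> f \<in> arcs E \<Longrightarrow> t e * s f \<approx> (if e = f then p (head E e) else 0)"
    and ck: "v \<in> regular_vertices E \<Longrightarrow> p v \<approx> (\<Sum>e\<in>out_arcs E v. s e * t e)"

text \<open>
  Nonzero vertices and a weak form of local units: an element killed by all vertices from the left is
  zero. In the completion only approximate units exist, but this property survives.
\<close>

locale ck_family = ck_relations S K sc E p s t
  for S K :: "'r::ring_1 set" and sc :: "'k::field \<Rightarrow> 'r \<Rightarrow> 'r"
    and E :: "('v, 'e) pre_digraph" and p s t +
  assumes p_not_in_K: "v \<in> verts E \<Longrightarrow> p v \<notin> K"
    and nondegenerate: "x \<in> S \<Longrightarrow> (\<And>v. v \<in> verts E \<Longrightarrow> p v * x \<in> K) \<Longrightarrow> x \<in> K"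
begin

lemma p_idem: "v \<in> verts E \<Longrightarrow> p v * p v \<approx> p v"
  using p_mult[of v v] by simp

text \<open>
  The end point \<open>u\<close> of the walk is an argument, as the empty walk does not determine it.
\<close>

primrec walk_s :: "'e list \<Rightarrow> 'v \<Rightarrow> 'r" where
  "walk_s [] u = p u"
| "walk_s (e # \<alpha>) u = s e * walk_s \<alpha> u"

primrec walk_t :: "'e list \<Rightarrow> 'v \<Rightarrow> 'r" where
  "walk_t [] u = p u"
| "walk_t (e # \<alpha>) u = walk_t \<alpha> u * t e"

lemma walk_in [simp]:
  assumes "awalk v \<alpha> u"
  shows "walk_s \<alpha> u \<in> S" "walk_t \<alpha> u \<in> S"
  using assms by (induction \<alpha> arbitrary: v) (auto simp: awalk_Cons_iff awalk_Nil_iff)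

lemma awalk_verts_ends: "awalk v \<alpha> u \<Longrightarrow> v \<in> verts E \<and> u \<in> verts E"
  by (simp add: awalk_hd_in_verts awalk_last_in_verts)

lemma p_walk_s: "awalk v \<alpha> u \<Longrightarrow> p v * walk_s \<alpha> u \<approx> walk_s \<alpha> u"
proof (cases \<alpha>)
  case (Cons e \<beta>)
  assume "awalk v \<alpha> u"
  then have "awalk (head E e) \<beta> u" "e \<in> arcs E" "v = tail E e"
    using Cons by (auto simp: awalk_Cons_iff)
  then show ?thesis using Cons eqK_right[OF tail_s, of e "walk_s \<beta> u"] by (simp add: mult.assoc)
qed (auto simp: awalk_Nil_iff p_idem)

lemma walk_t_p: "awalk v \<alpha> u \<Longrightarrow> walk_t \<alpha> u * p v \<approx> walk_t \<alpha> u"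
proof (cases \<alpha>)
  case (Cons e \<beta>)
  assume "awalk v \<alpha> u"
  then have "awalk (head E e) \<beta> u" "e \<in> arcs E" "v = tail E e"
    using Cons by (auto simp: awalk_Cons_iff)
  then show ?thesis using Cons eqK_left[OF t_tail, of e "walk_t \<beta> u"] by (simp add: mult.assoc)
qed (auto simp: awalk_Nil_iff p_idem)

lemma walk_s_p: "awalk v \<alpha> u \<Longrightarrow> walk_s \<alpha> u * p u \<approx> walk_s \<alpha> u"
proof (induction \<alpha> arbitrary: v)
  case (Cons e \<alpha>)
  then have "awalk (head E e) \<alpha> u" "e \<in> arcs E" by (auto simp: awalk_Cons_iff)
  then show ?case using eqK_left[OF Cons.IH, of "head E e" "s e"] by (simp add: mult.assoc)
qed (auto simp: awalk_Nil_iff p_idem)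

lemma p_mult_K: "v \<in> verts E \<Longrightarrow> w \<in> verts E \<Longrightarrow> v \<noteq> w \<Longrightarrow> p v * p w \<in> K"
  using p_mult[of v w] by (simp add: eqK_zero_iff)

lemma p_walk_s_K:
  assumes "awalk v \<alpha> u" "w \<in> verts E" "w \<noteq> v"
  shows "p w * walk_s \<alpha> u \<in> K"
proof -
  have v: "v \<in> verts E" using assms awalk_verts_ends by auto
  have "p w * walk_s \<alpha> u \<approx> p w * (p v * walk_s \<alpha> u)"
    using eqK_sym[OF eqK_left[OF p_walk_s]] assms by simp
  moreover have "p w * (p v * walk_s \<alpha> u) \<in> K"
    using K_right[OF walk_in(1) p_mult_K[OF assms(2) v]] assms by (simp add: mult.assoc)
  ultimately show ?thesis using eqK_in_K by blast
qed

lemma walk_t_p_K: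
  assumes "awalk v \<alpha> u" "w \<in> verts E" "w \<noteq> v"
  shows "walk_t \<alpha> u * p w \<in> K"
proof -
  have v: "v \<in> verts E" using assms awalk_verts_ends by auto
  have "walk_t \<alpha> u * p w \<approx> walk_t \<alpha> u * p v * p w"
    using eqK_sym[OF eqK_right[OF walk_t_p]] assms by simp
  moreover have "walk_t \<alpha> u * p v * p w \<in> K"
    using K_left[OF walk_in(2) p_mult_K[OF v assms(2)]] assms by (simp add: mult.assoc)
  ultimately show ?thesis using eqK_in_K by blast
qed

lemma walk_t_s_cancel:
  assumes "e \<in> arcs E" "awalk (head E e) \<alpha> u" "awalk (head E e) \<beta> w"
  shows "walk_t (e # \<alpha>) u * walk_s (e # \<beta>) w \<approx> walk_t \<alpha> u * walk_s \<beta> w"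
proof -
  have "walk_t (e # \<alpha>) u * walk_s (e # \<beta>) w = walk_t \<alpha> u * ((t e * s e) * walk_s \<beta> w)"
    by (simp add: mult.assoc)
  also have "\<dots> \<approx> walk_t \<alpha> u * (p (head E e) * walk_s \<beta> w)"
    using assms t_s[of e e] by (intro eqK_left eqK_right) auto
  also have "\<dots> \<approx> walk_t \<alpha> u * walk_s \<beta> w"
    using assms by (intro eqK_left p_walk_s) auto
  finally show ?thesis .
qed

text \<open>
  The first of three rules for \<open>t\<^sub>\<alpha> s\<^sub>\<beta>\<close>. Cancelling edge by edge from the middle, the
  product reduces to the part by which one walk exceeds the other, and vanishes if neither is a prefix
  of the other.
\<close>

lemma walk_t_s_append:
  "awalk v \<alpha> u \<Longrightarrow> awalk u \<delta> w \<Longrightarrow> walk_t \<alpha> u * walk_s (\<alpha> @ \<delta>) w \<approx> walk_s \<delta> w"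
proof (induction \<alpha> arbitrary: v)
  case (Cons e \<alpha>)
  then have a: "awalk (head E e) \<alpha> u" "e \<in> arcs E" by (auto simp: awalk_Cons_iff)
  then have "awalk (head E e) (\<alpha> @ \<delta>) w" using Cons.prems(2) by (simp add: awalk_appendI)
  from eqK_trans[OF walk_t_s_cancel[OF a(2,1) this] Cons.IH[OF a(1) Cons.prems(2)]]
  show ?case by simp
qed (simp add: p_walk_s awalk_Nil_iff)

lemma walk_t_append_s:
  "awalk v \<alpha> u \<Longrightarrow> awalk u \<delta> w \<Longrightarrow> walk_t (\<alpha> @ \<delta>) w * walk_s \<alpha> u \<approx> walk_t \<delta> w"
proof (induction \<alpha> arbitrary: v)
  case (Cons e \<alpha>)
  then have a: "awalk (head E e) \<alpha> u" "e \<in> arcs E" by (auto simp: awalk_Cons_iff)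
  then have "awalk (head E e) (\<alpha> @ \<delta>) w" using Cons.prems(2) by (simp add: awalk_appendI)
  from eqK_trans[OF walk_t_s_cancel[OF a(2) this a(1)] Cons.IH[OF a(1) Cons.prems(2)]]
  show ?case by simp
qed (simp add: walk_t_p awalk_Nil_iff)

lemma walk_t_s_incomparable:
  "awalk v \<alpha> u \<Longrightarrow> awalk v' \<beta> w \<Longrightarrow> \<not> prefix \<alpha> \<beta> \<Longrightarrow> \<not> prefix \<beta> \<alpha> \<Longrightarrow> walk_t \<alpha> u * walk_s \<beta> w \<in> K"
proof (induction \<alpha> arbitrary: v v' \<beta>)
  case (Cons e \<alpha>)
  then obtain f \<gamma> where \<beta>: "\<beta> = f # \<gamma>" by (cases \<beta>) auto
  have a: "awalk (head E e) \<alpha> u" "e \<in> arcs E" "awalk (head E f) \<gamma> w" "f \<in> arcs E"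
    using Cons.prems \<beta> by (auto simp: awalk_Cons_iff)
  show ?case
  proof (cases "e = f")
    case True
    then have "walk_t \<alpha> u * walk_s \<gamma> w \<in> K" using Cons.prems Cons.IH a \<beta> by auto
    then show ?thesis using walk_t_s_cancel[OF a(2,1)] a True \<beta> eqK_in_K by blast
  next
    case False
    then have "t e * s f \<in> K" using t_s[of e f] a by (simp add: eqK_zero_iff)
    then have "walk_t \<alpha> u * ((t e * s f) * walk_s \<gamma> w) \<in> K"
      using a by (intro K_left[OF _ K_right]) auto
    then show ?thesis by (simp add: \<beta> mult.assoc)
  qed
qed simp

lemma walk_t_s_diff_start:
  assumes "awalk v \<alpha> u" "awalk v' \<beta> w" "v \<noteq> v'"
  shows "walk_t \<alpha> u * walk_s \<beta> w \<in> K"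
proof -
  have v: "v \<in> verts E" using assms awalk_verts_ends by auto
  have "walk_t \<alpha> u * walk_s \<beta> w \<approx> walk_t \<alpha> u * p v * walk_s \<beta> w"
    using assms by (intro eqK_right[OF eqK_sym[OF walk_t_p]]) auto
  moreover have "walk_t \<alpha> u * p v * walk_s \<beta> w \<in> K"
    using K_left[OF walk_in(2)[OF assms(1)] p_walk_s_K[OF assms(2) v assms(3)]]
    by (simp add: mult.assoc)
  ultimately show ?thesis using eqK_in_K by blast
qed

lemma walk_t_s_self: "awalk v \<alpha> u \<Longrightarrow> walk_t \<alpha> u * walk_s \<alpha> u \<approx> p u"
  using walk_t_s_append[of v \<alpha> u "[]" u] awalk_verts_ends by (simp add: awalk_Nil_iff)

lemma full_ideal_head:
  assumes I: "full_ideal I" and e: "e \<in> arcs E" and "p (tail E e) \<in> I"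
  shows "p (head E e) \<in> I"
proof -
  have "p (head E e) \<approx> t e * s e" using t_s[of e e] e by (simp add: eqK_sym)
  also have "\<dots> \<approx> t e * (p (tail E e) * s e)" using e by (intro eqK_left eqK_sym[OF tail_s]) auto
  finally have "p (head E e) \<approx> t e * (p (tail E e) * s e)" .
  moreover have "t e * (p (tail E e) * s e) \<in> I"
    using full_idealD(5,6)[OF I] e assms(3) by simp
  ultimately show ?thesis by (rule full_ideal_eqK[OF I])
qed

lemma full_ideal_s: "full_ideal I \<Longrightarrow> e \<in> arcs E \<Longrightarrow> p (head E e) \<in> I \<Longrightarrow> s e \<in> I"
  by (rule full_ideal_eqK[OF _ eqK_sym[OF s_head]]) (auto intro: full_idealD)

lemma full_ideal_t: "full_ideal I \<Longrightarrow> e \<in> arcs E \<Longrightarrow> p (head E e) \<in> I \<Longrightarrow> t e \<in> I"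
  by (rule full_ideal_eqK[OF _ eqK_sym[OF head_t]]) (auto intro: full_idealD)

lemma full_ideal_regular:
  assumes I: "full_ideal I" and v: "v \<in> regular_vertices E"
    and h: "\<And>e. e \<in> out_arcs E v \<Longrightarrow> p (head E e) \<in> I"
  shows "p v \<in> I"
proof -
  have "s e * t e \<in> I" if "e \<in> out_arcs E v" for e
    using that h[OF that] full_ideal_s[OF I] full_idealD(6)[OF I] by simp
  then show ?thesis using full_ideal_eqK[OF I ck[OF v] full_ideal_sum[OF I]] by blast
qed

text \<open>
  The vertices in an ideal form a saturated set, by the relation \<open>p v = \<Sum> s e * t e\<close>.
\<close>

lemma full_ideal_saturation:
  assumes I: "full_ideal I" and H: "\<And>v. v \<in> H \<Longrightarrow> p v \<in> I"
  shows "v \<in> saturation E H \<Longrightarrow> p v \<in> I"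
  by (induction rule: saturation.induct) (blast intro: H full_ideal_regular[OF I])+

definition ideal_part :: "'r set \<Rightarrow> 'r set \<Rightarrow> 'r \<Rightarrow> 'r \<Rightarrow> bool" where
  "ideal_part I J x a \<longleftrightarrow> a \<in> I \<and> x - a \<in> J"

context
  fixes I J
  assumes split: "ideal_splitting I J"
begin

lemma split_ideals: "full_ideal I" "full_ideal J" and split_Int: "x \<in> I \<Longrightarrow> x \<in> J \<Longrightarrow> x \<in> K"
  using split by (auto simp: ideal_splitting_def)

lemma part_ex: "x \<in> S \<Longrightarrow> \<exists>a. ideal_part I J x a"
proof -
  assume "x \<in> S"
  then obtain a b where "a \<in> I" "b \<in> J" "x = a + b"
    using split unfolding ideal_splitting_def by blast
  then show ?thesis by (auto simp: ideal_part_def intro!: exI[of _ a])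
qed

text \<open>
  Components are unique modulo \<open>K\<close> because \<open>I \<inter> J = K\<close>. This is the source of all identities below:
  an identity for \<open>p\<close> passes to the components as soon as both sides are seen to have them.
\<close>

lemma part_unique:
  assumes "ideal_part I J x a" "ideal_part I J x' a'" "x \<approx> x'"
  shows "a \<approx> a'"
proof -
  have "a - a' \<in> I" using assms full_idealD(8)[OF split_ideals(1)] by (auto simp: ideal_part_def)
  moreover have "a - a' = (x - x') - (x - a) + (x' - a')" by simp
  moreover have "x - x' \<in> J" using assms full_idealD(1)[OF split_ideals(2)] by (simp add: eqK_def)
  ultimately show ?thesis
    using split_Int assms full_idealD(3,8)[OF split_ideals(2)] unfolding eqK_def ideal_part_def by metis
qed

lemma part_left: "ideal_part I J x a \<Longrightarrow> c \<in> S \<Longrightarrow> ideal_part I J (c * x) (c * a)"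
  using full_idealD(5)[OF split_ideals(1), of c a] full_idealD(5)[OF split_ideals(2), of c "x - a"]
  by (auto simp: ideal_part_def algebra_simps)

lemma part_right: "ideal_part I J x a \<Longrightarrow> c \<in> S \<Longrightarrow> ideal_part I J (x * c) (a * c)"
  using full_idealD(6)[OF split_ideals(1), of c a] full_idealD(6)[OF split_ideals(2), of c "x - a"]
  by (auto simp: ideal_part_def algebra_simps)

lemma part_in_S: "ideal_part I J x a \<Longrightarrow> a \<in> S"
  using full_idealD(2)[OF split_ideals(1)] by (auto simp: ideal_part_def)

lemma part_mult:
  assumes "ideal_part I J x a" "ideal_part I J y b" "y \<in> S"
  shows "ideal_part I J (x * y) (a * b)"
proof -
  have "x * y - a * b = (x - a) * y + a * (y - b)" by (simp add: algebra_simps)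
  moreover have "(x - a) * y \<in> J" "a * (y - b) \<in> J" "a * b \<in> I"
    using assms part_in_S full_idealD(5,6)[OF split_ideals(2)] full_idealD(5)[OF split_ideals(1)]
    by (auto simp: ideal_part_def)
  ultimately show ?thesis using full_idealD(3)[OF split_ideals(2)] by (auto simp: ideal_part_def)
qed

lemma part_p_idem:
  assumes "v \<in> verts E" "ideal_part I J (p v) a"
  shows "a * a \<approx> a" "p v * a \<approx> a" "a * p v \<approx> a"
  using part_unique[OF part_mult[OF assms(2,2)] assms(2) p_idem[OF assms(1)]]
    part_unique[OF part_left[OF assms(2), of "p v"] assms(2) p_idem[OF assms(1)]]
    part_unique[OF part_right[OF assms(2), of "p v"] assms(2) p_idem[OF assms(1)]] assms by auto

text \<open>
  Compressing by a walk carries the component of \<open>p v\<close> to the component of \<open>p w\<close>, since the two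
  ideals are invariant under multiplication from both sides and \<open>t\<^sub>\<gamma> p\<^sub>v s\<^sub>\<gamma> = p\<^sub>w\<close>.
\<close>

lemma part_transport:
  assumes "awalk v \<gamma> w" "ideal_part I J (p v) a" "ideal_part I J (p w) b"
  shows "walk_t \<gamma> w * a * walk_s \<gamma> w \<approx> b"
proof (rule part_unique[OF _ assms(3)])
  show "ideal_part I J (walk_t \<gamma> w * p v * walk_s \<gamma> w) (walk_t \<gamma> w * a * walk_s \<gamma> w)"
    using assms by (intro part_right part_left) auto
  have "walk_t \<gamma> w * p v * walk_s \<gamma> w \<approx> walk_t \<gamma> w * walk_s \<gamma> w"
    using assms by (intro eqK_right[OF walk_t_p]) auto
  also have "\<dots> \<approx> p w" using assms by (intro walk_t_s_self)
  finally show "walk_t \<gamma> w * p v * walk_s \<gamma> w \<approx> p w" .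
qed

lemma part_zero_imp: "ideal_part I J (p w) a \<Longrightarrow> a \<in> K \<Longrightarrow> p w \<in> J"
  using full_idealD(3)[OF split_ideals(2), of "p w - a" a] full_idealD(1)[OF split_ideals(2), of a]
  by (simp add: ideal_part_def)

lemma part_one_imp: "ideal_part I J (p w) a \<Longrightarrow> p w \<approx> a \<Longrightarrow> p w \<in> I"
  using full_ideal_eqK[OF split_ideals(1)] by (auto simp: ideal_part_def)

definition vertices_in :: "'r set \<Rightarrow> 'v set" where
  "vertices_in M = {v \<in> verts E. p v \<in> M}"

text \<open>
  What the study of closed walks yields enters as the assumption \<open>cover\<close>. At a sink only
  the empty walk exists, hence the requirement that \<open>n\<close> be \<open>0\<close> there. Neither set of vertices is empty:
  otherwise all vertices would lie in one ideal, and the other ideal, being annihilated by them, would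
  be zero.
\<close>

lemma splitting_imp_graph_splits:
  assumes cover: "\<And>v. v \<in> verts E \<Longrightarrow> \<exists>n. (out_arcs E v = {} \<longrightarrow> n = 0) \<and>
      (\<forall>\<gamma> w. awalk v \<gamma> w \<and> length \<gamma> = n \<longrightarrow> p w \<in> I \<or> p w \<in> J)"
  shows "graph_splits E"
proof -
  let ?H = "vertices_in I" and ?L = "vertices_in J"
  have her: "hereditary E (vertices_in M)" if "full_ideal M" for M
    unfolding hereditary_def vertices_in_def using full_ideal_head[OF that] by auto
  have disj: "?H \<inter> ?L = {}"
    using split_Int p_not_in_K by (auto simp: vertices_in_def)
  have sat: "v \<in> saturation E (?H \<union> ?L)" if v: "v \<in> verts E" for v
  proof (rule ccontr)
    let ?U = "saturation E (?H \<union> ?L)"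
    assume nv: "v \<notin> ?U"
    have in_U: "w \<in> ?U" if "w \<in> verts E" "p w \<in> I \<or> p w \<in> J" for w
      using that by (auto simp: vertices_in_def intro: saturation.base)
    \<comment> \<open>Outside the saturation no vertex is a sink, so one can walk on outside it for ever.\<close>
    have escape: "\<exists>\<gamma> w. awalk v \<gamma> w \<and> length \<gamma> = n \<and> w \<notin> ?U" if "v \<in> verts E" "v \<notin> ?U" for v n
      using that
    proof (induction n arbitrary: v)
      case 0
      then show ?case by (intro exI[of _ "[]"]) (auto simp: awalk_Nil_iff)
    next
      case (Suc n)
      have "v \<in> regular_vertices E"
      proof (rule ccontr)
        assume "v \<notin> regular_vertices E"
        then have "out_arcs E v = {}" using Suc.prems(1) by (simp add: regular_vertices_def)
        then have "\<forall>\<gamma> w. awalk v \<gamma> w \<and> length \<gamma> = 0 \<longrightarrow> p w \<in> I \<or> p w \<in> J"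
          using cover[OF Suc.prems(1)] by metis
        then have "p v \<in> I \<or> p v \<in> J" using Suc.prems(1) by (simp add: awalk_Nil_iff)
        then show False using in_U Suc.prems by blast
      qed
      then obtain e where e: "e \<in> out_arcs E v" "head E e \<notin> ?U"
        using saturation.step Suc.prems(2) by metis
      then have "e \<in> arcs E" "tail E e = v" by auto
      then obtain \<gamma> w where "awalk (head E e) \<gamma> w" "length \<gamma> = n" "w \<notin> ?U"
        using Suc.IH[of "head E e"] e by auto
      then show ?case
        using \<open>e \<in> arcs E\<close> \<open>tail E e = v\<close>
        by (intro exI[of _ "e # \<gamma>"] exI[of _ w]) (auto simp: awalk_Cons_iff)
    qed
    obtain n where n: "\<forall>\<gamma> w. awalk v \<gamma> w \<and> length \<gamma> = n \<longrightarrow> p w \<in> I \<or> p w \<in> J"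
      using cover[OF v] by blast
    obtain \<gamma> w where "awalk v \<gamma> w" "length \<gamma> = n" "w \<notin> ?U" using escape[OF v nv] by blast
    then show False using n in_U awalk_verts_ends by blast
  qed
  have ne: "vertices_in M \<noteq> {}"
    if M: "ideal_splitting M N" and cov: "verts E \<subseteq> saturation E (vertices_in M \<union> vertices_in N)" for M N
  proof
    assume "vertices_in M = {}"
    then have cov': "verts E \<subseteq> saturation E (vertices_in N)" using cov by simp
    have MN: "full_ideal M" "full_ideal N" "M \<inter> N = K" "M \<noteq> K"
      using M by (auto simp: ideal_splitting_def)
    have pN: "p v \<in> N" if "v \<in> verts E" for v
      using full_ideal_saturation[OF MN(2), of "vertices_in N" v] cov' that
      by (auto simp: vertices_in_def)
    have "x \<in> K" if "x \<in> M" for x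
    proof (rule nondegenerate)
      show "x \<in> S" using that full_idealD(2)[OF MN(1)] by simp
      fix v assume "v \<in> verts E"
      then show "p v * x \<in> K"
        using that MN(3) full_idealD(2,5)[OF MN(1)] full_idealD(6)[OF MN(2)] pN by fastforce
    qed
    then show False using MN(4) full_idealD(1)[OF MN(1)] by blast
  qed
  have "?H \<noteq> {}" using ne[OF split] sat by blast
  moreover have "?L \<noteq> {}" using ne[OF ideal_splitting_sym[OF split]] sat by (simp add: Un_commute subset_iff)
  ultimately show ?thesis
    unfolding graph_splits_def using her[OF split_ideals(1)] her[OF split_ideals(2)] disj sat by blast
qed

end

text \<open>
  Defined by \<open>p\<^sub>w S x \<subseteq> K\<close> rather than as an ideal generated by vertices: annihilators are
  two-sided ideals without taking spans, and in a completion they are closed.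
\<close>

definition annihilator :: "'v set \<Rightarrow> 'r set" where
  "annihilator H = {x \<in> S. \<forall>w\<in>H. \<forall>a\<in>S. p w * (a * x) \<in> K}"

lemma annihilator_ideal:
  assumes "H \<subseteq> verts E"
  shows "full_ideal (annihilator H)"
  unfolding full_ideal_def
proof (intro conjI ballI allI)
  show "K \<subseteq> annihilator H" using K_left K_in_S assms by (auto simp: annihilator_def)
  show "annihilator H \<subseteq> S" by (auto simp: annihilator_def)
  show "x + y \<in> annihilator H" if "x \<in> annihilator H" "y \<in> annihilator H" for x y
    using that K_add by (auto simp: annihilator_def algebra_simps)
  show "sc c x \<in> annihilator H" if "x \<in> annihilator H" for c x
    using that K_scale by (auto simp: annihilator_def scale_mult_right)
  fix a x assume a: "a \<in> S" and x: "x \<in> annihilator H"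
  have "p w * (b * (a * x)) \<in> K" if "w \<in> H" "b \<in> S" for w b
  proof -
    have "p w * ((b * a) * x) \<in> K" using that x S_mult[OF that(2) a] by (simp add: annihilator_def)
    then show ?thesis by (simp add: mult.assoc)
  qed
  then show "a * x \<in> annihilator H" using a x by (auto simp: annihilator_def)
  have "p w * (b * (x * a)) \<in> K" if "w \<in> H" "b \<in> S" for w b
    using that x K_right[OF a, of "p w * (b * x)"] by (auto simp: annihilator_def mult.assoc)
  then show "x * a \<in> annihilator H" using a x by (auto simp: annihilator_def)
qed

text \<open>
  The vertices \<open>v\<close> with \<open>p\<^sub>v S x \<subseteq> K\<close> form a saturated set; if it is everything, \<open>x\<close> vanishes by
  nondegeneracy.
\<close>

lemma annihilator_saturation:
  assumes "H \<subseteq> verts E" and sat: "verts E \<subseteq> saturation E H"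
  shows "annihilator H = K"
proof
  show "K \<subseteq> annihilator H" using annihilator_ideal[OF assms(1)] by (simp add: full_ideal_def)
  show "annihilator H \<subseteq> K"
  proof
    fix x assume x: "x \<in> annihilator H"
    then have xS: "x \<in> S" by (simp add: annihilator_def)
    have *: "\<forall>a\<in>S. p v * (a * x) \<in> K" if "v \<in> saturation E H" for v
      using that
    proof (induction rule: saturation.induct)
      case (base v)
      then show ?case using x by (simp add: annihilator_def)
    next
      case (step v)
      show ?case
      proof
        fix a assume a: "a \<in> S"
        have "p v * (a * x) \<approx> (\<Sum>e\<in>out_arcs E v. s e * t e) * (a * x)"
          using a xS by (intro eqK_right ck step.hyps) auto
        also have "\<dots> = (\<Sum>e\<in>out_arcs E v. s e * t e * (a * x))" by (rule sum_distrib_right)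
        also have "\<dots> \<approx> (\<Sum>e\<in>out_arcs E v. s e * p (head E e) * t e * (a * x))"
          using a xS by (intro eqK_sum eqK_right eqK_sym[OF s_head]) auto
        finally have eq: "p v * (a * x) \<approx> (\<Sum>e\<in>out_arcs E v. s e * p (head E e) * t e * (a * x))" .
        have "s e * p (head E e) * t e * (a * x) \<in> K" if e: "e \<in> out_arcs E v" for e
        proof -
          have "p (head E e) * ((t e * a) * x) \<in> K" using step.IH[OF e] a e by simp
          then have "s e * (p (head E e) * ((t e * a) * x)) \<in> K" using e by (intro K_left[OF s_in]) auto
          then show ?thesis by (simp add: mult.assoc)
        qed
        then show "p v * (a * x) \<in> K" unfolding eqK_in_K[OF eq] by (rule K_sum)
      qed
    qed
    show "x \<in> K"
    proof (rule nondegenerate[OF xS])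
      fix v assume v: "v \<in> verts E"
      then have "p v * (p v * x) \<in> K" using * sat by auto
      moreover have "p v * p v * x \<approx> p v * x" using v xS by (intro eqK_right p_idem)
      ultimately show "p v * x \<in> K" using eqK_in_K by (simp add: mult.assoc)
    qed
  qed
qed

lemma annihilator_Un: "annihilator (H \<union> L) = annihilator H \<inter> annihilator L"
  by (auto simp: annihilator_def)

lemma sum_ideal:
  assumes I: "full_ideal I" and J: "full_ideal J"
  shows "full_ideal {a + b | a b. a \<in> I \<and> b \<in> J}"
  unfolding full_ideal_def
proof (intro conjI ballI allI)
  note i = full_idealD[OF I] and j = full_idealD[OF J]
  show "K \<subseteq> {a + b | a b. a \<in> I \<and> b \<in> J}"
    using i(1) j(1)[of 0] by force
  show "{a + b | a b. a \<in> I \<and> b \<in> J} \<subseteq> S" using i(2) j(2) by auto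
  show "x + y \<in> {a + b | a b. a \<in> I \<and> b \<in> J}"
    if x: "x \<in> {a + b | a b. a \<in> I \<and> b \<in> J}" and y: "y \<in> {a + b | a b. a \<in> I \<and> b \<in> J}" for x y
  proof -
    obtain a b a' b' where "a \<in> I" "b \<in> J" "x = a + b" "a' \<in> I" "b' \<in> J" "y = a' + b'"
      using x y by blast
    moreover from this have "x + y = (a + a') + (b + b')" by simp
    ultimately show ?thesis using i(3) j(3) by blast
  qed
  show "sc c x \<in> {a + b | a b. a \<in> I \<and> b \<in> J}" if "x \<in> {a + b | a b. a \<in> I \<and> b \<in> J}" for c x
  proof -
    obtain a b where "a \<in> I" "b \<in> J" "x = a + b" using \<open>x \<in> {a + b | a b. a \<in> I \<and> b \<in> J}\<close> by blast
    then have "sc c x = sc c a + sc c b" "sc c a \<in> I" "sc c b \<in> J"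
      using scale_add i(4) j(4) by simp_all
    then show ?thesis by blast
  qed
  fix c x assume c: "c \<in> S" and x: "x \<in> {a + b | a b. a \<in> I \<and> b \<in> J}"
  then obtain a b where ab: "a \<in> I" "b \<in> J" "x = a + b" by blast
  then have "c * x = c * a + c * b" "c * a \<in> I" "c * b \<in> J"
    using distrib_left i(5)[OF c] j(5)[OF c] by simp_all
  then show "c * x \<in> {a + b | a b. a \<in> I \<and> b \<in> J}" by blast
  have "x * c = a * c + b * c" "a * c \<in> I" "b * c \<in> J"
    using ab distrib_right i(6)[OF c] j(6)[OF c] by simp_all
  then show "x * c \<in> {a + b | a b. a \<in> I \<and> b \<in> J}" by blast
qed

lemma graph_splits_imp_splitting:
  assumes H: "H \<subseteq> verts E" "H \<noteq> {}" and L: "L \<subseteq> verts E" "L \<noteq> {}"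
    and sat: "verts E \<subseteq> saturation E (H \<union> L)"
    and orth: "\<And>v w a. v \<in> H \<Longrightarrow> w \<in> L \<Longrightarrow> a \<in> S \<Longrightarrow> p v * (a * p w) \<in> K \<and> p w * (a * p v) \<in> K"
    and sum: "\<And>x. x \<in> S \<Longrightarrow> \<exists>a\<in>annihilator L. \<exists>b\<in>annihilator H. x = a + b"
  shows "ideal_splitting (annihilator L) (annihilator H)"
  unfolding ideal_splitting_def
proof (intro conjI ballI)
  show "full_ideal (annihilator L)" "full_ideal (annihilator H)"
    using annihilator_ideal[OF H(1)] annihilator_ideal[OF L(1)] by simp_all
  show "annihilator L \<inter> annihilator H = K"
    using annihilator_saturation[OF _ sat] H L by (simp add: annihilator_Un Int_commute)
  obtain v w where vw: "v \<in> H" "w \<in> L" using H L by blast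
  then have "v \<in> verts E" "w \<in> verts E" using H L by auto
  note nK = this[THEN p_not_in_K] and pS = this[THEN p_in]
  have "p v \<in> annihilator L" using orth[OF vw(1)] pS by (simp add: annihilator_def)
  then show "annihilator L \<noteq> K" using nK by metis
  have "p w \<in> annihilator H" using orth[OF _ vw(2)] pS by (simp add: annihilator_def)
  then show "annihilator H \<noteq> K" using nK by metis
  fix x assume "x \<in> S"
  then show "\<exists>a\<in>annihilator L. \<exists>b\<in>annihilator H. x = a + b" by (rule sum)
qed

end

section \<open>Free algebras\<close>

lemma letters_plus [simp]: "letters (x + y) = letters x @ letters y"
  by (simp add: plus_free_word_def)

lemma letters_zero [simp]: "letters 0 = []"
  by (simp add: zero_free_word_def)

lemma poly_sum_monomials:
  fixes x :: "'a \<Rightarrow>\<^sub>0 'b::comm_monoid_add"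
  shows "x = (\<Sum>w\<in>Poly_Mapping.keys x. Poly_Mapping.single w (Poly_Mapping.lookup x w))"
proof (rule poly_mapping_eqI)
  fix k
  have "(\<Sum>w\<in>Poly_Mapping.keys x. Poly_Mapping.lookup (Poly_Mapping.single w (Poly_Mapping.lookup x w)) k) =
    (\<Sum>w\<in>Poly_Mapping.keys x. if w = k then Poly_Mapping.lookup x k else 0)"
    by (intro sum.cong) (auto simp: lookup_single when_def)
  also have "\<dots> = Poly_Mapping.lookup x k" by (simp add: in_keys_iff)
  finally show "Poly_Mapping.lookup x k = Poly_Mapping.lookup
      (\<Sum>w\<in>Poly_Mapping.keys x. Poly_Mapping.single w (Poly_Mapping.lookup x w)) k"
    by (simp add: lookup_sum)
qed

lemma poly_induct [case_names zero single add]: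
  fixes x :: "'a \<Rightarrow>\<^sub>0 'b::comm_monoid_add"
  assumes "P 0" "\<And>w c. P (Poly_Mapping.single w c)" "\<And>x y. P x \<Longrightarrow> P y \<Longrightarrow> P (x + y)"
  shows "P x"
proof -
  have "P (\<Sum>w\<in>A. Poly_Mapping.single w (Poly_Mapping.lookup x w))" if "finite A" for A
    using that by (induction A rule: finite_induct) (auto intro: assms)
  from this[OF finite_keys[of x]] show ?thesis by (subst poly_sum_monomials)
qed

lemma scale_eq_mult: "scale c x = Poly_Mapping.single 0 c * x"
  by (simp add: scale_def mult_map_scale_conv_mult)

lemma scale_single [simp]: "scale c (Poly_Mapping.single w d) = Poly_Mapping.single w (c * d)"
  by (simp add: scale_eq_mult mult_single)

lemma scale_zero_right [simp]: "scale c 0 = 0"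
  by (simp add: scale_eq_mult)

lemma scale_add_right: "scale c (x + y) = scale c x + scale c y"
  by (simp add: scale_eq_mult distrib_left)

lemma scale_diff_right: "scale c (x - y) = scale c x - scale c y"
  by (simp add: scale_eq_mult right_diff_distrib)

lemma scale_sum: "scale c (sum f A) = (\<Sum>i\<in>A. scale c (f i))"
  by (simp add: scale_eq_mult sum_distrib_left)

lemma scale_add_left: "scale (c + d) x = scale c x + scale d x"
  by (simp add: scale_eq_mult single_add distrib_right)

lemma scale_sum_coeffs: "scale (sum c A) x = (\<Sum>i\<in>A. scale (c i) x)"
  by (induction A rule: infinite_finite_induct) (simp_all add: scale_eq_mult single_add distrib_right)

lemma scale_diff_left: "scale (c - d) x = scale c x - scale d x"
  by (simp add: scale_eq_mult single_diff left_diff_distrib)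

lemma scale_scale: "scale c (scale d x) = scale (c * d) x"
  by (simp add: scale_eq_mult mult_single flip: mult.assoc)

lemma scale_one [simp]: "scale 1 x = x"
  by (simp add: scale_eq_mult)

lemma scale_minus_one_eq: "scale (- 1) x = - x"
  by (simp add: scale_eq_mult single_uminus)

lemma scale_zero_left [simp]: "scale 0 x = 0"
  by (simp add: scale_eq_mult)

lemma scale_mult_left_eq: "scale c x * y = scale c (x * y)"
  by (simp add: scale_eq_mult mult.assoc)

text \<open>
  Scaling is multiplication by a constant \<open>single 0 c\<close>, and constants are central when the
  coefficients commute.
\<close>

lemma scale_mult_right_eq: "x * scale c y = scale c (x * y)" for c :: "'k::comm_ring_1"
proof -
  have "x * Poly_Mapping.single 0 c = Poly_Mapping.single 0 c * x"
    by (induction x rule: poly_induct) (simp_all add: mult_single mult.commute distrib_left distrib_right)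
  then show ?thesis by (simp add: scale_eq_mult flip: mult.assoc)
qed

lemma free_algebra_zero [simp]: "0 \<in> free_algebra X"
  by (simp add: free_algebra_def)

lemma free_algebra_add [simp]: "x \<in> free_algebra X \<Longrightarrow> y \<in> free_algebra X \<Longrightarrow> x + y \<in> free_algebra X"
  using Poly_Mapping.keys_add[of x y] by (auto simp: free_algebra_def)

lemma free_algebra_mult [simp]: "x \<in> free_algebra X \<Longrightarrow> y \<in> free_algebra X \<Longrightarrow> x * y \<in> free_algebra X"
  using keys_mult[of x y] by (fastforce simp: free_algebra_def)

lemma free_algebra_scale [simp]: "x \<in> free_algebra X \<Longrightarrow> scale c x \<in> free_algebra X"
  unfolding scale_eq_mult using keys_mult[of "Poly_Mapping.single 0 c" x]
  by (fastforce simp: free_algebra_def split: if_splits)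

lemma free_algebra_uminus [simp]: "x \<in> free_algebra X \<Longrightarrow> - x \<in> free_algebra X"
  using free_algebra_scale[of x X "- 1"] by (simp add: scale_minus_one_eq)

lemma free_algebra_diff [simp]: "x \<in> free_algebra X \<Longrightarrow> y \<in> free_algebra X \<Longrightarrow> x - y \<in> free_algebra X"
  using free_algebra_add[of x X "- y"] by simp

lemma free_algebra_sum [simp]: "(\<And>i. i \<in> A \<Longrightarrow> f i \<in> free_algebra X) \<Longrightarrow> sum f A \<in> free_algebra X"
  by (induction A rule: infinite_finite_induct) auto

lemma free_algebra_gen [simp]: "g \<in> X \<Longrightarrow> gen g \<in> free_algebra X"
  by (simp add: free_algebra_def gen_def)

text \<open>
  Words are built by appending letters on the right, which is the direction in which normal forms are
  computed.
\<close>

lemma free_algebra_induct [consumes 1, case_names zero add scale gen mult]: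
  fixes x :: "'g free_word \<Rightarrow>\<^sub>0 'k::ring_1"
  assumes x: "x \<in> free_algebra X"
    and zero: "P 0"
    and add: "\<And>x y. x \<in> free_algebra X \<Longrightarrow> y \<in> free_algebra X \<Longrightarrow> P x \<Longrightarrow> P y \<Longrightarrow> P (x + y)"
    and sc: "\<And>c x. x \<in> free_algebra X \<Longrightarrow> P x \<Longrightarrow> P (scale c x)"
    and gen: "\<And>g. g \<in> X \<Longrightarrow> P (gen g)"
    and mult: "\<And>g x. g \<in> X \<Longrightarrow> x \<in> free_algebra X \<Longrightarrow> P x \<Longrightarrow> P (x * gen g)"
  shows "P x"
proof -
  have word: "P (Poly_Mapping.single (Word l) 1) \<and> Poly_Mapping.single (Word l) (1::'k) \<in> free_algebra X"
    if "l \<noteq> []" "set l \<subseteq> X" for l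
    using that
  proof (induction l rule: rev_nonempty_induct)
    case (single g)
    then show ?case using gen[of g] free_algebra_gen[of g X] unfolding gen_def by simp
  next
    case (snoc g l)
    have "Poly_Mapping.single (Word (l @ [g])) (1::'k) = Poly_Mapping.single (Word l) 1 * gen g"
      by (simp add: gen_def mult_single plus_free_word_def)
    then show ?case using snoc mult by simp
  qed
  have "P (\<Sum>w\<in>A. Poly_Mapping.single w (Poly_Mapping.lookup x w)) \<and>
    (\<Sum>w\<in>A. Poly_Mapping.single w (Poly_Mapping.lookup x w)) \<in> free_algebra X"
    if "A \<subseteq> Poly_Mapping.keys x" "finite A" for A
    using that(2,1)
  proof (induction A rule: finite_induct)
    case (insert w A)
    have "letters w \<noteq> []" "set (letters w) \<subseteq> X"
      using x insert.prems by (auto simp: free_algebra_def)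
    from word[OF this] have w: "P (Poly_Mapping.single w 1)" "Poly_Mapping.single w (1::'k) \<in> free_algebra X"
      by simp_all
    have "Poly_Mapping.single w (Poly_Mapping.lookup x w) =
        scale (Poly_Mapping.lookup x w) (Poly_Mapping.single w 1)" by simp
    then have "P (Poly_Mapping.single w (Poly_Mapping.lookup x w))"
      "Poly_Mapping.single w (Poly_Mapping.lookup x w) \<in> free_algebra X"
      using sc[OF w(2,1)] free_algebra_scale[OF w(2)] by metis+
    then show ?case using insert add by simp
  qed (simp add: zero)
  from this[OF order.refl finite_keys] show ?thesis by (subst poly_sum_monomials) (rule conjunct1)
qed

section \<open>Linear spans modulo an ideal\<close>

context ring_quotient
begin

text \<open>
  The linear span of \<open>B\<close>, saturated under congruence modulo \<open>K\<close>.
\<close>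

inductive_set kspan :: "'r set \<Rightarrow> 'r set" for B where
  inK: "x \<in> K \<Longrightarrow> x \<in> kspan B"
| base: "x \<in> B \<Longrightarrow> x \<in> kspan B"
| add: "x \<in> kspan B \<Longrightarrow> y \<in> kspan B \<Longrightarrow> x + y \<in> kspan B"
| scale: "x \<in> kspan B \<Longrightarrow> sc c x \<in> kspan B"

lemma kspan_eqK: "x \<approx> y \<Longrightarrow> y \<in> kspan B \<Longrightarrow> x \<in> kspan B"
  using kspan.add[OF kspan.inK[of "x - y"], of y B] by (simp add: eqK_def)

lemma kspan_baseI: "x \<approx> y \<Longrightarrow> y \<in> B \<Longrightarrow> x \<in> kspan B"
  by (rule kspan_eqK[OF _ kspan.base])

lemma kspan_uminus: "x \<in> kspan B \<Longrightarrow> - x \<in> kspan B"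
  using kspan.scale[of x B "- 1"] by (simp add: scale_minus_one)

lemma kspan_diff: "x \<in> kspan B \<Longrightarrow> y \<in> kspan B \<Longrightarrow> x - y \<in> kspan B"
  using kspan.add[of x B "- y"] kspan_uminus[of y] by simp

lemma kspan_sum: "(\<And>i. i \<in> A \<Longrightarrow> f i \<in> kspan B) \<Longrightarrow> sum f A \<in> kspan B"
  by (induction A rule: infinite_finite_induct) (auto intro: kspan.add kspan.inK)

lemma kspan_mult:
  assumes x: "x \<in> kspan B" and a: "a \<in> S"
  shows "(\<And>b. b \<in> B \<Longrightarrow> a * b \<in> kspan B') \<Longrightarrow> a * x \<in> kspan B'"
    and "(\<And>b. b \<in> B \<Longrightarrow> b * a \<in> kspan B') \<Longrightarrow> x * a \<in> kspan B'"
proof -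
  assume b: "\<And>b. b \<in> B \<Longrightarrow> a * b \<in> kspan B'"
  from x show "a * x \<in> kspan B'"
    by (induction rule: kspan.induct)
      (auto simp: distrib_left scale_mult_right intro: b kspan.add kspan.scale kspan.inK K_left[OF a])
next
  assume b: "\<And>b. b \<in> B \<Longrightarrow> b * a \<in> kspan B'"
  from x show "x * a \<in> kspan B'"
    by (induction rule: kspan.induct)
      (auto simp: distrib_right scale_mult_left intro: b kspan.add kspan.scale kspan.inK K_right[OF a])
qed

end

section \<open>Normal forms\<close>

locale ck_generators = ck_relations "free_algebra X" K scale E p s t
  for X :: "'g set" and K :: "('g free_word \<Rightarrow>\<^sub>0 'k::field) set"
    and E :: "('v, 'e) pre_digraph" and p s t +
  assumes generators: "g \<in> X \<Longrightarrow> (\<exists>v\<in>verts E. gen g \<approx> p v) \<or> (\<exists>e\<in>arcs E. gen g \<approx> s e) \<or>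
      (\<exists>e\<in>arcs E. gen g \<approx> t e)"
begin

lemma vertex_sum_unit:
  assumes u: "u \<in> F" and F: "finite F" "F \<subseteq> verts E" and y: "y \<in> free_algebra X" "p u * y \<approx> y"
  shows "(\<Sum>v\<in>F. p v) * y \<approx> y"
proof -
  have uE: "u \<in> verts E" using u F by auto
  have "p v * y \<approx> (if v = u then y else 0)" if v: "v \<in> F" for v
  proof -
    have "p v * y \<approx> p v * (p u * y)" using v F by (intro eqK_left eqK_sym[OF y(2)]) auto
    also have "\<dots> = p v * p u * y" by (simp add: mult.assoc)
    also have "\<dots> \<approx> (if v = u then p v else 0) * y"
      using v F uE by (intro eqK_right p_mult y) auto
    also have "\<dots> \<approx> (if v = u then y else 0)" using y(2) by simp
    finally show ?thesis .
  qed
  then have "(\<Sum>v\<in>F. p v * y) \<approx> (\<Sum>v\<in>F. if v = u then y else 0)" by (rule eqK_sum)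
  then show ?thesis using u F by (simp add: sum_distrib_right)
qed

text \<open>
  Stated for all larger finite sets, so that the units of two elements can be merged.
\<close>

lemma local_unit:
  assumes "x \<in> free_algebra X"
  shows "\<exists>F. finite F \<and> F \<subseteq> verts E \<and>
    (\<forall>F'. finite F' \<and> F \<subseteq> F' \<and> F' \<subseteq> verts E \<longrightarrow> (\<Sum>v\<in>F'. p v) * x \<approx> x)"
  using assms
proof (induction rule: free_algebra_induct)
  case zero
  show ?case by (intro exI[of _ "{}"]) simp
next
  case (add x y)
  obtain F where F: "finite F" "F \<subseteq> verts E"
    "\<And>F'. finite F' \<and> F \<subseteq> F' \<and> F' \<subseteq> verts E \<Longrightarrow> (\<Sum>v\<in>F'. p v) * x \<approx> x" using add by blast
  obtain G where G: "finite G" "G \<subseteq> verts E"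
    "\<And>F'. finite F' \<and> G \<subseteq> F' \<and> F' \<subseteq> verts E \<Longrightarrow> (\<Sum>v\<in>F'. p v) * y \<approx> y" using add by blast
  show ?case using F G by (intro exI[of _ "F \<union> G"]) (auto simp: distrib_left intro!: eqK_add)
next
  case (scale c x)
  then show ?case using eqK_scale scale_mult_right by metis
next
  case (gen g)
  have y: "gen g \<in> free_algebra X" using gen by simp
  have "\<exists>u\<in>verts E. p u * gen g \<approx> gen g"
    using generators[OF gen]
  proof (elim disjE bexE)
    fix v assume v: "v \<in> verts E" "gen g \<approx> p v"
    have "p v * gen g \<approx> p v * p v" using v by (intro eqK_left) auto
    also have "\<dots> \<approx> p v" using v p_mult[of v v] by simp
    also have "\<dots> \<approx> gen g" using v eqK_sym by blast
    finally show ?thesis using v by blast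
  next
    fix e assume e: "e \<in> arcs E" "gen g \<approx> s e"
    have "p (tail E e) * gen g \<approx> p (tail E e) * s e" using e by (intro eqK_left) auto
    also have "\<dots> \<approx> s e" using e tail_s by simp
    also have "\<dots> \<approx> gen g" using e eqK_sym by blast
    finally show ?thesis using e tail_in_verts by blast
  next
    fix e assume e: "e \<in> arcs E" "gen g \<approx> t e"
    have "p (head E e) * gen g \<approx> p (head E e) * t e" using e by (intro eqK_left) auto
    also have "\<dots> \<approx> t e" using e head_t by simp
    also have "\<dots> \<approx> gen g" using e eqK_sym by blast
    finally show ?thesis using e head_in_verts by blast
  qed
  then obtain u where u: "u \<in> verts E" "p u * gen g \<approx> gen g" by blast
  show ?case using u vertex_sum_unit[of u _ "gen g"] y by (intro exI[of _ "{u}"]) auto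
next
  case (mult g x)
  then obtain F where F: "finite F" "F \<subseteq> verts E"
    "\<And>F'. finite F' \<and> F \<subseteq> F' \<and> F' \<subseteq> verts E \<Longrightarrow> (\<Sum>v\<in>F'. p v) * x \<approx> x" by blast
  then have "(\<Sum>v\<in>F'. p v) * (x * gen g) \<approx> x * gen g"
    if "finite F' \<and> F \<subseteq> F' \<and> F' \<subseteq> verts E" for F'
    using eqK_right[OF F(3)[OF that] free_algebra_gen[OF mult.hyps(1)]] by (simp add: mult.assoc)
  then show ?case using F by blast
qed

lemma nondegenerate_free:
  assumes x: "x \<in> free_algebra X" and K: "\<And>v. v \<in> verts E \<Longrightarrow> p v * x \<in> K"
  shows "x \<in> K"
proof -
  obtain F where F: "finite F" "F \<subseteq> verts E" "(\<Sum>v\<in>F. p v) * x \<approx> x" using local_unit[OF x] by blast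
  have "(\<Sum>v\<in>F. p v) * x \<in> K" using F K by (auto simp: sum_distrib_right intro!: K_sum)
  then show ?thesis using eqK_in_K[OF F(3)] by simp
qed

end

locale ck_words = ck_generators X K E p s t + ck_family "free_algebra X" K scale E p s t
  for X :: "'g set" and K :: "('g free_word \<Rightarrow>\<^sub>0 'k::field) set"
    and E :: "('v, 'e) pre_digraph" and p s t
begin

lemma full_ideal_all:
  assumes M: "full_ideal M" and pM: "\<And>v. v \<in> verts E \<Longrightarrow> p v \<in> M" and x: "x \<in> free_algebra X"
  shows "x \<in> M"
  using x
proof (induction rule: free_algebra_induct)
  case zero
  then show ?case using full_idealD(1)[OF M] by simp
next
  case (gen g)
  then show ?case
    using generators[of g] full_ideal_eqK[OF M] pM full_ideal_s[OF M] full_ideal_t[OF M]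
    by (metis head_in_verts)
qed (use full_idealD[OF M] in auto)

text \<open>
  The normal forms \<open>s\<^sub>\<alpha> t\<^sub>\<beta>\<close> of words, where both walks end in the same vertex \<open>u\<close>.
\<close>

definition monomials :: "('g free_word \<Rightarrow>\<^sub>0 'k) set" where
  "monomials = {walk_s \<alpha> u * walk_t \<beta> u | \<alpha> \<beta> u v w. awalk v \<alpha> u \<and> awalk w \<beta> u}"

lemma monomial_in: "awalk v \<alpha> u \<Longrightarrow> awalk w \<beta> u \<Longrightarrow> walk_s \<alpha> u * walk_t \<beta> u \<in> monomials"
  unfolding monomials_def by blast

lemma walk_s_append:
  "awalk v \<alpha> u \<Longrightarrow> awalk u \<beta> w \<Longrightarrow> walk_s \<alpha> u * walk_s \<beta> w \<approx> walk_s (\<alpha> @ \<beta>) w"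
proof (induction \<alpha> arbitrary: v)
  case (Cons e \<alpha>)
  then have a: "awalk (head E e) \<alpha> u" "e \<in> arcs E" by (auto simp: awalk_Cons_iff)
  then show ?case
    using eqK_left[OF Cons.IH[OF a(1) Cons.prems(2)] s_in[OF a(2)]] by (simp add: mult.assoc)
qed (simp add: p_walk_s awalk_Nil_iff)

lemma walk_t_append:
  "awalk v \<alpha> u \<Longrightarrow> awalk u \<beta> w \<Longrightarrow> walk_t \<beta> w * walk_t \<alpha> u \<approx> walk_t (\<alpha> @ \<beta>) w"
proof (induction \<alpha> arbitrary: v)
  case (Cons e \<alpha>)
  then have a: "awalk (head E e) \<alpha> u" "e \<in> arcs E" by (auto simp: awalk_Cons_iff)
  then show ?case
    using eqK_right[OF Cons.IH[OF a(1) Cons.prems(2)] t_in[OF a(2)]] by (simp add: mult.assoc)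
qed (simp add: walk_t_p awalk_Nil_iff)

lemma walk_single:
  assumes "e \<in> arcs E"
  shows "awalk (tail E e) [e] (head E e)" "walk_s [e] (head E e) \<approx> s e" "walk_t [e] (head E e) \<approx> t e"
  using assms s_head head_t by (auto simp: awalk_Cons_iff awalk_Nil_iff)

text \<open>
  Multiplying \<open>s\<^sub>\<alpha> t\<^sub>\<beta>\<close> by a generator on the right prolongs \<open>\<beta>\<close>, or prolongs \<open>\<alpha>\<close> if \<open>\<beta>\<close> is empty, or
  cancels the first edge of \<open>\<beta>\<close>, or gives zero.
\<close>

lemma mult_generator:
  assumes m: "m \<in> monomials"
  shows "w \<in> verts E \<Longrightarrow> m * p w \<in> kspan monomials"
    and "e \<in> arcs E \<Longrightarrow> m * s e \<in> kspan monomials"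
    and "e \<in> arcs E \<Longrightarrow> m * t e \<in> kspan monomials"
proof -
  obtain \<alpha> \<beta> u v' w' where \<alpha>: "awalk v' \<alpha> u" and \<beta>: "awalk w' \<beta> u"
    and m': "m = walk_s \<alpha> u * walk_t \<beta> u"
    using m unfolding monomials_def by blast
  have S: "walk_s \<alpha> u \<in> free_algebra X" "walk_t \<beta> u \<in> free_algebra X" using \<alpha> \<beta> by auto
  have w': "w' \<in> verts E" "u \<in> verts E" using \<beta> awalk_verts_ends by auto
  show p: "m * p w \<in> kspan monomials" if w: "w \<in> verts E" for w
  proof (cases "w = w'")
    case True
    have "m * p w \<approx> m"
      using eqK_left[OF walk_t_p[OF \<beta>] S(1)] by (simp add: m' True mult.assoc)
    then show ?thesis using m by (rule kspan_baseI)
  next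
    case False
    have "m * p w \<in> K"
      using K_left[OF S(1) walk_t_p_K[OF \<beta> w False]] by (simp add: m' mult.assoc)
    then show ?thesis by (rule kspan.inK)
  qed
  show "m * t e \<in> kspan monomials" if e: "e \<in> arcs E"
  proof (cases "head E e = w'")
    case True
    have "m * t e = walk_s \<alpha> u * walk_t (e # \<beta>) u" by (simp add: m' mult.assoc)
    moreover have "awalk (tail E e) (e # \<beta>) u" using \<beta> e True by (auto simp: awalk_Cons_iff)
    from kspan.base[OF monomial_in[OF \<alpha> this]]
    have "walk_s \<alpha> u * walk_t (e # \<beta>) u \<in> kspan monomials" .
    ultimately show ?thesis by metis
  next
    case False
    have "m * t e \<approx> m * (p (head E e) * t e)"
      using e S by (intro eqK_left eqK_sym[OF head_t]) (auto simp: m')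
    moreover have "m * (p (head E e) * t e) = walk_s \<alpha> u * (walk_t \<beta> u * p (head E e)) * t e"
      by (simp add: m' mult.assoc)
    moreover have "\<dots> \<in> K"
      using e False by (intro K_right[OF t_in] K_left[OF S(1)] walk_t_p_K[OF \<beta>]) auto
    ultimately show ?thesis using eqK_in_K kspan.inK by metis
  qed
  show "m * s e \<in> kspan monomials" if e: "e \<in> arcs E"
  proof (cases \<beta>)
    case Nil
    have "w' = u" using \<beta> Nil by (simp add: awalk_Nil_iff)
    have ps: "m * s e \<approx> m * (p (tail E e) * s e)"
      using e S by (intro eqK_left eqK_sym[OF tail_s]) (auto simp: m')
    show ?thesis
    proof (cases "tail E e = u")
      case True
      have aw: "awalk u [e] (head E e)" using walk_single(1)[OF e] True by simp
      have "m * s e = walk_s \<alpha> u * (p u * s e)" by (simp add: m' Nil mult.assoc)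
      also have "\<dots> \<approx> walk_s \<alpha> u * s e" using tail_s[OF e] True by (intro eqK_left[OF _ S(1)]) simp
      also have "\<dots> \<approx> walk_s \<alpha> u * walk_s [e] (head E e)"
        by (intro eqK_left[OF _ S(1)] eqK_sym[OF walk_single(2)] e)
      also have "\<dots> \<approx> walk_s (\<alpha> @ [e]) (head E e)" by (rule walk_s_append[OF \<alpha> aw])
      also have "\<dots> \<approx> walk_s (\<alpha> @ [e]) (head E e) * walk_t [] (head E e)"
        using walk_s_p[OF awalk_appendI[OF \<alpha> aw]] by (simp add: eqK_sym)
      finally have eq: "m * s e \<approx> walk_s (\<alpha> @ [e]) (head E e) * walk_t [] (head E e)" .
      have "awalk (head E e) [] (head E e)" using e by (simp add: awalk_Nil_iff)
      from kspan_baseI[OF eq monomial_in[OF awalk_appendI[OF \<alpha> aw] this]] show ?thesis .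
    next
      case False
      have "m * (p (tail E e) * s e) = walk_s \<alpha> u * (p u * p (tail E e)) * s e"
        by (simp add: m' Nil mult.assoc)
      moreover have "\<dots> \<in> K"
        using e False w' by (intro K_right[OF s_in] K_left[OF S(1)] p_mult_K) auto
      ultimately show ?thesis using ps eqK_in_K kspan.inK by metis
    qed
  next
    case (Cons f \<beta>')
    have f: "f \<in> arcs E" "awalk (head E f) \<beta>' u" using \<beta> Cons by (auto simp: awalk_Cons_iff)
    have eq: "m * s e = walk_s \<alpha> u * (walk_t \<beta>' u * (t f * s e))" by (simp add: m' Cons mult.assoc)
    show ?thesis
    proof (cases "f = e")
      case True
      have "m * s e \<approx> walk_s \<alpha> u * (walk_t \<beta>' u * p (head E f))"
        unfolding eq using f t_s[of f e] True S by (intro eqK_left) auto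
      also have "\<dots> \<approx> walk_s \<alpha> u * walk_t \<beta>' u"
        using f by (intro eqK_left[OF _ S(1)] walk_t_p)
      finally show ?thesis by (rule kspan_baseI) (rule monomial_in[OF \<alpha> f(2)])
    next
      case False
      have "t f * s e \<in> K" using t_s[of f e] f e False by (simp add: eqK_zero_iff)
      then have "m * s e \<in> K" unfolding eq using f by (intro K_left[OF S(1)] K_left[OF walk_in(2)])
      then show ?thesis by (rule kspan.inK)
    qed
  qed
qed

lemma vertex_in_monomials: "v \<in> verts E \<Longrightarrow> p v \<in> kspan monomials"
  using monomial_in[of v "[]" v v "[]"] kspan_baseI[OF eqK_sym[OF p_idem]] by (simp add: awalk_Nil_iff)

lemma free_algebra_monomials: "x \<in> free_algebra X \<Longrightarrow> x \<in> kspan monomials"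
proof (induction rule: free_algebra_induct)
  case (gen g)
  have "p v \<in> kspan monomials" if "v \<in> verts E" for v by (rule vertex_in_monomials[OF that])
  moreover have "s e \<in> kspan monomials" if e: "e \<in> arcs E" for e
  proof -
    have "p (tail E e) * s e \<in> kspan monomials"
      using kspan_mult(2)[OF vertex_in_monomials[OF tail_in_verts[OF e]] s_in[OF e]]
        mult_generator(2)[OF _ e] by blast
    then show ?thesis using kspan_eqK[OF eqK_sym[OF tail_s[OF e]]] by blast
  qed
  moreover have "t e \<in> kspan monomials" if e: "e \<in> arcs E" for e
  proof -
    have "p (head E e) * t e \<in> kspan monomials"
      using kspan_mult(2)[OF vertex_in_monomials[OF head_in_verts[OF e]] t_in[OF e]]
        mult_generator(3)[OF _ e] by blast
    then show ?thesis using kspan_eqK[OF eqK_sym[OF head_t[OF e]]] by blast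
  qed
  ultimately show ?case using generators[OF gen] kspan_eqK by blast
next
  case (mult g x)
  have pw: "x * p w \<in> kspan monomials" if "w \<in> verts E" for w
    using kspan_mult(2)[OF mult.IH p_in[OF that]] mult_generator(1)[OF _ that] by blast
  have sw: "x * s e \<in> kspan monomials" if "e \<in> arcs E" for e
    using kspan_mult(2)[OF mult.IH s_in[OF that]] mult_generator(2)[OF _ that] by blast
  have tw: "x * t e \<in> kspan monomials" if "e \<in> arcs E" for e
    using kspan_mult(2)[OF mult.IH t_in[OF that]] mult_generator(3)[OF _ that] by blast
  show ?case
    using generators[OF mult.hyps(1)]
  proof (elim disjE bexE)
    fix v assume "v \<in> verts E" "gen g \<approx> p v"
    then show ?thesis using kspan_eqK[OF eqK_left[OF _ mult.hyps(2)] pw] by blast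
  next
    fix e assume "e \<in> arcs E" "gen g \<approx> s e"
    then show ?thesis using kspan_eqK[OF eqK_left[OF _ mult.hyps(2)] sw] by blast
  next
    fix e assume "e \<in> arcs E" "gen g \<approx> t e"
    then show ?thesis using kspan_eqK[OF eqK_left[OF _ mult.hyps(2)] tw] by blast
  qed
qed (auto intro: kspan.intros)

lemma hereditary_awalk: "hereditary E H \<Longrightarrow> awalk v \<alpha> u \<Longrightarrow> v \<in> H \<Longrightarrow> u \<in> H"
  by (induction \<alpha> arbitrary: v) (auto simp: awalk_Cons_iff awalk_Nil_iff hereditary_def)

text \<open>
  In a monomial \<open>s\<^sub>\<alpha> t\<^sub>\<beta>\<close> that survives between \<open>p\<^sub>v\<close> and \<open>p\<^sub>w\<close>, the common end point of \<open>\<alpha>\<close> and \<open>\<beta>\<close> is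
  reachable from \<open>v\<close> and from \<open>w\<close>, hence lies in both hereditary sets.
\<close>

lemma hereditary_orthogonal:
  assumes H: "hereditary E H" and L: "hereditary E L" and disj: "H \<inter> L = {}"
    and v: "v \<in> H" and w: "w \<in> L" and x: "x \<in> free_algebra X"
  shows "p v * (x * p w) \<in> K"
proof -
  have vw: "v \<in> verts E" "w \<in> verts E" using H L v w by (auto simp: hereditary_def)
  have m0: "p v * (m * p w) \<in> kspan {}" if "m \<in> monomials" for m
  proof -
    obtain \<alpha> \<beta> u v' w' where \<alpha>: "awalk v' \<alpha> u" and \<beta>: "awalk w' \<beta> u"
      and m: "m = walk_s \<alpha> u * walk_t \<beta> u"
      using \<open>m \<in> monomials\<close> unfolding monomials_def by blast
    have eq: "p v * (m * p w) = (p v * walk_s \<alpha> u) * (walk_t \<beta> u * p w)" by (simp add: m mult.assoc)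
    have "v \<noteq> v' \<or> w \<noteq> w'"
      using hereditary_awalk[OF H \<alpha>] hereditary_awalk[OF L \<beta>] v w disj by blast
    then have "p v * (m * p w) \<in> K"
    proof
      assume "v \<noteq> v'"
      then show ?thesis unfolding eq using \<alpha> \<beta> vw
        by (intro K_right[OF _ p_walk_s_K[OF \<alpha>]]) auto
    next
      assume "w \<noteq> w'"
      then show ?thesis unfolding eq using \<alpha> \<beta> vw
        by (intro K_left[OF _ walk_t_p_K[OF \<beta>]]) auto
    qed
    then show ?thesis by (rule kspan.inK)
  qed
  have "b * p w \<in> kspan ((\<lambda>m. m * p w) ` monomials)" if "b \<in> monomials" for b
    using that by (intro kspan.base imageI)
  note xw = kspan_mult(2)[OF free_algebra_monomials[OF x] p_in[OF vw(2)] this]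
  have "p v * b \<in> kspan {}" if "b \<in> (\<lambda>m. m * p w) ` monomials" for b
    using that m0 by auto
  note kspan_mult(1)[OF xw p_in[OF vw(1)] this]
  moreover have "y \<in> K" if "y \<in> kspan {}" for y
    using that by (induction rule: kspan.induct) (auto intro: K_add K_scale)
  ultimately show ?thesis by blast
qed

text \<open>
  A closed walk at \<open>w\<close>, read forwards as \<open>s\<close> or backwards as \<open>t\<close>. The index records the direction, so
  that one finite family of coefficients describes a combination of both kinds.
\<close>

definition loop :: "'v \<Rightarrow> bool \<times> 'e list \<Rightarrow> 'g free_word \<Rightarrow>\<^sub>0 'k" where
  "loop w i = (if fst i then walk_s (snd i) w else walk_t (snd i) w)"

definition loops :: "'v \<Rightarrow> ('g free_word \<Rightarrow>\<^sub>0 'k) set" where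
  "loops w = loop w ` {i. awalk w (snd i) w}"

lemma walk_s_in_loops: "awalk w \<delta> w \<Longrightarrow> walk_s \<delta> w \<in> loops w"
  unfolding loops_def by (rule image_eqI[of _ _ "(True, \<delta>)"]) (auto simp: loop_def)

lemma walk_t_in_loops: "awalk w \<delta> w \<Longrightarrow> walk_t \<delta> w \<in> loops w"
  unfolding loops_def by (rule image_eqI[of _ _ "(False, \<delta>)"]) (auto simp: loop_def)

text \<open>
  If \<open>\<gamma>\<close> is at least as long as \<open>\<alpha>\<close>, the product \<open>t\<^sub>\<gamma> s\<^sub>\<alpha>\<close> is a single backward walk or zero, and
  dually \<open>t\<^sub>\<alpha> s\<^sub>\<gamma>\<close> is a forward walk or zero. Any length of \<open>\<gamma>\<close> will do when \<open>\<gamma>\<close> ends in a sink, because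
  then \<open>\<gamma>\<close> cannot be a proper prefix of \<open>\<alpha>\<close>.
\<close>

lemma long_walk_t_s:
  assumes \<gamma>: "awalk v \<gamma> w" and \<alpha>: "awalk v' \<alpha> u" and long: "length \<alpha> \<le> length \<gamma> \<or> out_arcs E w = {}"
  shows "walk_t \<gamma> w * walk_s \<alpha> u \<in> K \<or> (\<exists>\<delta>. awalk u \<delta> w \<and> walk_t \<gamma> w * walk_s \<alpha> u \<approx> walk_t \<delta> w)"
    and "walk_t \<alpha> u * walk_s \<gamma> w \<in> K \<or> (\<exists>\<delta>. awalk u \<delta> w \<and> walk_t \<alpha> u * walk_s \<gamma> w \<approx> walk_s \<delta> w)"
proof -
  have *: "prefix \<alpha> \<gamma>" if pre: "prefix \<gamma> \<alpha>" "v = v'"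
  proof -
    obtain \<delta> where \<delta>: "\<alpha> = \<gamma> @ \<delta>" using pre by (auto simp: prefix_def)
    then have aw: "awalk w \<delta> u" using \<alpha> \<gamma> pre(2) by (auto simp: awalk_append_iff dest: awalk_ends)
    show ?thesis
    proof (cases \<delta>)
      case (Cons e \<delta>')
      then have "e \<in> out_arcs E w" using aw by (auto simp: awalk_Cons_iff)
      then show ?thesis using long \<delta> Cons by auto
    qed (use \<delta> in auto)
  qed
  have cases: "v \<noteq> v' \<or> (\<not> prefix \<alpha> \<gamma> \<and> \<not> prefix \<gamma> \<alpha>) \<or> (\<exists>\<delta>. v = v' \<and> \<gamma> = \<alpha> @ \<delta> \<and> awalk u \<delta> w)"
  proof -
    have "\<exists>\<delta>. \<gamma> = \<alpha> @ \<delta> \<and> awalk u \<delta> w" if pre: "prefix \<alpha> \<gamma>" "v = v'"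
    proof -
      obtain \<delta> where \<delta>: "\<gamma> = \<alpha> @ \<delta>" using pre by (auto simp: prefix_def)
      then have "awalk u \<delta> w" using \<alpha> \<gamma> pre(2) by (auto simp: awalk_append_iff dest: awalk_ends)
      with \<delta> show ?thesis by blast
    qed
    then show ?thesis using * by blast
  qed
  show "walk_t \<gamma> w * walk_s \<alpha> u \<in> K \<or> (\<exists>\<delta>. awalk u \<delta> w \<and> walk_t \<gamma> w * walk_s \<alpha> u \<approx> walk_t \<delta> w)"
    using cases walk_t_s_diff_start[OF \<gamma> \<alpha>] walk_t_s_incomparable[OF \<gamma> \<alpha>] walk_t_append_s[OF \<alpha>] by blast
  show "walk_t \<alpha> u * walk_s \<gamma> w \<in> K \<or> (\<exists>\<delta>. awalk u \<delta> w \<and> walk_t \<alpha> u * walk_s \<gamma> w \<approx> walk_s \<delta> w)"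
    using cases walk_t_s_diff_start[OF \<alpha> \<gamma>] walk_t_s_incomparable[OF \<alpha> \<gamma>] walk_t_s_append[OF \<alpha>] by blast
qed

lemma walk_t_s_loops:
  assumes \<alpha>: "awalk u \<alpha> w" and \<beta>: "awalk u \<beta> w"
  shows "walk_t \<alpha> w * walk_s \<beta> w \<in> kspan (loops w)"
proof -
  consider "\<not> prefix \<alpha> \<beta>" "\<not> prefix \<beta> \<alpha>" | \<delta> where "\<alpha> = \<beta> @ \<delta>" | \<delta> where "\<beta> = \<alpha> @ \<delta>"
    by (auto simp: prefix_def)
  then show ?thesis
  proof cases
    case 1
    then show ?thesis using walk_t_s_incomparable[OF \<alpha> \<beta>] by (blast intro: kspan.inK)
  next
    case 2
    then have "awalk w \<delta> w" using \<alpha> \<beta> by (auto simp: awalk_append_iff dest: awalk_ends)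
    then show ?thesis
      using walk_t_append_s[OF \<beta>] 2 walk_t_in_loops kspan_baseI by blast
  next
    case 3
    then have "awalk w \<delta> w" using \<alpha> \<beta> by (auto simp: awalk_append_iff dest: awalk_ends)
    then show ?thesis
      using walk_t_s_append[OF \<alpha>] 3 walk_s_in_loops kspan_baseI by blast
  qed
qed

lemma compress_monomial:
  assumes m: "m \<in> monomials"
  shows "\<exists>n. \<forall>\<gamma> w. awalk v \<gamma> w \<and> (n \<le> length \<gamma> \<or> out_arcs E w = {}) \<longrightarrow>
    walk_t \<gamma> w * m * walk_s \<gamma> w \<in> kspan (loops w)"
proof -
  obtain \<alpha> \<beta> u v' w' where \<alpha>: "awalk v' \<alpha> u" and \<beta>: "awalk w' \<beta> u"
    and m': "m = walk_s \<alpha> u * walk_t \<beta> u"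
    using m unfolding monomials_def by blast
  have "walk_t \<gamma> w * m * walk_s \<gamma> w \<in> kspan (loops w)"
    if \<gamma>: "awalk v \<gamma> w" and long: "max (length \<alpha>) (length \<beta>) \<le> length \<gamma> \<or> out_arcs E w = {}" for \<gamma> w
  proof -
    let ?a = "walk_t \<gamma> w * walk_s \<alpha> u" and ?b = "walk_t \<beta> u * walk_s \<gamma> w"
    have eq: "walk_t \<gamma> w * m * walk_s \<gamma> w = ?a * ?b" by (simp add: m' mult.assoc)
    have ab: "?a \<in> free_algebra X" "?b \<in> free_algebra X" using \<alpha> \<beta> \<gamma> by auto
    have la: "length \<alpha> \<le> length \<gamma> \<or> out_arcs E w = {}" and lb: "length \<beta> \<le> length \<gamma> \<or> out_arcs E w = {}"
      using long by auto
    consider "?a \<in> K" | "?b \<in> K"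
      | \<delta> \<epsilon> where "awalk u \<delta> w" "?a \<approx> walk_t \<delta> w" "awalk u \<epsilon> w" "?b \<approx> walk_s \<epsilon> w"
      using long_walk_t_s(1)[OF \<gamma> \<alpha> la] long_walk_t_s(2)[OF \<gamma> \<beta> lb] by blast
    then show ?thesis
    proof cases
      case 1
      then show ?thesis unfolding eq by (intro kspan.inK K_right[OF ab(2)])
    next
      case 2
      then show ?thesis unfolding eq by (intro kspan.inK K_left[OF ab(1)])
    next
      case 3
      then have "?a * ?b \<approx> walk_t \<delta> w * walk_s \<epsilon> w" using ab by (intro eqK_mult) auto
      then show ?thesis unfolding eq using walk_t_s_loops[OF 3(1,3)] kspan_eqK by blast
    qed
  qed
  then show ?thesis by blast
qed

text \<open>
  Both sides of \<open>t\<^sub>\<gamma> s\<^sub>\<alpha> t\<^sub>\<beta> s\<^sub>\<gamma>\<close> collapse once \<open>\<gamma>\<close> is at least as long as the finitely many \<open>\<alpha>\<close> and \<open>\<beta>\<close> in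
  \<open>x\<close>; what remains is \<open>t\<^sub>\<delta> s\<^sub>\<epsilon>\<close> with walks \<open>\<delta>\<close>, \<open>\<epsilon>\<close> between the same two vertices, that is, a closed
  walk or zero. For a sink \<open>v\<close> the only walk is the empty one, and it suffices.
\<close>

lemma compress:
  assumes x: "x \<in> free_algebra X" and v: "v \<in> verts E"
  shows "\<exists>n. (out_arcs E v = {} \<longrightarrow> n = 0) \<and>
    (\<forall>\<gamma> w. awalk v \<gamma> w \<and> length \<gamma> = n \<longrightarrow> walk_t \<gamma> w * x * walk_s \<gamma> w \<in> kspan (loops w))"
proof -
  have "\<exists>n. \<forall>\<gamma> w. awalk v \<gamma> w \<and> (n \<le> length \<gamma> \<or> out_arcs E w = {}) \<longrightarrow>
    walk_t \<gamma> w * x * walk_s \<gamma> w \<in> kspan (loops w)"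
    using free_algebra_monomials[OF x]
  proof (induction rule: kspan.induct)
    case (inK x)
    have "walk_t \<gamma> w * x * walk_s \<gamma> w \<in> kspan (loops w)" if "awalk v \<gamma> w" for \<gamma> w
      using that inK by (intro kspan.inK K_right[OF walk_in(1)] K_left[OF walk_in(2)])
    then show ?case by blast
  next
    case (base m)
    then show ?case by (rule compress_monomial)
  next
    case (add x y)
    obtain n where n: "\<And>\<gamma> w. awalk v \<gamma> w \<and> (n \<le> length \<gamma> \<or> out_arcs E w = {}) \<Longrightarrow>
        walk_t \<gamma> w * x * walk_s \<gamma> w \<in> kspan (loops w)" using add.IH by blast
    obtain n' where n': "\<And>\<gamma> w. awalk v \<gamma> w \<and> (n' \<le> length \<gamma> \<or> out_arcs E w = {}) \<Longrightarrow>
        walk_t \<gamma> w * y * walk_s \<gamma> w \<in> kspan (loops w)" using add.IH by blast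
    have "walk_t \<gamma> w * (x + y) * walk_s \<gamma> w \<in> kspan (loops w)"
      if "awalk v \<gamma> w \<and> (max n n' \<le> length \<gamma> \<or> out_arcs E w = {})" for \<gamma> w
      using n[of \<gamma> w] n'[of \<gamma> w] that by (auto simp: distrib_left distrib_right intro: kspan.add)
    then show ?case by blast
  next
    case (scale x c)
    have "walk_t \<gamma> w * scale c x * walk_s \<gamma> w = scale c (walk_t \<gamma> w * x * walk_s \<gamma> w)" for \<gamma> w
      by (simp add: scale_mult_right_eq scale_mult_left_eq)
    then show ?case using scale.IH kspan.scale by metis
  qed
  then obtain n where n: "\<And>\<gamma> w. awalk v \<gamma> w \<and> (n \<le> length \<gamma> \<or> out_arcs E w = {}) \<Longrightarrow>
    walk_t \<gamma> w * x * walk_s \<gamma> w \<in> kspan (loops w)" by blast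
  show ?thesis
  proof (cases "out_arcs E v = {}")
    case True
    then have "walk_t \<gamma> w * x * walk_s \<gamma> w \<in> kspan (loops w)" if "awalk v \<gamma> w \<and> length \<gamma> = 0" for \<gamma> w
      using n[of \<gamma> w] that by (auto simp: awalk_Nil_iff)
    then show ?thesis by (intro exI[of _ 0] conjI allI impI) simp_all
  next
    case False
    have "walk_t \<gamma> w * x * walk_s \<gamma> w \<in> kspan (loops w)" if "awalk v \<gamma> w \<and> length \<gamma> = n" for \<gamma> w
      using n[of \<gamma> w] that by simp
    with False show ?thesis by (intro exI[of _ n] conjI allI impI) simp_all
  qed
qed

lemma loops_combination:
  assumes "y \<in> kspan (loops w)"
  shows "\<exists>D c. finite D \<and> (\<forall>i\<in>D. awalk w (snd i) w) \<and> y \<approx> (\<Sum>i\<in>D. scale (c i) (loop w i))"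
  using assms
proof (induction rule: kspan.induct)
  case (inK x)
  then show ?case by (intro exI[of _ "{}"]) (simp add: eqK_zero_iff)
next
  case (base x)
  then obtain i where "awalk w (snd i) w" "x = loop w i" by (auto simp: loops_def)
  then show ?case by (intro exI[of _ "{i}"] exI[of _ "\<lambda>_. 1"]) simp
next
  case (add x y)
  obtain D c where D: "finite D" "\<forall>i\<in>D. awalk w (snd i) w" "x \<approx> (\<Sum>i\<in>D. scale (c i) (loop w i))"
    using add.IH by blast
  obtain D' c' where D': "finite D'" "\<forall>i\<in>D'. awalk w (snd i) w" "y \<approx> (\<Sum>i\<in>D'. scale (c' i) (loop w i))"
    using add.IH by blast
  let ?d = "\<lambda>i. (if i \<in> D then c i else 0) + (if i \<in> D' then c' i else 0)"
  have 1: "(\<Sum>i\<in>D. scale (c i) (loop w i)) = (\<Sum>i\<in>D \<union> D'. scale (if i \<in> D then c i else 0) (loop w i))"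
    using D D' by (intro sum.mono_neutral_cong_left) auto
  have 2: "(\<Sum>i\<in>D'. scale (c' i) (loop w i)) = (\<Sum>i\<in>D \<union> D'. scale (if i \<in> D' then c' i else 0) (loop w i))"
    using D D' by (intro sum.mono_neutral_cong_left) auto
  have "x + y \<approx> (\<Sum>i\<in>D \<union> D'. scale (?d i) (loop w i))"
    using eqK_add[OF D(3) D'(3)] unfolding 1 2 by (simp add: scale_add_left sum.distrib)
  then show ?case using D D' by (intro exI[of _ "D \<union> D'"] exI[of _ ?d]) auto
next
  case (scale x a)
  then obtain D c where D: "finite D" "\<forall>i\<in>D. awalk w (snd i) w" "x \<approx> (\<Sum>i\<in>D. scale (c i) (loop w i))"
    by blast
  have "scale a x \<approx> (\<Sum>i\<in>D. scale (a * c i) (loop w i))"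
    using eqK_scale[OF D(3), of a] by (simp add: scale_sum scale_scale)
  then show ?case using D by (intro exI[of _ D] exI[of _ "\<lambda>i. a * c i"]) auto
qed

lemma words_splitting:
  assumes H: "hereditary E H" "H \<noteq> {}" and L: "hereditary E L" "L \<noteq> {}" and disj: "H \<inter> L = {}"
    and sat: "verts E \<subseteq> saturation E (H \<union> L)"
  shows "ideal_splitting (annihilator L) (annihilator H)"
proof (rule graph_splits_imp_splitting[OF _ H(2) _ L(2) sat])
  show HL: "H \<subseteq> verts E" "L \<subseteq> verts E" using H L by (auto simp: hereditary_def)
  show orth: "p v * (a * p w) \<in> K \<and> p w * (a * p v) \<in> K" if "v \<in> H" "w \<in> L" "a \<in> free_algebra X" for v w a
    using hereditary_orthogonal[OF H(1) L(1) disj] hereditary_orthogonal[OF L(1) H(1)] disj that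
    by (simp add: Int_commute)
  fix x :: "'g free_word \<Rightarrow>\<^sub>0 'k" assume x: "x \<in> free_algebra X"
  let ?M = "{a + b | a b. a \<in> annihilator L \<and> b \<in> annihilator H}"
  have M: "full_ideal ?M" by (intro sum_ideal annihilator_ideal HL)
  have z: "0 \<in> annihilator L" "0 \<in> annihilator H"
    using full_idealD(1)[OF annihilator_ideal K_zero] HL by auto
  have "p v \<in> ?M" if v: "v \<in> H \<union> L" for v
  proof (cases "v \<in> H")
    case True
    then have "p v \<in> annihilator L" unfolding annihilator_def using orth[OF True] HL by auto
    then have "p v + 0 \<in> ?M" using z by blast
    then show ?thesis by simp
  next
    case False
    then have "v \<in> L" using v by simp
    then have "p v \<in> annihilator H" unfolding annihilator_def using orth[OF _ \<open>v \<in> L\<close>] HL by auto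
    then have "0 + p v \<in> ?M" using z by blast
    then show ?thesis by simp
  qed
  then have "p v \<in> ?M" if "v \<in> verts E" for v
    using full_ideal_saturation[OF M, of "H \<union> L" v] that sat by blast
  then have "x \<in> ?M" using full_ideal_all[OF M _ x] by blast
  then show "\<exists>a\<in>annihilator L. \<exists>b\<in>annihilator H. x = a + b" by blast
qed

end

section \<open>Idempotents on loops\<close>

context ck_words
begin

text \<open>
  The algebra of the top degree argument. Think of \<open>P = p\<^sub>w\<close>, of \<open>T = t\<^sub>\<delta>\<close> with \<open>\<delta>\<close> of maximal length
  \<open>n\<close> among the forward walks in \<open>y\<close>, of \<open>c\<close> as the coefficient of \<open>s\<^sub>\<delta>\<close>, of \<open>B1\<close> as the nonempty backward
  walks and of \<open>B2\<close> as those longer than \<open>n\<close>. Then \<open>T T y\<close> and \<open>T T y y\<close> agree; the former has negative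
  degree, whereas the latter has constant term \<open>c\<^sup>2 P\<close>.

  The product \<open>opr\<close> is ordinary or reversed multiplication. The reversed one serves for the backward
  walks in \<open>y\<close>, so that the argument is needed only once.
\<close>

lemma idempotent_top_degree:
  fixes opr :: "('g free_word \<Rightarrow>\<^sub>0 'k) \<Rightarrow> ('g free_word \<Rightarrow>\<^sub>0 'k) \<Rightarrow> ('g free_word \<Rightarrow>\<^sub>0 'k)"
  assumes opr: "opr = (*) \<or> opr = (\<lambda>x y. y * x)"
    and y: "y \<in> free_algebra X" "y * y \<approx> y" and T: "T \<in> free_algebra X"
    and P: "P \<in> free_algebra X" and B2: "B2 \<subseteq> free_algebra X" and B1: "B1 \<subseteq> free_algebra X"
    and Ty: "opr T y - scale c P \<in> kspan B1"
    and By: "\<And>b. b \<in> B2 \<Longrightarrow> opr b y \<in> kspan B1"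
    and TP: "opr T P \<approx> T"
    and TB: "\<And>b. b \<in> B1 \<Longrightarrow> opr T b \<in> kspan B2"
    and TT: "opr T T \<in> kspan B2"
  shows "scale (c * c) P \<in> kspan B1"
proof -
  have assoc: "opr (opr a b) d = opr a (opr b d)" for a b d using opr by (auto simp: mult.assoc)
  have closed: "opr a b \<in> free_algebra X" if "a \<in> free_algebra X" "b \<in> free_algebra X" for a b
    using opr that by auto
  have addl: "opr (a + b) d = opr a d + opr b d" and addr: "opr a (b + d) = opr a b + opr a d" for a b d
    using opr by (auto simp: algebra_simps)
  have scl: "opr (scale r a) b = scale r (opr a b)" and scr: "opr a (scale r b) = scale r (opr a b)" for a b r
    using opr by (auto simp: scale_mult_left scale_mult_right)
  have congl: "opr a b \<approx> opr a' b" if "a \<approx> a'" "b \<in> free_algebra X" for a a' b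
    using opr that eqK_left eqK_right by auto
  have congr: "opr b a \<approx> opr b a'" if "a \<approx> a'" "b \<in> free_algebra X" for a a' b
    using opr that eqK_left eqK_right by auto
  have spanl: "opr a u \<in> kspan B'" if "u \<in> kspan B" "a \<in> free_algebra X" "\<And>b. b \<in> B \<Longrightarrow> opr a b \<in> kspan B'"
    for a u B B' using opr kspan_mult[OF that(1,2), of B'] that(3) by auto
  have spanr: "opr u a \<in> kspan B'" if "u \<in> kspan B" "a \<in> free_algebra X" "\<And>b. b \<in> B \<Longrightarrow> opr b a \<in> kspan B'"
    for a u B B' using opr kspan_mult[OF that(1,2), of B'] that(3) by auto
  have B2y: "opr u y \<in> kspan B1" if "u \<in> kspan B2" for u using spanr[OF that y(1) By] .
  define u where "u = opr T y - scale c P"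
  have u: "u \<in> kspan B1" "opr T y = scale c P + u" using Ty by (auto simp: u_def)
  have Tu: "opr T u \<in> kspan B2" using spanl[OF u(1) T TB] .
  have "opr (opr T T) (opr y y) \<approx> opr (opr T T) y"
    using opr y(2) by (intro congr closed T) auto
  then have 1: "opr (opr T T) (opr y y) \<in> kspan B1" using kspan_eqK B2y[OF TT] by blast
  have "opr (opr T T) (opr y y) = opr (opr T (opr T y)) y" by (simp add: assoc)
  also have "opr T (opr T y) = scale c (opr T P) + opr T u" by (simp add: u(2) addr scr)
  also have "opr (scale c (opr T P) + opr T u) y \<approx> opr (scale c T + opr T u) y"
    by (rule congl[OF _ y(1)]) (intro eqK_add eqK_scale TP eqK_refl)
  also have "opr (scale c T + opr T u) y = scale (c * c) P + (scale c u + opr (opr T u) y)"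
    by (simp add: addl scl u(2) scale_add scale_scale add.assoc)
  finally have eq: "opr (opr T T) (opr y y) \<approx> scale (c * c) P + (scale c u + opr (opr T u) y)" .
  have "scale (c * c) P + (scale c u + opr (opr T u) y) \<in> kspan B1"
    using kspan_eqK[OF eqK_sym[OF eq] 1] .
  moreover have "scale c u + opr (opr T u) y \<in> kspan B1"
    by (intro kspan.add kspan.scale u B2y Tu)
  ultimately have "(scale (c * c) P + (scale c u + opr (opr T u) y)) - (scale c u + opr (opr T u) y) \<in> kspan B1"
    by (rule kspan_diff)
  then show ?thesis by simp
qed

lemma kspan_mono: "x \<in> kspan B \<Longrightarrow> B \<subseteq> B' \<Longrightarrow> x \<in> kspan B'"
  by (induction rule: kspan.induct) (auto intro: kspan.intros)

text \<open>
  Multiplication, reversed for backward walks. With this convention the rules for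
  \<open>loop w (\<not> b, \<mu>)\<close> acting on \<open>loop w (b, \<nu>)\<close> do not depend on the direction \<open>b\<close>.
\<close>

definition opr :: "bool \<Rightarrow> ('g free_word \<Rightarrow>\<^sub>0 'k) \<Rightarrow> ('g free_word \<Rightarrow>\<^sub>0 'k) \<Rightarrow> ('g free_word \<Rightarrow>\<^sub>0 'k)" where
  "opr b x y = (if b then x * y else y * x)"

lemma loop_in: "awalk w (snd i) w \<Longrightarrow> loop w i \<in> free_algebra X"
  by (auto simp: loop_def)

lemma opr_loop_self:
  assumes "awalk w \<mu> w"
  shows "opr b (loop w (\<not> b, \<mu>)) (loop w (b, \<mu>)) \<approx> p w"
  using walk_t_s_self[OF assms] by (auto simp: opr_def loop_def)

lemma opr_loop_append:
  assumes "awalk w \<mu> w" "awalk w \<nu> w"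
  shows "opr b (loop w (\<not> b, \<mu>)) (loop w (\<not> b, \<nu>)) \<approx> loop w (\<not> b, \<nu> @ \<mu>)"
  using walk_t_append[OF assms(2,1)] walk_s_append[OF assms(2,1)] by (auto simp: opr_def loop_def)

lemma opr_loop_shorter:
  assumes \<mu>: "awalk w \<mu> w" and \<nu>: "awalk w \<nu> w" and "length \<nu> \<le> length \<mu>" "\<nu> \<noteq> \<mu>"
  shows "opr b (loop w (\<not> b, \<mu>)) (loop w (b, \<nu>)) \<in> kspan {loop w (\<not> b, \<kappa>) | \<kappa>. awalk w \<kappa> w \<and> \<kappa> \<noteq> []}"
proof (cases "prefix \<nu> \<mu>")
  case True
  then obtain \<kappa> where \<kappa>: "\<mu> = \<nu> @ \<kappa>" by (auto simp: prefix_def)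
  then have k: "awalk w \<kappa> w" "\<kappa> \<noteq> []" using \<mu> \<nu> assms(4) by (auto simp: awalk_append_iff dest: awalk_ends)
  have "opr b (loop w (\<not> b, \<mu>)) (loop w (b, \<nu>)) \<approx> loop w (\<not> b, \<kappa>)"
    using walk_t_append_s[OF \<nu> k(1)] walk_t_s_append[OF \<nu> k(1)] by (auto simp: opr_def loop_def \<kappa>)
  then show ?thesis by (rule kspan_baseI) (use k in blast)
next
  case False
  moreover have "\<not> prefix \<mu> \<nu>" using assms(3,4) by (auto simp: prefix_def)
  ultimately have "opr b (loop w (\<not> b, \<mu>)) (loop w (b, \<nu>)) \<in> K"
    using walk_t_s_incomparable[OF \<mu> \<nu>] walk_t_s_incomparable[OF \<nu> \<mu>] by (auto simp: opr_def loop_def)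
  then show ?thesis by (rule kspan.inK)
qed

lemma opr_loop_unit: "awalk w \<mu> w \<Longrightarrow> opr b (loop w (\<not> b, \<mu>)) (p w) \<approx> loop w (\<not> b, \<mu>)"
  using walk_t_p[of w \<mu> w] p_walk_s[of w \<mu> w] by (auto simp: opr_def loop_def)

lemma opr_sum:
  assumes "y \<approx> (\<Sum>i\<in>D. scale (c i) (f i))" "a \<in> free_algebra X"
  shows "opr b a y \<approx> (\<Sum>i\<in>D. scale (c i) (opr b a (f i)))"
proof -
  have "opr b a y \<approx> opr b a (\<Sum>i\<in>D. scale (c i) (f i))"
    using eqK_left[OF assms] eqK_right[OF assms] by (simp add: opr_def)
  then show ?thesis
    by (simp add: opr_def sum_distrib_left sum_distrib_right scale_mult_left scale_mult_right split: if_splits)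
qed

end

text \<open>
  The independence of \<open>p\<^sub>w\<close> from the closed walks of nonzero length is the trace of the grading by
  length that the argument uses.
\<close>

locale graded_ck_words = ck_words +
  assumes loops_independent:
    "w \<in> verts E \<Longrightarrow> p w \<notin> kspan {loop w i | i. awalk w (snd i) w \<and> snd i \<noteq> []}"
begin

lemma loop_coefficient_zero:
  assumes w: "w \<in> verts E" and y: "y \<in> free_algebra X" "y * y \<approx> y"
    and D: "finite D" "\<And>i. i \<in> D \<Longrightarrow> awalk w (snd i) w" "\<And>i. i \<in> D \<Longrightarrow> c i \<noteq> 0"
    and yD: "y \<approx> (\<Sum>i\<in>D. scale (c i) (loop w i))"
    and i: "(b, \<mu>) \<in> D"
  shows "\<mu> = []"
proof (rule ccontr)
  assume "\<mu> \<noteq> []"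
  \<comment> \<open>Among the walks read in direction \<open>b\<close>, choose a longest one.\<close>
  let ?L = "{\<mu>. (b, \<mu>) \<in> D}"
  have "finite ?L"
    using D(1) by (rule finite_subset[of _ "snd ` D", rotated, OF finite_imageI]) force
  then have fin: "finite (length ` ?L)" by (rule finite_imageI)
  have "Max (length ` ?L) \<in> length ` ?L" using fin i by (intro Max_in) auto
  then obtain \<delta> where \<delta>: "(b, \<delta>) \<in> D" and len: "length \<delta> = Max (length ` ?L)" by auto
  have max: "length \<nu> \<le> length \<delta>" if "(b, \<nu>) \<in> D" for \<nu>
    unfolding len using fin that by (intro Max_ge) auto
  have ne: "\<delta> \<noteq> []" using max[OF i] \<open>\<mu> \<noteq> []\<close> by auto
  have aw: "awalk w \<delta> w" using D(2)[OF \<delta>] by simp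
  let ?T = "loop w (\<not> b, \<delta>)"
  let ?B1 = "{loop w (\<not> b, \<kappa>) | \<kappa>. awalk w \<kappa> w \<and> \<kappa> \<noteq> []}"
  let ?B2 = "{loop w (\<not> b, \<kappa>) | \<kappa>. awalk w \<kappa> w \<and> length \<delta> < length \<kappa>}"
  have step: "opr b (loop w (\<not> b, \<nu>)) (loop w i) \<in> kspan ?B1"
    if \<nu>: "awalk w \<nu> w" "length \<delta> \<le> length \<nu>" and i: "i \<in> D" "i \<noteq> (b, \<nu>)" for \<nu> i
  proof -
    obtain b' \<kappa> where i': "i = (b', \<kappa>)" by force
    have \<kappa>: "awalk w \<kappa> w" using D(2)[OF i(1)] i' by simp
    show ?thesis
    proof (cases "b' = b")
      case True
      then have "length \<kappa> \<le> length \<nu>" "\<kappa> \<noteq> \<nu>" using max[of \<kappa>] i i' \<nu>(2) by auto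
      then show ?thesis using opr_loop_shorter[OF \<nu>(1) \<kappa>] i' True by simp
    next
      case False
      then have b': "b' = (\<not> b)" by auto
      have "awalk w (\<kappa> @ \<nu>) w" "\<kappa> @ \<nu> \<noteq> []" using awalk_appendI[OF \<kappa> \<nu>(1)] \<nu>(2) ne by auto
      then have "loop w (\<not> b, \<kappa> @ \<nu>) \<in> ?B1" by blast
      then show ?thesis unfolding i' b' by (rule kspan_baseI[OF opr_loop_append[OF \<nu>(1) \<kappa>]])
    qed
  qed
  have "scale (c (b, \<delta>) * c (b, \<delta>)) (p w) \<in> kspan ?B1"
  proof (rule idempotent_top_degree[of "opr b" y ?T "p w" ?B2 ?B1])
    show "opr b = (*) \<or> opr b = (\<lambda>x y. y * x)" by (cases b) (auto simp: opr_def fun_eq_iff)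
    show "?T \<in> free_algebra X" "p w \<in> free_algebra X" using loop_in aw w by auto
    show "?B2 \<subseteq> free_algebra X" "?B1 \<subseteq> free_algebra X" using loop_in by auto
    let ?f = "\<lambda>i. scale (c i) (opr b ?T (loop w i))"
    have "opr b ?T y \<approx> sum ?f D" by (rule opr_sum[OF yD]) (use loop_in aw in auto)
    also have "sum ?f D = scale (c (b, \<delta>)) (opr b ?T (loop w (b, \<delta>))) + sum ?f (D - {(b, \<delta>)})"
      using D(1) \<delta> by (subst sum.remove) auto
    also have "\<dots> \<approx> scale (c (b, \<delta>)) (p w) + sum ?f (D - {(b, \<delta>)})"
      by (intro eqK_add eqK_scale opr_loop_self aw eqK_refl)
    finally have "opr b ?T y - scale (c (b, \<delta>)) (p w) \<approx> sum ?f (D - {(b, \<delta>)})"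
      by (simp add: eqK_def algebra_simps)
    moreover have "sum ?f (D - {(b, \<delta>)}) \<in> kspan ?B1"
      by (intro kspan_sum kspan.scale step aw) auto
    ultimately show "opr b ?T y - scale (c (b, \<delta>)) (p w) \<in> kspan ?B1" by (rule kspan_eqK)
    show "opr b x y \<in> kspan ?B1" if x2: "x \<in> ?B2" for x
    proof -
      obtain \<nu> where x: "x = loop w (\<not> b, \<nu>)" and \<nu>: "awalk w \<nu> w" "length \<delta> < length \<nu>"
        using x2 by blast
      have "opr b x y \<approx> (\<Sum>i\<in>D. scale (c i) (opr b x (loop w i)))"
        by (rule opr_sum[OF yD]) (use x loop_in \<nu> in auto)
      moreover have "(\<Sum>i\<in>D. scale (c i) (opr b x (loop w i))) \<in> kspan ?B1"
        unfolding x using \<nu> max[of \<nu>] by (intro kspan_sum kspan.scale step) auto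
      ultimately show ?thesis by (rule kspan_eqK)
    qed
    show "opr b ?T (p w) \<approx> ?T" by (rule opr_loop_unit[OF aw])
    show "opr b ?T x \<in> kspan ?B2" if x1: "x \<in> ?B1" for x
    proof -
      obtain \<nu> where x: "x = loop w (\<not> b, \<nu>)" and \<nu>: "awalk w \<nu> w" "\<nu> \<noteq> []"
        using x1 by blast
      have "loop w (\<not> b, \<nu> @ \<delta>) \<in> ?B2" using awalk_appendI[OF \<nu>(1) aw] \<nu>(2) by auto
      then show ?thesis unfolding x by (rule kspan_baseI[OF opr_loop_append[OF aw \<nu>(1)]])
    qed
    have "loop w (\<not> b, \<delta> @ \<delta>) \<in> ?B2" using awalk_appendI[OF aw aw] ne by auto
    then show "opr b ?T ?T \<in> kspan ?B2" by (rule kspan_baseI[OF opr_loop_append[OF aw aw]])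
  qed (use y in auto)
  from kspan.scale[OF this, of "inverse (c (b, \<delta>) * c (b, \<delta>))"] have "p w \<in> kspan ?B1"
    using D(3)[OF \<delta>] left_inverse[of "c (b, \<delta>) * c (b, \<delta>)"] by (simp only: scale_scale) simp
  then have "p w \<in> kspan {loop w i | i. awalk w (snd i) w \<and> snd i \<noteq> []}"
    by (rule kspan_mono) auto
  then show False using loops_independent[OF w] by blast
qed

text \<open>
  By the top degree argument only multiples \<open>d p\<^sub>w\<close> remain, and \<open>d\<^sup>2 = d\<close> in a field leaves \<open>0\<close> and \<open>1\<close>.
\<close>

lemma loop_idempotent:
  assumes w: "w \<in> verts E" and y: "y \<in> free_algebra X" "y * y \<approx> y" "y \<in> kspan (loops w)"
  shows "y \<in> K \<or> p w \<approx> y"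
proof -
  obtain D c where D: "finite D" "\<forall>i\<in>D. awalk w (snd i) w" "y \<approx> (\<Sum>i\<in>D. scale (c i) (loop w i))"
    using loops_combination[OF y(3)] by blast
  define D' where "D' = {i \<in> D. c i \<noteq> 0}"
  have "(\<Sum>i\<in>D. scale (c i) (loop w i)) = (\<Sum>i\<in>D'. scale (c i) (loop w i))"
    using D by (intro sum.mono_neutral_right) (auto simp: D'_def)
  then have D': "finite D'" "\<And>i. i \<in> D' \<Longrightarrow> awalk w (snd i) w" "\<And>i. i \<in> D' \<Longrightarrow> c i \<noteq> 0"
    "y \<approx> (\<Sum>i\<in>D'. scale (c i) (loop w i))"
    using D by (auto simp: D'_def)
  have "loop w i = p w" if "i \<in> D'" for i
    using loop_coefficient_zero[OF w y(1,2) D', of "fst i" "snd i"] that by (simp add: loop_def)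
  then have "(\<Sum>i\<in>D'. scale (c i) (loop w i)) = (\<Sum>i\<in>D'. scale (c i) (p w))" by simp
  also have "\<dots> = scale (\<Sum>i\<in>D'. c i) (p w)" by (simp only: scale_sum_coeffs)
  finally obtain d where d: "y \<approx> scale d (p w)" using D'(4) by metis
  have "scale (d * d) (p w) \<approx> scale (d * d) (p w * p w)"
    by (intro eqK_scale eqK_sym[OF p_idem[OF w]])
  also have "\<dots> = scale d (p w) * scale d (p w)"
    by (simp add: scale_mult_left scale_mult_right scale_scale)
  also have "\<dots> \<approx> y * y" using w y by (intro eqK_mult eqK_sym[OF d]) auto
  also have "\<dots> \<approx> y" by (rule y)
  also have "\<dots> \<approx> scale d (p w)" by (rule d)
  finally have dd: "scale (d * d - d) (p w) \<in> K" by (simp add: eqK_def scale_diff_left)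
  have "d * d - d = 0"
  proof (rule ccontr)
    assume nz: "d * d - d \<noteq> 0"
    from K_scale[OF dd, of "inverse (d * d - d)"] have "p w \<in> K"
      unfolding scale_scale left_inverse[OF nz] by simp
    then show False using p_not_in_K[OF w] by simp
  qed
  then have "d = 0 \<or> d = 1" by (simp add: algebra_simps)
  then show ?thesis using d eqK_sym by (auto simp: eqK_zero_iff)
qed

theorem splitting_iff_graph_splits: "(\<exists>I J. ideal_splitting I J) \<longleftrightarrow> graph_splits E"
proof
  assume "graph_splits E"
  then obtain H L where "hereditary E H" "H \<noteq> {}" "hereditary E L" "L \<noteq> {}" "H \<inter> L = {}"
      "verts E \<subseteq> saturation E (H \<union> L)"
    unfolding graph_splits_def by blast
  from words_splitting[OF this] show "\<exists>I J. ideal_splitting I J" by blast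
next
  assume "\<exists>I J. ideal_splitting I J"
  then obtain I J where IJ: "ideal_splitting I J" by blast
  show "graph_splits E"
  proof (rule splitting_imp_graph_splits[OF IJ])
    fix v assume v: "v \<in> verts E"
    obtain a where a: "ideal_part I J (p v) a" using part_ex[OF IJ p_in[OF v]] by blast
    obtain n where n0: "out_arcs E v = {} \<longrightarrow> n = 0" and
        n: "\<forall>\<gamma> w. awalk v \<gamma> w \<and> length \<gamma> = n \<longrightarrow> walk_t \<gamma> w * a * walk_s \<gamma> w \<in> kspan (loops w)"
      using compress[OF part_in_S[OF IJ a] v] by (elim exE conjE)
    have "p w \<in> I \<or> p w \<in> J" if \<gamma>: "awalk v \<gamma> w \<and> length \<gamma> = n" for \<gamma> w
    proof -
      have w: "w \<in> verts E" using \<gamma> awalk_verts_ends by blast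
      obtain b where b: "ideal_part I J (p w) b" using part_ex[OF IJ p_in[OF w]] by blast
      have "b \<approx> walk_t \<gamma> w * a * walk_s \<gamma> w"
        using part_transport[OF IJ conjunct1[OF \<gamma>] a b] by (rule eqK_sym)
      then have "b \<in> kspan (loops w)" by (rule kspan_eqK) (use n \<gamma> in blast)
      then have "b \<in> K \<or> p w \<approx> b"
        using loop_idempotent[OF w part_in_S[OF IJ b] part_p_idem(1)[OF IJ w b]] by blast
      then show ?thesis using part_zero_imp[OF IJ b] part_one_imp[OF IJ b] by blast
    qed
    then show "\<exists>n. (out_arcs E v = {} \<longrightarrow> n = 0) \<and>
        (\<forall>\<gamma> w. awalk v \<gamma> w \<and> length \<gamma> = n \<longrightarrow> p w \<in> I \<or> p w \<in> J)"
      using n0 by (intro exI[of _ n] conjI allI impI) blast+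
  qed
qed

end

section \<open>Actions of free algebras on functions\<close>

locale word_action =
  fixes opr :: "'g \<Rightarrow> ('b \<Rightarrow> 'k::comm_ring_1) \<Rightarrow> 'b \<Rightarrow> 'k"
  assumes opr_add: "opr g (\<lambda>b. f b + h b) = (\<lambda>b. opr g f b + opr g h b)"
    and opr_scale: "opr g (\<lambda>b. c * f b) = (\<lambda>b. c * opr g f b)"
begin

definition word_act :: "'g list \<Rightarrow> ('b \<Rightarrow> 'k) \<Rightarrow> 'b \<Rightarrow> 'k" where
  "word_act l = foldr opr l"

definition act :: "('g free_word \<Rightarrow>\<^sub>0 'k) \<Rightarrow> ('b \<Rightarrow> 'k) \<Rightarrow> 'b \<Rightarrow> 'k" where
  "act x f b = (\<Sum>w\<in>Poly_Mapping.keys x. Poly_Mapping.lookup x w * word_act (letters w) f b)"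

lemma word_act_add: "word_act l (\<lambda>b. f b + h b) = (\<lambda>b. word_act l f b + word_act l h b)"
  by (induction l) (simp_all add: word_act_def opr_add)

lemma word_act_scale: "word_act l (\<lambda>b. c * f b) = (\<lambda>b. c * word_act l f b)"
  by (induction l) (simp_all add: word_act_def opr_scale)

lemma act_zero [simp]: "act 0 f b = 0"
  by (simp add: act_def)

lemma act_single: "act (Poly_Mapping.single w c) f b = c * word_act (letters w) f b"
  by (simp add: act_def)

lemma act_add: "act (x + y) f b = act x f b + act y f b"
  unfolding act_def by (rule setsum_keys_plus_distrib) (auto simp: distrib_right)

lemma act_add_fun: "act x (\<lambda>b. f b + h b) b' = act x f b' + act x h b'"
  by (simp add: act_def word_act_add distrib_left sum.distrib)

lemma act_scale_fun: "act x (\<lambda>b. c * f b) b' = c * act x f b'"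
  by (simp add: act_def word_act_scale sum_distrib_left mult.left_commute)

lemma act_fun_zero [simp]: "act x (\<lambda>b. 0) b' = 0"
  using act_scale_fun[of x 0 "\<lambda>b. 0"] by simp

lemma act_mult: "act (x * y) f b = act x (act y f) b"
proof (induction x rule: poly_induct)
  case (single w c)
  show ?case
  proof (induction y rule: poly_induct)
    case zero
    have "act 0 f = (\<lambda>b. 0)" by auto
    then show ?case by simp
  next
    case (single w' c')
    have "act (Poly_Mapping.single w' c') f = (\<lambda>b. c' * word_act (letters w') f b)"
      by (auto simp: act_single)
    then show ?case
      by (simp add: mult_single act_single act_scale_fun word_act_scale mult.assoc)
        (simp add: word_act_def)
  next
    case (add y z)
    have "act (y + z) f = (\<lambda>b. act y f b + act z f b)" by (auto simp: act_add)
    then show ?case using add by (simp add: distrib_left act_add act_add_fun)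
  qed
qed (simp_all add: act_add distrib_right)

lemma act_gen: "act (gen g) f b = opr g f b"
  by (simp add: gen_def act_single word_act_def)

lemma act_scale: "act (scale c x) f b = c * act x f b"
proof -
  have "act (Poly_Mapping.single 0 c * x) f b = c * act x f b"
    by (simp add: act_mult act_single word_act_def)
  then show ?thesis by (simp add: scale_eq_mult)
qed

lemma act_uminus: "act (- x) f b = - act x f b"
  using act_scale[of "- 1" x] by (simp add: scale_minus_one_eq)

lemma act_diff: "act (x - y) f b = act x f b - act y f b"
  using act_add[of x "- y"] by (simp add: act_uminus)

lemma act_sum: "act (sum x A) f b = (\<Sum>i\<in>A. act (x i) f b)"
  by (induction A rule: infinite_finite_induct) (simp_all add: act_add)

lemma act_generated_ideal:
  assumes R: "\<And>r f b. r \<in> R \<Longrightarrow> act r f b = 0"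
  shows "x \<in> generated_ideal X R \<Longrightarrow> act x f b = 0"
proof (induction arbitrary: f b rule: generated_ideal.induct)
  case (left x a)
  have "act x f = (\<lambda>b. 0)" using left.IH by auto
  then show ?case by (simp add: act_mult)
qed (simp_all add: R act_add act_scale act_mult)

end

section \<open>A branching system\<close>

context row_finite_graph
begin

definition edge_index :: "'e \<Rightarrow> nat" where
  "edge_index e =
     (SOME h. bij_betw h (out_arcs E (tail E e)) {..<card (out_arcs E (tail E e))}) e"

definition out_deg :: "'v \<Rightarrow> nat" where
  "out_deg v = card (out_arcs E v)"

lemma edge_index_bij:
  assumes "v \<in> verts E"
  shows "bij_betw edge_index (out_arcs E v) {..<out_deg v}"
proof -
  let ?P = "\<lambda>h. bij_betw h (out_arcs E v) {..<card (out_arcs E v)}"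
  have "\<exists>h. ?P h"
    using ex_bij_betw_finite_nat[OF finite_out_arcs[OF assms]] by (simp add: atLeast0LessThan)
  then have "?P (SOME h. ?P h)" by (rule someI_ex)
  moreover have "edge_index e = (SOME h. ?P h) e" if "e \<in> out_arcs E v" for e
    using that by (auto simp: edge_index_def)
  ultimately show ?thesis
    unfolding out_deg_def using bij_betw_cong[of "out_arcs E v" edge_index "SOME h. ?P h"] by blast
qed

lemma edge_index_less: "e \<in> arcs E \<Longrightarrow> edge_index e < out_deg (tail E e)"
  using edge_index_bij[of "tail E e"] by (auto simp: bij_betw_def)

lemma edge_index_inj:
  "e \<in> arcs E \<Longrightarrow> f \<in> arcs E \<Longrightarrow> tail E e = tail E f \<Longrightarrow> edge_index e = edge_index f \<Longrightarrow> e = f"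
  using edge_index_bij[of "tail E e"] by (auto simp: bij_betw_def inj_on_def)

text \<open>
  Over each vertex lies a copy of \<open>\<nat> \<times> \<int>\<close>. An edge \<open>e\<close> from \<open>v\<close> maps the copy over its head bijectively
  onto the residue class \<open>edge_index e\<close> modulo \<open>out_deg v\<close> over \<open>v\<close>, and raises the level in \<open>\<int>\<close> by one.
  Since the residue classes of the edges from \<open>v\<close> partition \<open>\<nat>\<close>, the Leavitt relations hold. The level
  makes the degree of a walk visible. The operators act on functions on these points.
\<close>

definition vertex_op :: "'v \<Rightarrow> ('v \<times> nat \<times> int \<Rightarrow> 'k::comm_ring_1) \<Rightarrow> 'v \<times> nat \<times> int \<Rightarrow> 'k" where
  "vertex_op v f = (\<lambda>(u, k, i). if u = v then f (u, k, i) else 0)"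

definition edge_op :: "'e \<Rightarrow> ('v \<times> nat \<times> int \<Rightarrow> 'k::comm_ring_1) \<Rightarrow> 'v \<times> nat \<times> int \<Rightarrow> 'k" where
  "edge_op e f = (\<lambda>(u, k, i).
     if u = tail E e \<and> k mod out_deg (tail E e) = edge_index e
     then f (head E e, k div out_deg (tail E e), i - 1) else 0)"

definition ghost_op :: "'e \<Rightarrow> ('v \<times> nat \<times> int \<Rightarrow> 'k::comm_ring_1) \<Rightarrow> 'v \<times> nat \<times> int \<Rightarrow> 'k" where
  "ghost_op e f = (\<lambda>(u, k, i).
     if u = head E e then f (tail E e, k * out_deg (tail E e) + edge_index e, i + 1) else 0)"

lemmas op_defs = vertex_op_def edge_op_def ghost_op_def

lemma op_add:
  "vertex_op v (\<lambda>b. f b + h b) = (\<lambda>b. vertex_op v f b + vertex_op v h b)"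
  "edge_op e (\<lambda>b. f b + h b) = (\<lambda>b. edge_op e f b + edge_op e h b)"
  "ghost_op e (\<lambda>b. f b + h b) = (\<lambda>b. ghost_op e f b + ghost_op e h b)"
  by (auto simp: op_defs fun_eq_iff)

lemma op_scale:
  "vertex_op v (\<lambda>b. c * f b) = (\<lambda>b. c * vertex_op v f b)"
  "edge_op e (\<lambda>b. c * f b) = (\<lambda>b. c * edge_op e f b)"
  "ghost_op e (\<lambda>b. c * f b) = (\<lambda>b. c * ghost_op e f b)"
  by (auto simp: op_defs fun_eq_iff)

lemma vertex_vertex_op: "vertex_op v (vertex_op w f) b = (if v = w then vertex_op v f b else 0)"
  by (cases b) (auto simp: op_defs)

lemma vertex_edge_op: "vertex_op (tail E e) (edge_op e f) b = edge_op e f b"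
  by (cases b) (auto simp: op_defs)

lemma edge_vertex_op: "edge_op e (vertex_op (head E e) f) b = edge_op e f b"
  by (cases b) (auto simp: op_defs)

lemma vertex_ghost_op: "vertex_op (head E e) (ghost_op e f) b = ghost_op e f b"
  by (cases b) (auto simp: op_defs)

lemma ghost_vertex_op: "ghost_op e (vertex_op (tail E e) f) b = ghost_op e f b"
  by (cases b) (auto simp: op_defs)

lemma ghost_edge_op:
  assumes "e \<in> arcs E" "g \<in> arcs E"
  shows "ghost_op e (edge_op g f) b = (if e = g then vertex_op (head E e) f b else 0)"
proof -
  obtain u k i where b: "b = (u, k, i)" by (cases b) auto
  let ?d = "out_deg (tail E e)"
  have d: "(k * ?d + edge_index e) mod ?d = edge_index e" "(k * ?d + edge_index e) div ?d = k"
    using edge_index_less[OF assms(1)] by auto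
  show ?thesis
  proof (cases "tail E e = tail E g \<and> edge_index e = edge_index g")
    case True
    then have "e = g" using edge_index_inj[OF assms] by simp
    then show ?thesis using d by (simp add: b op_defs)
  next
    case False
    then have "e \<noteq> g" by auto
    moreover have "ghost_op e (edge_op g f) b = 0"
    proof (cases "tail E e = tail E g")
      case True
      then have "edge_index e \<noteq> edge_index g" using False by simp
      then show ?thesis using d True by (simp add: b op_defs)
    qed (simp add: b op_defs)
    ultimately show ?thesis by simp
  qed
qed

lemma edge_ghost_op:
  assumes "e \<in> arcs E"
  shows "edge_op e (ghost_op e f) (u, k, i) =
    (if u = tail E e \<and> k mod out_deg (tail E e) = edge_index e then f (u, k, i) else 0)"
proof -
  let ?d = "out_deg (tail E e)"
  have "(k div ?d) * ?d + edge_index e = k" if "k mod ?d = edge_index e"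
    using that by (metis div_mult_mod_eq)
  then show ?thesis by (auto simp: op_defs)
qed

text \<open>
  At a given point exactly one edge, the one whose index is the residue of \<open>k\<close>, contributes.
\<close>

lemma edge_ghost_op_sum:
  assumes v: "v \<in> regular_vertices E"
  shows "(\<Sum>e\<in>out_arcs E v. edge_op e (ghost_op e f) b) = vertex_op v f b"
proof -
  obtain u k i where b: "b = (u, k, i)" by (cases b) auto
  have vE: "v \<in> verts E" using v by (rule regular_in_verts)
  have fin: "finite (out_arcs E v)" by (rule finite_out_arcs[OF vE])
  have "out_deg v > 0" using v fin by (auto simp: out_deg_def regular_vertices_def card_gt_0_iff)
  then have "k mod out_deg v \<in> edge_index ` out_arcs E v"
    using edge_index_bij[OF vE] by (simp add: bij_betw_def)
  then obtain e where e: "e \<in> out_arcs E v" "edge_index e = k mod out_deg v" by auto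
  have "edge_op g (ghost_op g f) b = (if g = e then vertex_op v f b else 0)"
    if g: "g \<in> out_arcs E v" for g
  proof -
    have ga: "g \<in> arcs E" "tail E g = v" "e \<in> arcs E" "tail E e = v" using g e by auto
    have "k mod out_deg v = edge_index g \<longleftrightarrow> g = e"
      using edge_index_inj[OF ga(1,3)] ga e(2) by auto
    then show ?thesis using ga by (simp add: b edge_ghost_op[OF ga(1)] vertex_op_def)
  qed
  then have "(\<Sum>g\<in>out_arcs E v. edge_op g (ghost_op g f) b) =
      (\<Sum>g\<in>out_arcs E v. if g = e then vertex_op v f b else 0)" by (rule sum.cong[OF HOL.refl])
  then show ?thesis using fin e by simp
qed

definition in_level :: "int \<Rightarrow> ('v \<times> nat \<times> int \<Rightarrow> 'k::comm_ring_1) \<Rightarrow> bool" where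
  "in_level j f \<longleftrightarrow> (\<forall>u k i. i \<noteq> j \<longrightarrow> f (u, k, i) = 0)"

lemma in_level_op:
  assumes "in_level j f"
  shows "in_level j (vertex_op v f)" "in_level (j + 1) (edge_op e f)" "in_level (j - 1) (ghost_op e f)"
  using assms by (auto simp: in_level_def op_defs)

end

section \<open>Leavitt path algebras\<close>

lemma generated_ideal_sub: "R \<subseteq> free_algebra X \<Longrightarrow> x \<in> generated_ideal X R \<Longrightarrow> x \<in> free_algebra X"
  by (rotate_tac, induction rule: generated_ideal.induct) auto

lemma ring_quotient_presented:
  assumes "R \<subseteq> free_algebra X"
  shows "ring_quotient (free_algebra X) (generated_ideal X R :: ('g free_word \<Rightarrow>\<^sub>0 'k::field) set) scale"
  by unfold_locales
    (use generated_ideal_sub[OF assms] in \<open>auto intro: generated_ideal.intros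
      simp: scale_diff_right scale_minus_one_eq scale_mult_left_eq scale_mult_right_eq\<close>)

context row_finite_graph
begin

lemma leavitt_relators_in: "leavitt_relators E \<subseteq> free_algebra (leavitt_gens E)"
proof -
  have g: "gen (Vertex v) \<in> free_algebra (leavitt_gens E)" if "v \<in> verts E" for v
    using that by (simp add: leavitt_gens_def)
  have e: "gen (Edge e) \<in> free_algebra (leavitt_gens E)" "gen (Ghost e) \<in> free_algebra (leavitt_gens E)"
    if "e \<in> arcs E" for e
    using that by (simp_all add: leavitt_gens_def)
  show ?thesis
    unfolding leavitt_relators_def
    using g e regular_in_verts by (auto intro!: free_algebra_diff free_algebra_mult free_algebra_sum)
qed

abbreviation leavitt_ideal :: "(('v, 'e) leavitt_gen free_word \<Rightarrow>\<^sub>0 'k::field) set" where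
  "leavitt_ideal \<equiv> generated_ideal (leavitt_gens E) (leavitt_relators E)"

lemma leavitt_ideal_rel: "x - y \<in> leavitt_relators E \<Longrightarrow> ring_quotient.eqK leavitt_ideal x y"
  unfolding ring_quotient.eqK_def[OF ring_quotient_presented[OF leavitt_relators_in]]
  by (rule generated_ideal.rel)

lemma leavitt_relatorsI:
  "v \<in> verts E \<Longrightarrow> w \<in> verts E \<Longrightarrow>
    gen (Vertex v) * gen (Vertex w) - (if v = w then gen (Vertex v) else 0) \<in> leavitt_relators E"
  "e \<in> arcs E \<Longrightarrow> gen (Vertex (tail E e)) * gen (Edge e) - gen (Edge e) \<in> leavitt_relators E"
  "e \<in> arcs E \<Longrightarrow> gen (Edge e) * gen (Vertex (head E e)) - gen (Edge e) \<in> leavitt_relators E"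
  "e \<in> arcs E \<Longrightarrow> gen (Vertex (head E e)) * gen (Ghost e) - gen (Ghost e) \<in> leavitt_relators E"
  "e \<in> arcs E \<Longrightarrow> gen (Ghost e) * gen (Vertex (tail E e)) - gen (Ghost e) \<in> leavitt_relators E"
  "e \<in> arcs E \<Longrightarrow> f \<in> arcs E \<Longrightarrow>
    gen (Ghost e) * gen (Edge f) - (if e = f then gen (Vertex (head E e)) else 0) \<in> leavitt_relators E"
  "v \<in> regular_vertices E \<Longrightarrow>
    gen (Vertex v) - (\<Sum>e\<in>out_arcs E v. gen (Edge e) * gen (Ghost e)) \<in> leavitt_relators E"
  unfolding leavitt_relators_def by (blast intro: UnI1 UnI2)+

lemma leavitt_ck_relations:
  "ck_relations (free_algebra (leavitt_gens E)) (leavitt_ideal :: (_ \<Rightarrow>\<^sub>0 'k::field) set) scale E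
     (\<lambda>v. gen (Vertex v)) (\<lambda>e. gen (Edge e)) (\<lambda>e. gen (Ghost e))"
proof (intro ck_relations.intro ck_relations_axioms.intro ring_quotient_presented leavitt_relators_in)
  show "row_finite_graph E" by unfold_locales
qed (rule leavitt_ideal_rel, rule leavitt_relatorsI, assumption+ | simp add: leavitt_gens_def)+

lemma leavitt_ck_generators:
  "ck_generators (leavitt_gens E) (leavitt_ideal :: (_ \<Rightarrow>\<^sub>0 'k::field) set) E
     (\<lambda>v. gen (Vertex v)) (\<lambda>e. gen (Edge e)) (\<lambda>e. gen (Ghost e))"
proof (intro ck_generators.intro leavitt_ck_relations ck_generators_axioms.intro)
  interpret R: ck_relations "free_algebra (leavitt_gens E)" "leavitt_ideal :: (_ \<Rightarrow>\<^sub>0 'k) set" scale E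
     "\<lambda>v. gen (Vertex v)" "\<lambda>e. gen (Edge e)" "\<lambda>e. gen (Ghost e)"
    by (rule leavitt_ck_relations)
  fix g assume "g \<in> leavitt_gens E"
  then have "(\<exists>v\<in>verts E. g = Vertex v) \<or> (\<exists>e\<in>arcs E. g = Edge e) \<or> (\<exists>e\<in>arcs E. g = Ghost e)"
    by (auto simp: leavitt_gens_def)
  then show "(\<exists>v\<in>verts E. R.eqK (gen g) (gen (Vertex v))) \<or> (\<exists>e\<in>arcs E. R.eqK (gen g) (gen (Edge e))) \<or>
      (\<exists>e\<in>arcs E. R.eqK (gen g) (gen (Ghost e)))"
    using R.eqK_refl by metis
qed

fun leavitt_op :: "('v, 'e) leavitt_gen \<Rightarrow> ('v \<times> nat \<times> int \<Rightarrow> 'k::comm_ring_1) \<Rightarrow> 'v \<times> nat \<times> int \<Rightarrow> 'k" where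
  "leavitt_op (Vertex v) = vertex_op v"
| "leavitt_op (Edge e) = edge_op e"
| "leavitt_op (Ghost e) = ghost_op e"

sublocale leavitt: word_action "leavitt_op :: _ \<Rightarrow> (_ \<Rightarrow> 'k::field) \<Rightarrow> _"
  by unfold_locales (case_tac g; simp add: op_add op_scale)+

lemma leavitt_act_fun [simp]:
  "leavitt.act (gen g) f = leavitt_op g f" "leavitt.act (x * y) f = leavitt.act x (leavitt.act y f)"
  by (auto simp: leavitt.act_gen leavitt.act_mult)

lemma leavitt_act_ideal:
  fixes x :: "('v, 'e) leavitt_gen free_word \<Rightarrow>\<^sub>0 'k::field"
  shows "x \<in> leavitt_ideal \<Longrightarrow> leavitt.act x f b = 0"
proof (rule leavitt.act_generated_ideal)
  fix r :: "('v, 'e) leavitt_gen free_word \<Rightarrow>\<^sub>0 'k" and f b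
  assume "r \<in> leavitt_relators E"
  then show "leavitt.act r f b = 0"
    unfolding leavitt_relators_def
    by (auto simp: leavitt.act_diff leavitt.act_sum vertex_vertex_op vertex_edge_op edge_vertex_op
        vertex_ghost_op ghost_vertex_op ghost_edge_op edge_ghost_op_sum)
qed

text \<open>
  Applied to the point mass at level \<open>0\<close> over \<open>w\<close>, a vertex acts as the identity, whereas a closed walk of
  nonzero length moves the mass to another level.
\<close>

lemma leavitt_graded_ck_words:
  "graded_ck_words (leavitt_gens E) (leavitt_ideal :: (_ \<Rightarrow>\<^sub>0 'k::field) set) E
     (\<lambda>v. gen (Vertex v)) (\<lambda>e. gen (Edge e)) (\<lambda>e. gen (Ghost e))"
proof -
  define \<delta> :: "'v \<Rightarrow> 'v \<times> nat \<times> int \<Rightarrow> 'k" where "\<delta> w b = (if b = (w, 0, 0) then 1 else 0)" for w b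
  have vertex1: "leavitt.act (gen (Vertex w)) (\<delta> w) (w, 0, 0) = 1" for w
    by (simp add: vertex_op_def \<delta>_def)
  have "gen (Vertex v) \<notin> (leavitt_ideal :: (_ \<Rightarrow>\<^sub>0 'k) set)" if "v \<in> verts E" for v
    using vertex1[of v] leavitt_act_ideal[of "gen (Vertex v)" "\<delta> v" "(v, 0, 0)"] by force
  then have words: "ck_words (leavitt_gens E) (leavitt_ideal :: (_ \<Rightarrow>\<^sub>0 'k) set) E
     (\<lambda>v. gen (Vertex v)) (\<lambda>e. gen (Edge e)) (\<lambda>e. gen (Ghost e))"
    by (intro ck_words.intro leavitt_ck_generators ck_family.intro leavitt_ck_relations
        ck_family_axioms.intro)
      (use ck_generators.nondegenerate_free[OF leavitt_ck_generators] in blast)+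
  interpret W: ck_words "leavitt_gens E" "leavitt_ideal :: (_ \<Rightarrow>\<^sub>0 'k) set" E
     "\<lambda>v. gen (Vertex v)" "\<lambda>e. gen (Edge e)" "\<lambda>e. gen (Ghost e)"
    by (rule words)
  have ls: "in_level (j + int (length \<alpha>)) (leavitt.act (W.walk_s \<alpha> u) f)" if "in_level j f" for j \<alpha> u and f :: "_ \<Rightarrow> 'k"
  proof (induction \<alpha>)
    case (Cons e \<alpha>)
    from in_level_op(2)[OF this, of e] show ?case by (simp add: add_ac)
  qed (simp add: in_level_op that)
  have lt: "in_level (j - int (length \<alpha>)) (leavitt.act (W.walk_t \<alpha> u) f)" if "in_level j f" for j \<alpha> u and f :: "_ \<Rightarrow> 'k"
    using that
  proof (induction \<alpha> arbitrary: j f)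
    case (Cons e \<alpha>)
    from Cons.IH[OF in_level_op(3)[OF Cons.prems, of e]] show ?case by (simp add: algebra_simps)
  qed (simp add: in_level_op)
  have zero: "leavitt.act x (\<delta> w) (w, 0, 0) = 0"
    if "x \<in> W.kspan {W.loop w i | i. awalk w (snd i) w \<and> snd i \<noteq> []}" for x w
    using that
  proof (induction rule: W.kspan.induct)
    case (base x)
    then obtain b \<mu> where x: "x = W.loop w (b, \<mu>)" "\<mu> \<noteq> []" by auto
    have "in_level 0 (\<delta> w)" by (simp add: in_level_def \<delta>_def)
    from ls[OF this, of \<mu> w] lt[OF this, of \<mu> w] show ?case
      using x(2) by (cases b) (auto simp: x(1) W.loop_def in_level_def)
  qed (simp_all add: leavitt_act_ideal leavitt.act_add leavitt.act_scale)
  show ?thesis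
  proof (intro graded_ck_words.intro words graded_ck_words_axioms.intro)
    fix w assume "w \<in> verts E"
    show "gen (Vertex w) \<notin> W.kspan {W.loop w i | i. awalk w (snd i) w \<and> snd i \<noteq> []}"
      using zero[of "gen (Vertex w)" w] vertex1[of w] by auto
  qed
qed

theorem leavitt_decomposable_iff:
  "decomposable_algebra (leavitt_path_algebra E :: ('k::field, _) nu_algebra) \<longleftrightarrow> graph_splits E"
proof -
  interpret G: graded_ck_words "leavitt_gens E" "leavitt_ideal :: (_ \<Rightarrow>\<^sub>0 'k) set" E
     "\<lambda>v. gen (Vertex v)" "\<lambda>e. gen (Edge e)" "\<lambda>e. gen (Ghost e)"
    by (rule leavitt_graded_ck_words)
  have "G.quotient_cong = ideal_cong (leavitt_gens E) (leavitt_relators E)"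
    by (simp add: G.quotient_cong_def ideal_cong_def)
  then interpret A: quotient_algebra "free_algebra (leavitt_gens E)" "leavitt_ideal :: (_ \<Rightarrow>\<^sub>0 'k) set" scale
      "leavitt_path_algebra E :: ('k, _) nu_algebra"
    by unfold_locales (simp_all add: leavitt_path_algebra_def presented_algebra_def)
  show ?thesis unfolding A.decomposable_iff_splitting by (rule G.splitting_iff_graph_splits)
qed

end

section \<open>The involution\<close>

lemma letter_star_star [simp]: "letter_star (letter_star l) = l"
  by (cases l) auto

lemma word_star_star [simp]: "word_star (word_star w) = w"
  by (cases w) (simp add: word_star_def rev_map o_def)

lemma inj_word_star: "inj word_star"
  by (metis injI word_star_star)

lemma word_star_plus: "word_star (u + v) = word_star v + word_star u"
  by (simp add: word_star_def plus_free_word_def)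

lemma lookup_star: "Poly_Mapping.lookup (star x) w = cnj (Poly_Mapping.lookup x (word_star w))"
  by (simp add: star_def map.rep_eq map_key.rep_eq[OF inj_word_star] when_def)

lemma star_zero [simp]: "star 0 = 0"
  by (rule poly_mapping_eqI) (simp add: lookup_star)

lemma star_add: "star (x + y) = star x + star y"
  by (rule poly_mapping_eqI) (simp add: lookup_star lookup_add)

lemma star_diff: "star (x - y) = star x - star y"
  by (rule poly_mapping_eqI) (simp add: lookup_star lookup_minus)

lemma star_sum: "star (sum f A) = (\<Sum>i\<in>A. star (f i))"
  by (induction A rule: infinite_finite_induct) (simp_all add: star_add)

lemma star_star [simp]: "star (star x) = x"
  by (rule poly_mapping_eqI) (simp add: lookup_star)

lemma star_single: "star (Poly_Mapping.single w c) = Poly_Mapping.single (word_star w) (cnj c)"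
proof (rule poly_mapping_eqI)
  fix u
  have "w = word_star u \<longleftrightarrow> word_star w = u" by auto
  then show "Poly_Mapping.lookup (star (Poly_Mapping.single w c)) u =
      Poly_Mapping.lookup (Poly_Mapping.single (word_star w) (cnj c)) u"
    by (simp add: lookup_star lookup_single when_def)
qed

lemma star_mult: "star (x * y) = star y * star x"
proof (induction x rule: poly_induct)
  case (single w c)
  show ?case
    by (induction y rule: poly_induct)
      (simp_all add: star_single mult_single word_star_plus star_add distrib_left distrib_right mult.commute)
qed (simp_all add: star_add distrib_left distrib_right)

lemma star_scale: "star (scale c x) = scale (cnj c) (star x)"
  by (induction x rule: poly_induct) (simp_all add: star_single star_add scale_add_right)

lemma star_gen: "star (gen l) = gen (letter_star l)"
  by (simp add: gen_def star_single word_star_def)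

lemma star_closed [simp]: "x \<in> free_star_algebra X \<Longrightarrow> star x \<in> free_star_algebra X"
  unfolding free_star_algebra_def
proof (induction rule: free_algebra_induct)
  case (gen g)
  then show ?case by (auto simp: star_gen)
next
  case (mult g x)
  have "letter_star g \<in> Plain ` X \<union> Starred ` X" using mult.hyps(1) by auto
  then show ?case using mult by (simp add: star_mult star_gen)
qed (simp_all add: star_add star_scale)

section \<open>C*-seminorms\<close>

locale cstar_norm =
  fixes X :: "'x set" and R :: "'x star_poly set" and N :: "'x star_poly \<Rightarrow> real"
  assumes N: "cstar_seminorm X R N"
begin

abbreviation F where "F \<equiv> free_star_algebra X"

lemma F_closed [simp]:
  "0 \<in> F" "x \<in> F \<Longrightarrow> y \<in> F \<Longrightarrow> x + y \<in> F" "x \<in> F \<Longrightarrow> y \<in> F \<Longrightarrow> x * y \<in> F" "x \<in> F \<Longrightarrow> scale c x \<in> F"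
  "x \<in> F \<Longrightarrow> - x \<in> F" "x \<in> F \<Longrightarrow> y \<in> F \<Longrightarrow> x - y \<in> F"
  by (simp_all add: free_star_algebra_def)

lemma F_sum: "(\<And>i. i \<in> A \<Longrightarrow> f i \<in> F) \<Longrightarrow> sum f A \<in> F"
  by (simp add: free_star_algebra_def)

lemma N_add: "x \<in> F \<Longrightarrow> y \<in> F \<Longrightarrow> N (x + y) \<le> N x + N y"
  and N_mult: "x \<in> F \<Longrightarrow> y \<in> F \<Longrightarrow> N (x * y) \<le> N x * N y"
  and N_scale: "x \<in> F \<Longrightarrow> N (scale c x) = cmod c * N x"
  and N_cstar: "x \<in> F \<Longrightarrow> N (star x * x) = (N x)\<^sup>2"
  and N_rel: "x \<in> R \<Longrightarrow> N x = 0"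
  using N by (simp_all add: cstar_seminorm_def)

lemma N_zero [simp]: "N 0 = 0"
  using N_scale[of 0 0] by simp

lemma N_uminus [simp]: "x \<in> F \<Longrightarrow> N (- x) = N x"
  using N_scale[of x "- 1"] by (simp add: scale_minus_one_eq)

lemma N_nonneg [simp]: "x \<in> F \<Longrightarrow> 0 \<le> N x"
  using N_add[of x "- x"] by simp

lemma N_diff: "x \<in> F \<Longrightarrow> y \<in> F \<Longrightarrow> N (x - y) \<le> N x + N y"
  using N_add[of x "- y"] by simp

lemma N_minus_commute: "x \<in> F \<Longrightarrow> y \<in> F \<Longrightarrow> N (x - y) = N (y - x)"
  using N_uminus[of "x - y"] by simp

lemma N_abs_diff: "x \<in> F \<Longrightarrow> y \<in> F \<Longrightarrow> \<bar>N x - N y\<bar> \<le> N (x - y)"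
  using N_add[of "x - y" y] N_add[of "y - x" x] N_minus_commute[of x y] by (simp add: abs_le_iff)

lemma N_sum: "(\<And>i. i \<in> A \<Longrightarrow> f i \<in> F) \<Longrightarrow> N (sum f A) \<le> (\<Sum>i\<in>A. N (f i))"
proof (induction A rule: infinite_finite_induct)
  case (insert i A)
  then have "N (f i + sum f A) \<le> N (f i) + N (sum f A)" by (intro N_add F_sum) auto
  also have "N (sum f A) \<le> (\<Sum>i\<in>A. N (f i))" using insert by simp
  finally show ?case using insert by simp
qed simp_all

text \<open>
  From \<open>\<parallel>x\<parallel>\<^sup>2 = \<parallel>x\<^sup>*x\<parallel> \<le> \<parallel>x\<^sup>*\<parallel> \<parallel>x\<parallel>\<close>.
\<close>

lemma N_star_le: "x \<in> F \<Longrightarrow> N x \<le> N (star x)"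
proof -
  assume x: "x \<in> F"
  have "(N x)\<^sup>2 \<le> N (star x) * N x" using N_cstar[OF x] N_mult[of "star x" x] x by simp
  then show ?thesis
    using N_nonneg[OF x] N_nonneg[OF star_closed[OF x]]
    by (cases "N x = 0") (auto simp: power2_eq_square)
qed

lemma N_star [simp]: "x \<in> F \<Longrightarrow> N (star x) = N x"
  using N_star_le[of x] N_star_le[of "star x"] by simp

definition null :: "'x star_poly set" where
  "null = {x \<in> F. N x = 0}"

lemma N_eq: "x \<in> F \<Longrightarrow> y \<in> F \<Longrightarrow> x - y \<in> null \<Longrightarrow> N x = N y"
  using N_abs_diff[of x y] by (simp add: null_def)

lemma null_star: "x \<in> null \<Longrightarrow> star x \<in> null"
  by (simp add: null_def)

lemma ring_quotient_null: "ring_quotient F null scale"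
proof unfold_locales
  fix x y :: "'x star_poly" and c
  show "x + y \<in> null" if "x \<in> null" "y \<in> null"
    using that N_add[of x y] N_nonneg[of "x + y"] by (auto simp: null_def simp del: N_nonneg)
  show "scale c x \<in> null" if "x \<in> null" using that N_scale[of x c] by (simp add: null_def)
  show "x * y \<in> null" if "x \<in> F" "y \<in> null"
    using that N_mult[of x y] N_nonneg[of "x * y"] by (auto simp: null_def simp del: N_nonneg)
  show "y * x \<in> null" if "x \<in> F" "y \<in> null"
    using that N_mult[of y x] N_nonneg[of "y * x"] by (auto simp: null_def simp del: N_nonneg)
qed (auto simp: null_def scale_diff_right scale_minus_one_eq scale_mult_left_eq scale_mult_right_eq)

text \<open>
  Modulo \<open>null\<close> the C*-identity reads \<open>\<parallel>p\<parallel>\<^sup>2 = \<parallel>p\<parallel>\<close> for a projection.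
\<close>

lemma N_idempotent_le_one:
  assumes p: "p \<in> F" "star p - p \<in> null" "p * p - p \<in> null"
  shows "N p \<le> 1"
proof -
  interpret ring_quotient F null scale by (rule ring_quotient_null)
  have "star p * p - p * p = (star p - p) * p" by (simp add: algebra_simps)
  then have "star p * p - p * p \<in> null" using K_right[OF p(1,2)] by simp
  then have "(star p * p - p * p) + (p * p - p) \<in> null" using p(3) by (rule K_add)
  then have "(N p)\<^sup>2 = N p" using N_eq[of "star p * p" p] p N_cstar by simp
  then show ?thesis by (auto simp: power2_eq_square)
qed

end

lemma cstar_seminorm_zero: "R \<subseteq> free_star_algebra X \<Longrightarrow> cstar_seminorm X R (\<lambda>_. 0)"
  by (simp add: cstar_seminorm_def)

text \<open>
  A bound on the generators, uniform over all C*-seminorms, makes the supremum in the universal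
  seminorm finite.
\<close>

locale universal_cstar =
  fixes X :: "'x set" and R :: "'x star_poly set"
  assumes generators_bounded: "cstar_seminorm X R \<rho> \<Longrightarrow> x \<in> X \<Longrightarrow> \<rho> (gen (Plain x)) \<le> 1"
begin

abbreviation U where "U \<equiv> universal_seminorm X R"

lemma bounded:
  assumes "x \<in> free_star_algebra X"
  shows "\<exists>B. \<forall>\<rho>. cstar_seminorm X R \<rho> \<longrightarrow> \<rho> x \<le> B"
  using assms unfolding free_star_algebra_def
proof (induction rule: free_algebra_induct)
  case zero
  have "\<rho> 0 \<le> 0" if "cstar_seminorm X R \<rho>" for \<rho>
    using cstar_norm.N_zero[OF cstar_norm.intro[OF that]] by simp
  then show ?case by blast
next
  case (add x y)
  obtain B where B: "\<forall>\<rho>. cstar_seminorm X R \<rho> \<longrightarrow> \<rho> x \<le> B" using add.IH by blast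
  obtain C where C: "\<forall>\<rho>. cstar_seminorm X R \<rho> \<longrightarrow> \<rho> y \<le> C" using add.IH by blast
  have "\<rho> (x + y) \<le> B + C" if \<rho>: "cstar_seminorm X R \<rho>" for \<rho>
    using cstar_norm.N_add[OF cstar_norm.intro[OF \<rho>], of x y] add.hyps B C \<rho>
    by (fastforce simp: free_star_algebra_def)
  then show ?case by blast
next
  case (scale c x)
  obtain B where B: "\<forall>\<rho>. cstar_seminorm X R \<rho> \<longrightarrow> \<rho> x \<le> B" using scale.IH by blast
  have "\<rho> (scale c x) \<le> cmod c * B" if \<rho>: "cstar_seminorm X R \<rho>" for \<rho>
    using cstar_norm.N_scale[OF cstar_norm.intro[OF \<rho>], of x c] scale.hyps B \<rho>
    by (simp add: free_star_algebra_def mult_left_mono)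
  then show ?case by blast
next
  case (gen g)
  have "\<rho> (gen g) \<le> 1" if \<rho>: "cstar_seminorm X R \<rho>" for \<rho>
  proof -
    interpret cstar_norm X R \<rho> by (rule cstar_norm.intro[OF \<rho>])
    show ?thesis
    proof (cases g)
      case (Plain x)
      then show ?thesis using gen generators_bounded[OF \<rho>] by auto
    next
      case (Starred x)
      then have x: "x \<in> X" using gen by auto
      then have "gen (Plain x) \<in> free_star_algebra X" by (simp add: free_star_algebra_def)
      from N_star[OF this] show ?thesis using generators_bounded[OF \<rho> x] Starred by (simp add: star_gen)
    qed
  qed
  then show ?case by blast
next
  case (mult g x)
  obtain B where B: "\<forall>\<rho>. cstar_seminorm X R \<rho> \<longrightarrow> \<rho> x \<le> B" using mult.IH by blast
  have "\<rho> (x * gen g) \<le> \<bar>B\<bar>" if \<rho>: "cstar_seminorm X R \<rho>" for \<rho>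
  proof -
    interpret cstar_norm X R \<rho> by (rule cstar_norm.intro[OF \<rho>])
    have g: "gen g \<in> free_star_algebra X" "x \<in> free_star_algebra X"
      using mult.hyps by (simp_all add: free_star_algebra_def)
    have "\<rho> (gen g) \<le> 1"
    proof (cases g)
      case (Plain x)
      then show ?thesis using mult.hyps(1) generators_bounded[OF \<rho>] by auto
    next
      case (Starred x)
      then have x: "x \<in> X" using mult.hyps(1) by auto
      then have "gen (Plain x) \<in> free_star_algebra X" by (simp add: free_star_algebra_def)
      from N_star[OF this] show ?thesis using generators_bounded[OF \<rho> x] Starred by (simp add: star_gen)
    qed
    then have "\<rho> x * \<rho> (gen g) \<le> \<rho> x" using N_nonneg[OF g(2)] by (simp add: mult_left_le)
    then show ?thesis using N_mult[OF g(2,1)] B \<rho> by fastforce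
  qed
  then show ?case by blast
qed

lemma le_universal: "cstar_seminorm X R \<rho> \<Longrightarrow> x \<in> free_star_algebra X \<Longrightarrow> \<rho> x \<le> U x"
proof -
  assume \<rho>: "cstar_seminorm X R \<rho>" and x: "x \<in> free_star_algebra X"
  obtain B where "\<forall>\<rho>. cstar_seminorm X R \<rho> \<longrightarrow> \<rho> x \<le> B" using bounded[OF x] by blast
  then have "bdd_above {\<rho> x | \<rho>. cstar_seminorm X R \<rho>}" by (auto intro!: bdd_aboveI[of _ B])
  then show ?thesis unfolding universal_seminorm_def using \<rho> by (intro cSup_upper) auto
qed

lemma universal_least:
  assumes "\<And>\<rho>. cstar_seminorm X R \<rho> \<Longrightarrow> \<rho> x \<le> B" and R: "R \<subseteq> free_star_algebra X"
  shows "U x \<le> B"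
  unfolding universal_seminorm_def using assms(1) cstar_seminorm_zero[OF R]
  by (intro cSup_least) auto

lemma cstar_seminorm_universal:
  assumes R: "R \<subseteq> free_star_algebra X"
  shows "cstar_seminorm X R U"
proof -
  let ?F = "free_star_algebra X"
  have Fc: "x + y \<in> ?F" "x * y \<in> ?F" "scale c x \<in> ?F" if "x \<in> ?F" "y \<in> ?F" for x y c
    using that by (simp_all add: free_star_algebra_def)
  have pos: "0 \<le> U x" if "x \<in> ?F" for x using le_universal[OF cstar_seminorm_zero[OF R] that] by simp
  have add: "U (x + y) \<le> U x + U y" if "x \<in> ?F" "y \<in> ?F" for x y
  proof (rule universal_least[OF _ R])
    fix \<rho> assume \<rho>: "cstar_seminorm X R \<rho>"
    show "\<rho> (x + y) \<le> U x + U y"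
      using cstar_norm.N_add[OF cstar_norm.intro[OF \<rho>] that] le_universal[OF \<rho> that(1)]
        le_universal[OF \<rho> that(2)] by linarith
  qed
  have mult: "U (x * y) \<le> U x * U y" if "x \<in> ?F" "y \<in> ?F" for x y
  proof (rule universal_least[OF _ R])
    fix \<rho> assume \<rho>: "cstar_seminorm X R \<rho>"
    interpret cstar_norm X R \<rho> by (rule cstar_norm.intro[OF \<rho>])
    have "\<rho> x * \<rho> y \<le> U x * U y"
      using that le_universal[OF \<rho>] pos by (intro mult_mono) auto
    then show "\<rho> (x * y) \<le> U x * U y" using N_mult[OF that] by simp
  qed
  have scale_le: "U (scale c x) \<le> cmod c * U x" if "x \<in> ?F" for c x
  proof (rule universal_least[OF _ R])
    fix \<rho> assume \<rho>: "cstar_seminorm X R \<rho>"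
    show "\<rho> (scale c x) \<le> cmod c * U x"
      using cstar_norm.N_scale[OF cstar_norm.intro[OF \<rho>] that, of c] le_universal[OF \<rho> that]
      by (simp add: mult_left_mono)
  qed
  have scale: "U (scale c x) = cmod c * U x" if x: "x \<in> ?F" for c x
  proof (cases "c = 0")
    case True
    have "U (scale 0 x) \<le> 0" using scale_le[OF x, of 0] by simp
    then show ?thesis using True pos[OF Fc(3)[OF x x, of 0]] by simp
  next
    case False
    have "U x = U (scale (inverse c) (scale c x))" using False by (simp add: scale_scale)
    also have "\<dots> \<le> cmod (inverse c) * U (scale c x)" by (rule scale_le[OF Fc(3)[OF x x]])
    finally have "cmod c * U x \<le> cmod c * (cmod (inverse c) * U (scale c x))" by (rule mult_left_mono) simp
    also have "\<dots> = U (scale c x)" using False by (simp add: norm_inverse)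
    finally have "cmod c * U x \<le> U (scale c x)" .
    then show ?thesis using scale_le[OF x, of c] by simp
  qed
  have cstar: "U (star x * x) = (U x)\<^sup>2" if x: "x \<in> ?F" for x
  proof (rule antisym)
    show "U (star x * x) \<le> (U x)\<^sup>2"
    proof (rule universal_least[OF _ R])
      fix \<rho> assume \<rho>: "cstar_seminorm X R \<rho>"
      interpret cstar_norm X R \<rho> by (rule cstar_norm.intro[OF \<rho>])
      show "\<rho> (star x * x) \<le> (U x)\<^sup>2"
        using N_cstar[OF x] le_universal[OF \<rho> x] N_nonneg[OF x] by (simp add: power_mono)
    qed
    have sx: "star x * x \<in> ?F" using x by (simp add: Fc)
    have "U x \<le> sqrt (U (star x * x))"
    proof (rule universal_least[OF _ R])
      fix \<rho> assume \<rho>: "cstar_seminorm X R \<rho>"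
      interpret cstar_norm X R \<rho> by (rule cstar_norm.intro[OF \<rho>])
      have "(\<rho> x)\<^sup>2 \<le> U (star x * x)" using N_cstar[OF x] le_universal[OF \<rho> sx] by simp
      then show "\<rho> x \<le> sqrt (U (star x * x))" by (rule real_le_rsqrt)
    qed
    then have "(U x)\<^sup>2 \<le> (sqrt (U (star x * x)))\<^sup>2" using pos[OF x] by (rule power_mono)
    then show "(U x)\<^sup>2 \<le> U (star x * x)" using pos[OF sx] by simp
  qed
  have rel: "U x = 0" if x: "x \<in> R" for x
  proof (rule antisym)
    show "U x \<le> 0"
    proof (rule universal_least[OF _ R])
      fix \<rho> assume "cstar_seminorm X R \<rho>"
      from cstar_norm.N_rel[OF cstar_norm.intro[OF this] x] show "\<rho> x \<le> 0" by simp
    qed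
    show "0 \<le> U x" using pos x R by blast
  qed
  show ?thesis using add mult scale cstar rel by (simp add: cstar_seminorm_def)
qed

end

section \<open>Completions\<close>

text \<open>
  Cauchy sequences and null sequences as an instance of a ring modulo an ideal; sequences are added and
  multiplied pointwise in the ring of all functions on \<open>\<nat>\<close>.
\<close>

locale universal_completion = universal_cstar X R for X :: "'x set" and R :: "'x star_poly set" +
  assumes R_sub: "R \<subseteq> free_star_algebra X"
begin

sublocale cstar_norm X R U
  by unfold_locales (rule cstar_seminorm_universal[OF R_sub])

abbreviation C where "C \<equiv> universal_cauchy X R"

lemma C_iff: "f \<in> C \<longleftrightarrow> (\<forall>n. f n \<in> F) \<and> (\<forall>\<epsilon>>0. \<exists>M. \<forall>m\<ge>M. \<forall>n\<ge>M. U (f m - f n) < \<epsilon>)"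
  by (simp add: universal_cauchy_def)

lemma C_F [simp]: "f \<in> C \<Longrightarrow> f n \<in> F"
  by (simp add: C_iff)

lemma C_const [simp]: "x \<in> F \<Longrightarrow> (\<lambda>n. x) \<in> C"
  by (auto simp: C_iff)

lemma C_convergent: "f \<in> C \<Longrightarrow> convergent (\<lambda>n. U (f n))"
proof -
  assume f: "f \<in> C"
  have "Cauchy (\<lambda>n. U (f n))"
    unfolding Cauchy_def dist_real_def
  proof (intro allI impI)
    fix \<epsilon> :: real assume "\<epsilon> > 0"
    then obtain M where "\<forall>m\<ge>M. \<forall>n\<ge>M. U (f m - f n) < \<epsilon>" using f by (auto simp: C_iff)
    then show "\<exists>M. \<forall>m\<ge>M. \<forall>n\<ge>M. \<bar>U (f m) - U (f n)\<bar> < \<epsilon>"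
      using N_abs_diff f by (meson C_F le_less_trans)
  qed
  then show ?thesis by (simp add: real_Cauchy_convergent)
qed

definition limit_norm :: "(nat \<Rightarrow> 'x star_poly) \<Rightarrow> real" where
  "limit_norm f = lim (\<lambda>n. U (f n))"

lemma limit_norm_LIMSEQ: "f \<in> C \<Longrightarrow> (\<lambda>n. U (f n)) \<longlonglongrightarrow> limit_norm f"
  unfolding limit_norm_def using C_convergent by (simp add: convergent_LIMSEQ_iff)

lemma limit_norm_const [simp]: "limit_norm (\<lambda>n. x) = U x"
  by (simp add: limit_norm_def)

lemma limit_norm_nonneg [simp]: "f \<in> C \<Longrightarrow> 0 \<le> limit_norm f"
  by (rule LIMSEQ_le_const[OF limit_norm_LIMSEQ]) auto

text \<open>
  Used to see that the two parts of a decomposed Cauchy sequence are Cauchy, and that the gauge action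
  preserves Cauchy sequences.
\<close>

lemma C_dominated:
  assumes f: "f \<in> C" and g: "\<And>n. g n \<in> F" and B: "\<And>m n. U (g m - g n) \<le> U (f m - f n)"
  shows "g \<in> C"
proof -
  have "\<exists>M. \<forall>m\<ge>M. \<forall>n\<ge>M. U (g m - g n) < \<epsilon>" if "\<epsilon> > 0" for \<epsilon>
    using f that B by (meson C_iff le_less_trans)
  then show ?thesis using g by (simp add: C_iff)
qed

lemma C_add: "f \<in> C \<Longrightarrow> g \<in> C \<Longrightarrow> f + g \<in> C"
proof -
  assume f: "f \<in> C" and g: "g \<in> C"
  have "\<exists>M. \<forall>m\<ge>M. \<forall>n\<ge>M. U ((f + g) m - (f + g) n) < \<epsilon>" if "\<epsilon> > 0" for \<epsilon>
  proof -
    obtain M where M: "\<forall>m\<ge>M. \<forall>n\<ge>M. U (f m - f n) < \<epsilon> / 2" using f \<open>\<epsilon> > 0\<close> unfolding C_iff by (meson half_gt_zero)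
    obtain M' where M': "\<forall>m\<ge>M'. \<forall>n\<ge>M'. U (g m - g n) < \<epsilon> / 2" using g \<open>\<epsilon> > 0\<close> unfolding C_iff by (meson half_gt_zero)
    have "U ((f + g) m - (f + g) n) < \<epsilon>" if "m \<ge> max M M'" "n \<ge> max M M'" for m n
    proof -
      have eq: "(f + g) m - (f + g) n = (f m - f n) + (g m - g n)" by (simp add: plus_fun_def)
      have "U ((f + g) m - (f + g) n) \<le> U (f m - f n) + U (g m - g n)"
        unfolding eq using f g by (intro N_add) auto
      moreover have "U (f m - f n) < \<epsilon> / 2" "U (g m - g n) < \<epsilon> / 2" using M M' that by auto
      ultimately show ?thesis by simp
    qed
    then show ?thesis by blast
  qed
  then show ?thesis using f g by (simp add: C_iff plus_fun_def)
qed

lemma C_bounded: "f \<in> C \<Longrightarrow> \<exists>B>0. \<forall>n. U (f n) \<le> B"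
proof -
  assume f: "f \<in> C"
  then obtain B where "B > 0" "\<forall>n. norm (U (f n)) \<le> B"
    using convergent_imp_Bseq[OF C_convergent[OF f]] by (auto simp: Bseq_def)
  then show ?thesis by (auto intro!: exI[of _ B] simp: abs_le_iff)
qed

lemma C_mult: "f \<in> C \<Longrightarrow> g \<in> C \<Longrightarrow> f * g \<in> C"
proof -
  assume f: "f \<in> C" and g: "g \<in> C"
  obtain A where A: "A > 0" "\<And>n. U (f n) \<le> A" using C_bounded[OF f] by blast
  obtain B where B: "B > 0" "\<And>n. U (g n) \<le> B" using C_bounded[OF g] by blast
  have "\<exists>M. \<forall>m\<ge>M. \<forall>n\<ge>M. U ((f * g) m - (f * g) n) < \<epsilon>" if \<epsilon>: "\<epsilon> > 0" for \<epsilon>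
  proof -
    have e: "\<epsilon> / (2 * B) > 0" "\<epsilon> / (2 * A) > 0" using A B \<epsilon> by auto
    obtain M where M: "\<forall>m\<ge>M. \<forall>n\<ge>M. U (f m - f n) < \<epsilon> / (2 * B)" using f e unfolding C_iff by meson
    obtain M' where M': "\<forall>m\<ge>M'. \<forall>n\<ge>M'. U (g m - g n) < \<epsilon> / (2 * A)" using g e unfolding C_iff by meson
    have "U ((f * g) m - (f * g) n) < \<epsilon>" if mn: "m \<ge> max M M'" "n \<ge> max M M'" for m n
    proof -
      have "(f * g) m - (f * g) n = (f m - f n) * g m + f n * (g m - g n)"
        by (simp add: times_fun_def algebra_simps)
      then have "U ((f * g) m - (f * g) n) \<le> U ((f m - f n) * g m) + U (f n * (g m - g n))"
        using N_add[of "(f m - f n) * g m" "f n * (g m - g n)"] f g by simp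
      also have "U ((f m - f n) * g m) \<le> U (f m - f n) * U (g m)" using f g by (intro N_mult) auto
      also have "\<dots> \<le> U (f m - f n) * B" using f g B by (intro mult_left_mono) auto
      also have "U (f n * (g m - g n)) \<le> U (f n) * U (g m - g n)" using f g by (intro N_mult) auto
      also have "\<dots> \<le> A * U (g m - g n)" using f g A by (intro mult_right_mono) auto
      finally have "U ((f * g) m - (f * g) n) \<le> U (f m - f n) * B + A * U (g m - g n)" by simp
      moreover have "U (f m - f n) * B < \<epsilon> / 2"
        using M mn B by (auto simp: field_simps)
      moreover have "A * U (g m - g n) < \<epsilon> / 2"
        using M' mn A by (auto simp: field_simps)
      ultimately show ?thesis by linarith
    qed
    then show ?thesis by blast
  qed
  then show ?thesis using f g by (simp add: C_iff times_fun_def)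
qed

definition cscale :: "complex \<Rightarrow> (nat \<Rightarrow> 'x star_poly) \<Rightarrow> nat \<Rightarrow> 'x star_poly" where
  "cscale c f = (\<lambda>n. scale c (f n))"

lemma C_scale: "f \<in> C \<Longrightarrow> cscale c f \<in> C"
proof -
  assume f: "f \<in> C"
  have "\<exists>M. \<forall>m\<ge>M. \<forall>n\<ge>M. U (cscale c f m - cscale c f n) < \<epsilon>" if \<epsilon>: "\<epsilon> > 0" for \<epsilon>
  proof -
    have e: "\<epsilon> / (cmod c + 1) > 0" using \<epsilon> by (simp add: add_nonneg_pos)
    obtain M where M: "\<forall>m\<ge>M. \<forall>n\<ge>M. U (f m - f n) < \<epsilon> / (cmod c + 1)" using f e unfolding C_iff by meson
    have "U (cscale c f m - cscale c f n) < \<epsilon>" if "m \<ge> M" "n \<ge> M" for m n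
    proof -
      have "U (cscale c f m - cscale c f n) = cmod c * U (f m - f n)"
        using f N_scale[of "f m - f n" c] by (simp add: cscale_def scale_diff_right)
      also have "\<dots> \<le> (cmod c + 1) * U (f m - f n)" using f by (intro mult_right_mono) auto
      also have "\<dots> < (cmod c + 1) * (\<epsilon> / (cmod c + 1))"
        using M that by (intro mult_strict_left_mono) (auto simp: add_nonneg_pos)
      also have "\<dots> = \<epsilon>" using add_nonneg_pos[OF norm_ge_zero[of c] zero_less_one] by simp
      finally show ?thesis .
    qed
    then show ?thesis by blast
  qed
  then show ?thesis using f by (simp add: C_iff cscale_def)
qed

lemma cscale_diff: "cscale c (f - g) = cscale c f - cscale c g"
  by (auto simp: cscale_def scale_diff_right)

lemma cscale_mult_left: "cscale c f * g = cscale c (f * g)"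
  and cscale_mult_right: "f * cscale c g = cscale c (f * g)"
  by (auto simp: cscale_def times_fun_def scale_mult_left_eq scale_mult_right_eq)

lemma cscale_minus_one: "cscale (- 1) f = - f"
  by (auto simp: cscale_def scale_minus_one_eq)

lemma C_uminus: "f \<in> C \<Longrightarrow> - f \<in> C"
  using C_scale[of f "- 1"] by (simp add: cscale_minus_one)

lemma C_diff: "f \<in> C \<Longrightarrow> g \<in> C \<Longrightarrow> f - g \<in> C"
  using C_add[of f "- g"] C_uminus[of g] by simp

lemma limit_norm_add: "f \<in> C \<Longrightarrow> g \<in> C \<Longrightarrow> limit_norm (f + g) \<le> limit_norm f + limit_norm g"
  by (rule LIMSEQ_le[OF limit_norm_LIMSEQ[OF C_add] tendsto_add[OF limit_norm_LIMSEQ limit_norm_LIMSEQ]])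
    (auto simp: plus_fun_def N_add)

lemma limit_norm_mult: "f \<in> C \<Longrightarrow> g \<in> C \<Longrightarrow> limit_norm (f * g) \<le> limit_norm f * limit_norm g"
  by (rule LIMSEQ_le[OF limit_norm_LIMSEQ[OF C_mult] tendsto_mult[OF limit_norm_LIMSEQ limit_norm_LIMSEQ]])
    (auto simp: times_fun_def N_mult)

lemma limit_norm_scale: "f \<in> C \<Longrightarrow> limit_norm (cscale c f) = cmod c * limit_norm f"
proof -
  assume f: "f \<in> C"
  have "(\<lambda>n. U (cscale c f n)) \<longlonglongrightarrow> cmod c * limit_norm f"
    using tendsto_mult_left[OF limit_norm_LIMSEQ[OF f], of "cmod c"] f by (simp add: cscale_def N_scale)
  then show ?thesis using LIMSEQ_unique limit_norm_LIMSEQ[OF C_scale[OF f]] by blast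
qed

lemma limit_norm_uminus: "f \<in> C \<Longrightarrow> limit_norm (- f) = limit_norm f"
  using limit_norm_scale[of f "- 1"] by (simp add: cscale_minus_one)

lemma limit_norm_diff: "f \<in> C \<Longrightarrow> g \<in> C \<Longrightarrow> limit_norm (f - g) \<le> limit_norm f + limit_norm g"
  using limit_norm_add[of f "- g"] C_uminus[of g] limit_norm_uminus[of g] by simp

definition cnull :: "(nat \<Rightarrow> 'x star_poly) set" where
  "cnull = {f \<in> C. (\<lambda>n. U (f n)) \<longlonglongrightarrow> 0}"

lemma cnull_iff: "f \<in> cnull \<longleftrightarrow> f \<in> C \<and> limit_norm f = 0"
  using limit_norm_LIMSEQ[of f] LIMSEQ_unique[of "\<lambda>n. U (f n)"] by (auto simp: cnull_def)

lemma C_zero [simp]: "0 \<in> C"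
  using C_const[of 0] by (simp add: zero_fun_def)

lemma limit_norm_zero [simp]: "limit_norm 0 = 0"
  using limit_norm_const[of 0] by (simp add: zero_fun_def)

sublocale completion: ring_quotient C cnull cscale
proof unfold_locales
  fix f g :: "nat \<Rightarrow> 'x star_poly" and c
  show "f + g \<in> cnull" if "f \<in> cnull" "g \<in> cnull"
    using that limit_norm_add[of f g] limit_norm_nonneg[of "f + g"] by (auto simp: cnull_iff C_add simp del: limit_norm_nonneg)
  show "cscale c f \<in> cnull" if "f \<in> cnull" using that by (simp add: cnull_iff limit_norm_scale C_scale)
  show "f * g \<in> cnull" if "f \<in> C" "g \<in> cnull"
    using that limit_norm_mult[of f g] limit_norm_nonneg[of "f * g"] by (auto simp: cnull_iff C_mult simp del: limit_norm_nonneg)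
  show "g * f \<in> cnull" if "f \<in> C" "g \<in> cnull"
    using that limit_norm_mult[of g f] limit_norm_nonneg[of "g * f"] by (auto simp: cnull_iff C_mult simp del: limit_norm_nonneg)
qed (auto simp: cnull_iff C_add C_mult C_scale cscale_minus_one cscale_diff cscale_mult_left cscale_mult_right)

lemma limit_norm_eqK: "completion.eqK f g \<Longrightarrow> f \<in> C \<Longrightarrow> g \<in> C \<Longrightarrow> limit_norm f = limit_norm g"
proof -
  assume fg: "completion.eqK f g" and f: "f \<in> C" and g: "g \<in> C"
  have "limit_norm (f - g) = 0" using fg by (simp add: completion.eqK_def cnull_iff)
  then show ?thesis
    using limit_norm_add[of "f - g" g] limit_norm_diff[of f "f - g"] C_diff[OF f g] f g by simp
qed

sublocale completion_algebra: quotient_algebra C cnull cscale "universal_cstar_algebra X R"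
proof -
  have "completion.quotient_cong = universal_cong X R"
    unfolding completion.quotient_cong_def universal_cong_def by (auto simp: cnull_def C_diff)
  moreover have "(\<lambda>(f :: nat \<Rightarrow> 'x star_poly) g n. f n + g n) = (+)"
    "(\<lambda>(f :: nat \<Rightarrow> 'x star_poly) g n. f n * g n) = (*)"
    "(\<lambda>f n. scale c (f n)) = cscale c" for c
    by (auto simp: fun_eq_iff plus_fun_def times_fun_def cscale_def)
  ultimately show "quotient_algebra C cnull cscale (universal_cstar_algebra X R)"
    by unfold_locales
      (simp_all add: universal_cstar_algebra_def zero_fun_def)
qed

lemma alg_norm_cl:
  assumes f: "f \<in> C"
  shows "alg_norm (universal_cstar_algebra X R) (completion.quotient_cong `` {f}) = limit_norm f"
proof -
  let ?A = "completion.quotient_cong `` {f}"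
  have "f \<in> ?A" using f by (simp add: completion.quotient_cong_def)
  then have "(SOME g. g \<in> ?A) \<in> ?A" by (rule someI[of "\<lambda>g. g \<in> ?A"])
  then have "completion.eqK f (SOME g. g \<in> ?A)" "(SOME g. g \<in> ?A) \<in> C"
    by (auto simp: completion.quotient_cong_def completion.eqK_def)
  then have "limit_norm f = limit_norm (SOME g. g \<in> ?A)" using limit_norm_eqK f by blast
  then show ?thesis by (simp add: universal_cstar_algebra_def limit_norm_def)
qed

lemma closed_ideal_image:
  assumes I: "completion.full_ideal I"
    and cl: "\<And>f x. (\<And>n. f n \<in> I) \<Longrightarrow> x \<in> C \<Longrightarrow> (\<lambda>n. limit_norm (f n - x)) \<longlonglongrightarrow> 0 \<Longrightarrow> x \<in> I"
  shows "closed_ideal (universal_cstar_algebra X R) ((\<lambda>x. completion.quotient_cong `` {x}) ` I)"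
  unfolding closed_ideal_def
proof (intro conjI allI ballI impI completion_algebra.image_ideal I)
  let ?A = "universal_cstar_algebra X R" and ?cl = "\<lambda>x. completion.quotient_cong `` {x}"
  fix f x assume x: "x \<in> carrier ?A" and f: "\<forall>n. f n \<in> ?cl ` I"
    and lim: "(\<lambda>n. alg_norm ?A (alg_add ?A (f n) (alg_scale ?A (- 1) x))) \<longlonglongrightarrow> 0"
  obtain y where y: "y \<in> C" "x = ?cl y" using x by (auto simp: completion_algebra.carrier_A_image)
  have "\<forall>n. \<exists>g. g \<in> I \<and> f n = ?cl g" using f by blast
  then obtain g where g: "\<And>n. g n \<in> I" "\<And>n. f n = ?cl (g n)" by metis
  have gC: "g n \<in> C" for n using completion.full_idealD(2)[OF I g(1)] .
  have "alg_add ?A (f n) (alg_scale ?A (- 1) x) = ?cl (g n - y)" for n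
    using y gC g by (simp add: completion_algebra.scale_cl completion_algebra.add_cl cscale_minus_one C_uminus)
  then have "(\<lambda>n. limit_norm (g n - y)) \<longlonglongrightarrow> 0" using lim gC y by (simp add: alg_norm_cl C_diff)
  then have "y \<in> I" using cl g(1) y(1) by blast
  then show "x \<in> ?cl ` I" using y by blast
qed

end

section \<open>Operator seminorms\<close>

definition supp :: "('b \<Rightarrow> complex) \<Rightarrow> 'b set" where
  "supp f = {b. f b \<noteq> 0}"

definition inner_prod :: "('b \<Rightarrow> complex) \<Rightarrow> ('b \<Rightarrow> complex) \<Rightarrow> complex" where
  "inner_prod f h = (\<Sum>b\<in>supp f. f b * cnj (h b))"

definition l2_norm :: "('b \<Rightarrow> complex) \<Rightarrow> real" where
  "l2_norm f = L2_set (\<lambda>b. cmod (f b)) (supp f)"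

lemma inner_prod_superset: "finite A \<Longrightarrow> supp f \<subseteq> A \<Longrightarrow> inner_prod f h = (\<Sum>b\<in>A. f b * cnj (h b))"
  unfolding inner_prod_def by (rule sum.mono_neutral_left) (auto simp: supp_def)

lemma l2_norm_superset: "finite A \<Longrightarrow> supp f \<subseteq> A \<Longrightarrow> l2_norm f = L2_set (\<lambda>b. cmod (f b)) A"
  unfolding l2_norm_def L2_set_def
  by (intro arg_cong[of _ _ sqrt] sum.mono_neutral_left) (auto simp: supp_def)

lemma l2_norm_nonneg [simp]: "0 \<le> l2_norm f"
  by (simp add: l2_norm_def)

lemma inner_prod_commute:
  assumes "finite (supp f)" "finite (supp h)"
  shows "inner_prod f h = cnj (inner_prod h f)"
  using assms inner_prod_superset[of "supp f \<union> supp h" f h] inner_prod_superset[of "supp f \<union> supp h" h f]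
  by (simp add: mult.commute)

lemma inner_prod_self: "inner_prod f f = complex_of_real ((l2_norm f)\<^sup>2)"
proof -
  have "(l2_norm f)\<^sup>2 = (\<Sum>b\<in>supp f. (cmod (f b))\<^sup>2)"
    by (simp add: l2_norm_def L2_set_def sum_nonneg)
  then show ?thesis by (simp add: inner_prod_def complex_norm_square del: of_real_power)
qed

lemma inner_prod_cauchy_schwarz:
  assumes f: "finite (supp f)" and h: "finite (supp h)"
  shows "cmod (inner_prod f h) \<le> l2_norm f * l2_norm h"
proof -
  let ?A = "supp f \<union> supp h"
  have "cmod (inner_prod f h) = cmod (\<Sum>b\<in>?A. f b * cnj (h b))" using f h by (subst inner_prod_superset[of ?A]) auto
  also have "\<dots> \<le> (\<Sum>b\<in>?A. \<bar>cmod (f b)\<bar> * \<bar>cmod (h b)\<bar>)"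
    by (rule order.trans[OF norm_sum]) (simp add: norm_mult)
  also have "\<dots> \<le> L2_set (\<lambda>b. cmod (f b)) ?A * L2_set (\<lambda>b. cmod (h b)) ?A"
    by (rule L2_set_mult_ineq)
  also have "\<dots> = l2_norm f * l2_norm h" using f h by (simp add: l2_norm_superset[of ?A])
  finally show ?thesis .
qed

lemma supp_add: "supp (\<lambda>b. f b + h b) \<subseteq> supp f \<union> supp h"
  by (auto simp: supp_def)

lemma l2_norm_add:
  assumes f: "finite (supp f)" and h: "finite (supp h)"
  shows "l2_norm (\<lambda>b. f b + h b) \<le> l2_norm f + l2_norm h"
proof -
  let ?A = "supp f \<union> supp h"
  have "l2_norm (\<lambda>b. f b + h b) = L2_set (\<lambda>b. cmod (f b + h b)) ?A"
    by (intro l2_norm_superset supp_add) (use f h in auto)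
  also have "\<dots> \<le> L2_set (\<lambda>b. cmod (f b) + cmod (h b)) ?A"
    by (rule L2_set_mono) (auto intro: norm_triangle_ineq)
  also have "\<dots> \<le> L2_set (\<lambda>b. cmod (f b)) ?A + L2_set (\<lambda>b. cmod (h b)) ?A"
    by (rule L2_set_triangle_ineq)
  also have "\<dots> = l2_norm f + l2_norm h" using f h by (simp add: l2_norm_superset[of ?A])
  finally show ?thesis .
qed

lemma l2_norm_scale: "l2_norm (\<lambda>b. c * f b) = cmod c * l2_norm f"
proof (cases "c = 0")
  case True
  then show ?thesis by (simp add: l2_norm_def supp_def)
next
  case False
  then have "supp (\<lambda>b. c * f b) = supp f" by (auto simp: supp_def)
  then show ?thesis by (simp add: l2_norm_def norm_mult L2_set_right_distrib)
qed

lemma l2_norm_restrict: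
  assumes f: "finite (supp f)" and "\<And>b. h b = f b \<or> h b = 0"
  shows "l2_norm h \<le> l2_norm f"
proof -
  have "supp h \<subseteq> supp f" using assms(2) by (auto simp: supp_def) metis
  then have "l2_norm h = L2_set (\<lambda>b. cmod (h b)) (supp f)" by (rule l2_norm_superset[OF f])
  also have "\<dots> \<le> L2_set (\<lambda>b. cmod (f b)) (supp f)"
    using assms(2) by (intro L2_set_mono) (metis norm_ge_zero norm_zero order.refl, simp)
  finally show ?thesis by (simp add: l2_norm_def)
qed

lemma l2_norm_zero_iff:
  assumes "finite (supp f)"
  shows "l2_norm f = 0 \<longleftrightarrow> (\<forall>b. f b = 0)"
  using assms by (auto simp: l2_norm_def L2_set_eq_0_iff supp_def)

text \<open>
  A *-representation by contractions on the finitely supported functions, with their \<open>\<ell>\<^sup>2\<close>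
  inner product. A pre-Hilbert space suffices: every letter has an adjoint among the operators, so the
  operator norm satisfies the C*-identity without completing.
\<close>

locale contraction_action = word_action opr
  for opr :: "'x star_letter \<Rightarrow> ('b \<Rightarrow> complex) \<Rightarrow> 'b \<Rightarrow> complex" +
  assumes opr_finite: "finite (supp f) \<Longrightarrow> finite (supp (opr g f))"
    and opr_contraction: "finite (supp f) \<Longrightarrow> l2_norm (opr g f) \<le> l2_norm f"
    and opr_adjoint: "finite (supp f) \<Longrightarrow> finite (supp h) \<Longrightarrow> inner_prod (opr g f) h = inner_prod f (opr (letter_star g) h)"
begin

lemma word_act_finite: "finite (supp f) \<Longrightarrow> finite (supp (word_act l f))"
  by (induction l) (simp_all add: word_act_def opr_finite)

lemma word_act_contraction: "finite (supp f) \<Longrightarrow> l2_norm (word_act l f) \<le> l2_norm f"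
proof (induction l)
  case (Cons g l)
  have "l2_norm (opr g (word_act l f)) \<le> l2_norm (word_act l f)"
    by (rule opr_contraction[OF word_act_finite[OF Cons.prems]])
  then show ?case using Cons by (simp add: word_act_def)
qed (simp add: word_act_def)

lemma act_bounded:
  "(\<forall>f. finite (supp f) \<longrightarrow> finite (supp (act x f))) \<and>
   (\<exists>B\<ge>0. \<forall>f. finite (supp f) \<longrightarrow> l2_norm (act x f) \<le> B * l2_norm f)"
proof (induction x rule: poly_induct)
  case zero
  have z: "act 0 f = (\<lambda>b. 0)" for f by auto
  have "supp (\<lambda>b::'b. 0) = {}" "l2_norm (\<lambda>b::'b. 0) = 0" by (auto simp: supp_def l2_norm_def)
  then show ?case by (auto simp: z intro!: exI[of _ 0])
next
  case (single w c)
  have s: "act (Poly_Mapping.single w c) f = (\<lambda>b. c * word_act (letters w) f b)" for f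
    by (auto simp: act_single)
  have "finite (supp (\<lambda>b. c * word_act (letters w) f b))" if "finite (supp f)" for f
    using word_act_finite[OF that, of "letters w"] by (rule finite_subset[rotated]) (auto simp: supp_def)
  moreover have "l2_norm (\<lambda>b. c * word_act (letters w) f b) \<le> cmod c * l2_norm f" if "finite (supp f)" for f
    unfolding l2_norm_scale using word_act_contraction[OF that] by (simp add: mult_left_mono)
  ultimately show ?case unfolding s by (intro conjI allI impI exI[of _ "cmod c"] norm_ge_zero)
next
  case (add x y)
  then obtain B B' where B: "B \<ge> 0" "\<forall>f. finite (supp f) \<longrightarrow> l2_norm (act x f) \<le> B * l2_norm f"
    and B': "B' \<ge> 0" "\<forall>f. finite (supp f) \<longrightarrow> l2_norm (act y f) \<le> B' * l2_norm f" by blast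
  have s: "act (x + y) f = (\<lambda>b. act x f b + act y f b)" for f by (auto simp: act_add)
  have fin: "finite (supp (act x f))" "finite (supp (act y f))" if "finite (supp f)" for f
    using add.IH that by blast+
  have "finite (supp (\<lambda>b. act x f b + act y f b))" if "finite (supp f)" for f
    by (rule finite_subset[OF supp_add]) (use fin[OF that] in simp)
  moreover have "l2_norm (\<lambda>b. act x f b + act y f b) \<le> (B + B') * l2_norm f" if "finite (supp f)" for f
  proof -
    have "l2_norm (act x f) \<le> B * l2_norm f" "l2_norm (act y f) \<le> B' * l2_norm f" using B B' that by auto
    then show ?thesis using l2_norm_add[OF fin[OF that]] by (simp add: distrib_right)
  qed
  ultimately show ?case
    unfolding s using B(1) B'(1) by (intro conjI allI impI exI[of _ "B + B'"] add_nonneg_nonneg)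
qed

lemma act_finite: "finite (supp f) \<Longrightarrow> finite (supp (act x f))"
  using act_bounded by blast

lemma inner_prod_add_left: "finite (supp f) \<Longrightarrow> finite (supp g) \<Longrightarrow> inner_prod (\<lambda>b. f b + g b) h = inner_prod f h + inner_prod g h"
  using supp_add[of f g] inner_prod_superset[of "supp f \<union> supp g"]
  by (simp add: distrib_right sum.distrib)

lemma inner_prod_add_right: "inner_prod f (\<lambda>b. g b + h b) = inner_prod f g + inner_prod f h"
  by (simp add: inner_prod_def distrib_left sum.distrib)

lemma inner_prod_scale_left: "finite (supp f) \<Longrightarrow> inner_prod (\<lambda>b. c * f b) h = c * inner_prod f h"
  using inner_prod_superset[of "supp f" "\<lambda>b. c * f b" h]
  by (auto simp: inner_prod_def sum_distrib_left mult.assoc supp_def)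

lemma inner_prod_scale_right: "inner_prod f (\<lambda>b. c * h b) = cnj c * inner_prod f h"
  by (simp add: inner_prod_def sum_distrib_left mult_ac)

lemma word_act_adjoint:
  "finite (supp f) \<Longrightarrow> finite (supp h) \<Longrightarrow> inner_prod (word_act l f) h = inner_prod f (word_act (rev (map letter_star l)) h)"
proof (induction l arbitrary: h)
  case (Cons g l)
  have "inner_prod (opr g (word_act l f)) h = inner_prod (word_act l f) (opr (letter_star g) h)"
    using Cons.prems by (intro opr_adjoint word_act_finite)
  also have "\<dots> = inner_prod f (word_act (rev (map letter_star l)) (opr (letter_star g) h))"
    using Cons.prems by (intro Cons.IH opr_finite)
  finally show ?case by (simp add: word_act_def)
qed (simp add: word_act_def)

lemma act_adjoint: "finite (supp f) \<Longrightarrow> finite (supp h) \<Longrightarrow> inner_prod (act x f) h = inner_prod f (act (star x) h)"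
proof (induction x rule: poly_induct)
  case zero
  have "act 0 f = (\<lambda>b. 0)" "act 0 h = (\<lambda>b. 0)" by auto
  then show ?case by (simp add: inner_prod_def supp_def)
next
  case (single w c)
  let ?l = "letters w"
  let ?l' = "rev (map letter_star ?l)"
  have l: "act (Poly_Mapping.single w c) f = (\<lambda>b. c * word_act ?l f b)" by (auto simp: act_single)
  have r: "act (star (Poly_Mapping.single w c)) h = (\<lambda>b. cnj c * word_act ?l' h b)"
    by (auto simp: star_single act_single word_star_def)
  have "inner_prod (act (Poly_Mapping.single w c) f) h = c * inner_prod (word_act ?l f) h"
    unfolding l by (rule inner_prod_scale_left[OF word_act_finite[OF single(1)]])
  also have "inner_prod (word_act ?l f) h = inner_prod f (word_act ?l' h)" by (rule word_act_adjoint[OF single])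
  also have "c * inner_prod f (word_act ?l' h) = inner_prod f (act (star (Poly_Mapping.single w c)) h)"
    unfolding r inner_prod_scale_right by simp
  finally show ?case .
next
  case (add x y)
  have "act (x + y) f = (\<lambda>b. act x f b + act y f b)"
    "act (star (x + y)) h = (\<lambda>b. act (star x) h b + act (star y) h b)" by (auto simp: act_add star_add)
  note eq = this
  have "inner_prod (act (x + y) f) h = inner_prod (act x f) h + inner_prod (act y f) h"
    unfolding eq by (intro inner_prod_add_left act_finite add.prems)
  also have "\<dots> = inner_prod f (act (star x) h) + inner_prod f (act (star y) h)"
    using add.IH(1)[OF add.prems] add.IH(2)[OF add.prems] by simp
  also have "\<dots> = inner_prod f (act (star (x + y)) h)" unfolding eq by (rule inner_prod_add_right[symmetric])
  finally show ?case .
qed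

definition opnorm :: "'x star_poly \<Rightarrow> real" where
  "opnorm x = Sup {l2_norm (act x f) | f. finite (supp f) \<and> l2_norm f \<le> 1}"

lemma opnorm_le:
  assumes B: "B \<ge> 0" "\<And>f. finite (supp f) \<Longrightarrow> l2_norm (act x f) \<le> B * l2_norm f"
  shows "opnorm x \<le> B"
  unfolding opnorm_def
proof (rule cSup_least)
  show "{l2_norm (act x f) | f. finite (supp f) \<and> l2_norm f \<le> 1} \<noteq> {}"
    by (auto intro!: exI[of _ "\<lambda>_. 0"] simp: supp_def l2_norm_def)
  fix r assume "r \<in> {l2_norm (act x f) | f. finite (supp f) \<and> l2_norm f \<le> 1}"
  then obtain f where "r = l2_norm (act x f)" "finite (supp f)" "l2_norm f \<le> 1" by blast
  then show "r \<le> B" using B(2)[of f] mult_left_mono[of "l2_norm f" 1 B] B(1) by simp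
qed

lemma opnorm_bdd: "bdd_above {l2_norm (act x f) | f. finite (supp f) \<and> l2_norm f \<le> 1}"
proof -
  obtain B where B: "B \<ge> 0" "\<forall>f. finite (supp f) \<longrightarrow> l2_norm (act x f) \<le> B * l2_norm f"
    using act_bounded by blast
  have "l2_norm (act x f) \<le> B" if "finite (supp f)" "l2_norm f \<le> 1" for f
    using B(2) that mult_left_mono[of "l2_norm f" 1 B] B(1) by fastforce
  then show ?thesis by (auto intro!: bdd_aboveI)
qed

lemma l2_norm_act_le_one: "finite (supp f) \<Longrightarrow> l2_norm f \<le> 1 \<Longrightarrow> l2_norm (act x f) \<le> opnorm x"
  unfolding opnorm_def by (rule cSup_upper[OF _ opnorm_bdd]) blast

lemma opnorm_nonneg: "0 \<le> opnorm x"
proof -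
  have "l2_norm (act x (\<lambda>_. 0)) \<le> opnorm x" by (rule l2_norm_act_le_one) (simp_all add: supp_def l2_norm_def)
  then show ?thesis using l2_norm_nonneg order.trans by blast
qed

lemma l2_norm_act_le:
  assumes f: "finite (supp f)"
  shows "l2_norm (act x f) \<le> opnorm x * l2_norm f"
proof (cases "l2_norm f = 0")
  case True
  then have "f = (\<lambda>b. 0)" using l2_norm_zero_iff[OF f] by auto
  moreover have "act x (\<lambda>b. 0) = (\<lambda>b. 0)" by auto
  ultimately show ?thesis using True by simp
next
  case False
  let ?c = "complex_of_real (inverse (l2_norm f))"
  let ?g = "\<lambda>b. ?c * f b"
  have fin: "finite (supp ?g)" using f by (rule finite_subset[rotated]) (auto simp: supp_def)
  have pos: "l2_norm f > 0" using False l2_norm_nonneg[of f] by linarith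
  have "l2_norm ?g = 1" unfolding l2_norm_scale using pos by (simp add: norm_inverse)
  then have "l2_norm (act x ?g) \<le> opnorm x" using l2_norm_act_le_one[OF fin] by simp
  moreover have "act x ?g = (\<lambda>b. ?c * act x f b)" by (auto simp: act_scale_fun)
  ultimately have "inverse (l2_norm f) * l2_norm (act x f) \<le> opnorm x" using pos by (simp add: l2_norm_scale norm_inverse)
  then show ?thesis using pos by (simp add: field_simps)
qed

text \<open>
  This is \<open>\<parallel>\<pi>(x) f\<parallel>\<^sup>2 = \<langle>\<pi>(x\<^sup>*x) f, f\<rangle> \<le> \<parallel>\<pi>(x\<^sup>*x)\<parallel> \<parallel>f\<parallel>\<^sup>2\<close>, by Cauchy--Schwarz.
\<close>

lemma opnorm_square_le: "(opnorm x)\<^sup>2 \<le> opnorm (star x * x)"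
proof -
  have "l2_norm (act x f) \<le> sqrt (opnorm (star x * x)) * l2_norm f" if f: "finite (supp f)" for f
  proof -
    have "(l2_norm (act x f))\<^sup>2 = cmod (inner_prod (act x f) (act x f))" by (simp add: inner_prod_self norm_power)
    also have "inner_prod (act x f) (act x f) = inner_prod f (act (star x) (act x f))"
      by (rule act_adjoint[OF f act_finite[OF f]])
    also have "act (star x) (act x f) = act (star x * x) f" by (auto simp: act_mult)
    also have "cmod (inner_prod f (act (star x * x) f)) \<le> l2_norm f * l2_norm (act (star x * x) f)"
      by (rule inner_prod_cauchy_schwarz[OF f act_finite[OF f]])
    also have "\<dots> \<le> l2_norm f * (opnorm (star x * x) * l2_norm f)"
      by (intro mult_left_mono l2_norm_act_le f l2_norm_nonneg)
    finally have "(l2_norm (act x f))\<^sup>2 \<le> opnorm (star x * x) * (l2_norm f)\<^sup>2"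
      by (simp add: power2_eq_square mult_ac)
    then have "l2_norm (act x f) \<le> sqrt (opnorm (star x * x) * (l2_norm f)\<^sup>2)" by (rule real_le_rsqrt)
    then show ?thesis by (simp add: real_sqrt_mult)
  qed
  then have "opnorm x \<le> sqrt (opnorm (star x * x))" by (intro opnorm_le) (simp_all add: opnorm_nonneg)
  then have "(opnorm x)\<^sup>2 \<le> (sqrt (opnorm (star x * x)))\<^sup>2" using opnorm_nonneg by (rule power_mono)
  then show ?thesis using opnorm_nonneg by simp
qed

lemma opnorm_mult: "opnorm (x * y) \<le> opnorm x * opnorm y"
proof (rule opnorm_le)
  fix f :: "'b \<Rightarrow> complex" assume f: "finite (supp f)"
  have "act (x * y) f = act x (act y f)" by (auto simp: act_mult)
  then have "l2_norm (act (x * y) f) \<le> opnorm x * l2_norm (act y f)" using l2_norm_act_le[OF act_finite[OF f]] by simp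
  also have "\<dots> \<le> opnorm x * (opnorm y * l2_norm f)" by (intro mult_left_mono l2_norm_act_le f opnorm_nonneg)
  finally show "l2_norm (act (x * y) f) \<le> opnorm x * opnorm y * l2_norm f" by (simp add: mult.assoc)
qed (simp add: opnorm_nonneg)

lemma opnorm_le_star: "opnorm x \<le> opnorm (star x)"
proof -
  have "(opnorm x)\<^sup>2 \<le> opnorm (star x) * opnorm x"
    using opnorm_square_le[of x] opnorm_mult[of "star x" x] by linarith
  then show ?thesis
    using opnorm_nonneg[of x] opnorm_nonneg[of "star x"]
    by (cases "opnorm x = 0") (auto simp: power2_eq_square)
qed

lemma opnorm_scale_le: "opnorm (scale c x) \<le> cmod c * opnorm x"
proof (rule opnorm_le)
  fix f :: "'b \<Rightarrow> complex" assume f: "finite (supp f)"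
  have "act (scale c x) f = (\<lambda>b. c * act x f b)" by (auto simp: act_scale)
  then show "l2_norm (act (scale c x) f) \<le> cmod c * opnorm x * l2_norm f"
    using mult_left_mono[OF l2_norm_act_le[OF f, of x], of "cmod c"] by (simp add: l2_norm_scale mult.assoc)
qed (simp add: opnorm_nonneg)

lemma cstar_seminorm_opnorm:
  assumes R: "\<And>r f b. r \<in> R \<Longrightarrow> act r f b = 0"
  shows "cstar_seminorm X R opnorm"
proof -
  have add: "opnorm (x + y) \<le> opnorm x + opnorm y" for x y
  proof (rule opnorm_le)
    fix f :: "'b \<Rightarrow> complex" assume f: "finite (supp f)"
    have eq: "act (x + y) f = (\<lambda>b. act x f b + act y f b)" by (auto simp: act_add)
    have "l2_norm (act (x + y) f) \<le> l2_norm (act x f) + l2_norm (act y f)"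
      unfolding eq by (rule l2_norm_add[OF act_finite[OF f] act_finite[OF f]])
    then show "l2_norm (act (x + y) f) \<le> (opnorm x + opnorm y) * l2_norm f"
      using l2_norm_act_le[OF f, of x] l2_norm_act_le[OF f, of y] by (simp add: distrib_right)
  qed (simp add: opnorm_nonneg)
  have scale: "opnorm (scale c x) = cmod c * opnorm x" for c x
  proof (cases "c = 0")
    case True
    then show ?thesis using opnorm_scale_le[of 0 x] opnorm_nonneg[of "scale 0 x"] by simp
  next
    case False
    have "cmod c * opnorm x = cmod c * opnorm (scale (inverse c) (scale c x))"
      using False by (simp add: scale_scale)
    also have "\<dots> \<le> cmod c * (cmod (inverse c) * opnorm (scale c x))"
      by (intro mult_left_mono opnorm_scale_le norm_ge_zero)
    also have "\<dots> = opnorm (scale c x)" using False by (simp add: norm_inverse)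
    finally show ?thesis using opnorm_scale_le[of c x] by simp
  qed
  have "opnorm (star x * x) \<le> (opnorm x)\<^sup>2" for x
    using opnorm_mult[of "star x" x] opnorm_le_star[of "star x"] opnorm_nonneg[of x]
      mult_right_mono[of "opnorm (star x)" "opnorm x" "opnorm x"] by (simp add: power2_eq_square)
  moreover have "opnorm r = 0" if "r \<in> R" for r
  proof -
    have "act r f = (\<lambda>b. 0)" for f using R[OF that] by auto
    then have "opnorm r \<le> 0" by (intro opnorm_le) (auto simp: l2_norm_def supp_def)
    then show ?thesis using opnorm_nonneg[of r] by simp
  qed
  ultimately show ?thesis
    using add opnorm_mult scale opnorm_square_le by (auto simp: cstar_seminorm_def intro: antisym)
qed

end

section \<open>The gauge action\<close>

fun letter_deg :: "('v, 'e) ck_gen star_letter \<Rightarrow> int" where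
  "letter_deg (Plain (CK_Iso e)) = 1"
| "letter_deg (Starred (CK_Iso e)) = - 1"
| "letter_deg (Plain (CK_Proj v)) = 0"
| "letter_deg (Starred (CK_Proj v)) = 0"

definition word_deg :: "('v, 'e) ck_gen star_letter free_word \<Rightarrow> int" where
  "word_deg w = sum_list (map letter_deg (letters w))"

lemma letter_deg_star: "letter_deg (letter_star l) = - letter_deg l"
  by (cases l rule: letter_deg.cases) auto

lemma word_deg_plus: "word_deg (u + v) = word_deg u + word_deg v"
  by (simp add: word_deg_def)

lemma word_deg_star: "word_deg (word_star w) = - word_deg w"
proof -
  have "sum_list (map letter_deg (rev (map letter_star l))) = - sum_list (map letter_deg l)" for l :: "('a, 'b) ck_gen star_letter list"
    by (induction l) (simp_all add: letter_deg_star)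
  then show ?thesis by (simp add: word_deg_def word_star_def)
qed

text \<open>
  The gauge action of the circle: an edge is multiplied by \<open>z\<close>, its adjoint by \<open>z\<^sup>-\<^sup>1\<close>.
\<close>

definition gauge :: "complex \<Rightarrow> ('v, 'e) ck_gen star_poly \<Rightarrow> ('v, 'e) ck_gen star_poly" where
  "gauge z = Poly_Mapping.mapp (\<lambda>w c. z powi word_deg w * c)"

lemma lookup_gauge: "Poly_Mapping.lookup (gauge z x) w = z powi word_deg w * Poly_Mapping.lookup x w"
  by (simp add: gauge_def lookup_mapp when_def in_keys_iff)

lemma gauge_zero [simp]: "gauge z 0 = 0"
  by (rule poly_mapping_eqI) (simp add: lookup_gauge)

lemma gauge_add: "gauge z (x + y) = gauge z x + gauge z y"
  by (rule poly_mapping_eqI) (simp add: lookup_gauge lookup_add distrib_left)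

lemma gauge_diff: "gauge z (x - y) = gauge z x - gauge z y"
  by (rule poly_mapping_eqI) (simp add: lookup_gauge lookup_minus right_diff_distrib)

lemma gauge_sum: "gauge z (sum f A) = (\<Sum>i\<in>A. gauge z (f i))"
  by (induction A rule: infinite_finite_induct) (simp_all add: gauge_add)

lemma gauge_single: "gauge z (Poly_Mapping.single w c) = Poly_Mapping.single w (z powi word_deg w * c)"
  by (rule poly_mapping_eqI) (simp add: lookup_gauge lookup_single when_def)

lemma gauge_scale: "gauge z (scale c x) = scale c (gauge z x)"
  by (induction x rule: poly_induct)
    (simp_all add: gauge_single gauge_add scale_add_right mult_ac)

lemma gauge_mult: "z \<noteq> 0 \<Longrightarrow> gauge z (x * y) = gauge z x * gauge z y"
proof (induction x rule: poly_induct)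
  case (single w c)
  then show ?case
    by (induction y rule: poly_induct)
      (simp_all add: gauge_single mult_single word_deg_plus power_int_add gauge_add distrib_left mult_ac)
qed (simp_all add: gauge_add distrib_right)

lemma gauge_gauge: "gauge z (gauge u x) = gauge (z * u) x"
  by (rule poly_mapping_eqI) (simp add: lookup_gauge power_int_mult_distrib)

lemma gauge_one [simp]: "gauge 1 x = x"
  by (rule poly_mapping_eqI) (simp add: lookup_gauge)

lemma cnj_unit: "cmod z = 1 \<Longrightarrow> cnj z = inverse z"
  by (metis complex_norm_square inverse_unique mult.commute of_real_1 power_one)

lemma cnj_power_int_unit: "cmod z = 1 \<Longrightarrow> cnj (z powi n) = inverse (z powi n)"
  by (simp add: complex_cnj_power_int cnj_unit power_int_inverse)

lemma star_gauge: "cmod z = 1 \<Longrightarrow> star (gauge z x) = gauge z (star x)"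
  by (rule poly_mapping_eqI)
    (simp add: lookup_gauge lookup_star word_deg_star power_int_minus cnj_power_int_unit del: complex_cnj_power_int)

lemma gauge_closed [simp]: "x \<in> free_star_algebra X \<Longrightarrow> gauge z x \<in> free_star_algebra X"
  using keys_mapp_subset[of "\<lambda>w c. z powi word_deg w * c" x]
  unfolding free_star_algebra_def free_algebra_def gauge_def by blast

lemma gauge_ck_p [simp]: "gauge z (ck_p v) = ck_p v"
  by (simp add: ck_p_def gen_def gauge_single word_deg_def)

lemma gauge_ck_s [simp]: "gauge z (ck_s e) = scale z (ck_s e)"
  by (simp add: ck_s_def gen_def gauge_single word_deg_def)

lemma gauge_ck_s_star [simp]: "gauge z (star (ck_s e)) = scale (inverse z) (star (ck_s e))"
  by (simp add: ck_s_def star_gen) (simp add: gen_def gauge_single word_deg_def power_int_minus)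

section \<open>Graph C*-algebras\<close>

locale graph_cstar = row_finite_graph E for E :: "('v, 'e) pre_digraph"
begin

abbreviation ckX where "ckX \<equiv> ck_gens E"
abbreviation ckR where "ckR \<equiv> ck_relators E"
abbreviation FA :: "('v, 'e) ck_gen star_poly set" where
  "FA \<equiv> free_algebra (Plain ` ck_gens E \<union> Starred ` ck_gens E)"

lemma FA_eq: "free_star_algebra ckX = FA"
  by (simp add: free_star_algebra_def)

lemma ck_p_in [simp]: "v \<in> verts E \<Longrightarrow> ck_p v \<in> FA"
  by (simp add: ck_p_def ck_gens_def)

lemma ck_s_in [simp]: "e \<in> arcs E \<Longrightarrow> ck_s e \<in> FA" "e \<in> arcs E \<Longrightarrow> star (ck_s e) \<in> FA"
  by (simp_all add: ck_s_def ck_gens_def star_gen)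

lemma star_FA: "x \<in> FA \<Longrightarrow> star x \<in> FA"
  using star_closed[of x ckX] by (simp add: FA_eq)

lemma ck_relators_in: "ckR \<subseteq> FA"
  unfolding ck_relators_def
  using regular_in_verts
  by (auto intro!: free_algebra_diff free_algebra_mult free_algebra_sum star_FA)

lemma ck_relatorsI:
  "v \<in> verts E \<Longrightarrow> star (ck_p v) - ck_p v \<in> ckR"
  "v \<in> verts E \<Longrightarrow> w \<in> verts E \<Longrightarrow> ck_p v * ck_p w - (if v = w then ck_p v else 0) \<in> ckR"
  "e \<in> arcs E \<Longrightarrow> ck_s e * star (ck_s e) * ck_s e - ck_s e \<in> ckR"
  "e \<in> arcs E \<Longrightarrow> f \<in> arcs E \<Longrightarrow> e \<noteq> f \<Longrightarrow>
    (ck_s e * star (ck_s e)) * (ck_s f * star (ck_s f)) \<in> ckR"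
  "e \<in> arcs E \<Longrightarrow> star (ck_s e) * ck_s e - ck_p (head E e) \<in> ckR"
  "e \<in> arcs E \<Longrightarrow> ck_p (tail E e) * (ck_s e * star (ck_s e)) - ck_s e * star (ck_s e) \<in> ckR"
  "v \<in> regular_vertices E \<Longrightarrow> ck_p v - (\<Sum>e\<in>out_arcs E v. ck_s e * star (ck_s e)) \<in> ckR"
  unfolding ck_relators_def by (blast intro: UnI1 UnI2)+

lemma ck_relators_null:
  assumes \<rho>: "cstar_seminorm ckX ckR \<rho>" and r: "r \<in> ckR"
  shows "r \<in> cstar_norm.null ckX \<rho>"
  using cstar_norm.null_def[OF cstar_norm.intro[OF \<rho>]] cstar_norm.N_rel[OF cstar_norm.intro[OF \<rho>] r]
    ck_relators_in r by (auto simp: FA_eq)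

sublocale cstar: universal_completion ckX ckR
proof unfold_locales
  fix \<rho> x assume \<rho>: "cstar_seminorm ckX ckR \<rho>" and x: "x \<in> ckX"
  interpret cstar_norm ckX ckR \<rho> by (rule cstar_norm.intro[OF \<rho>])
  note null = ck_relators_null[OF \<rho> ck_relatorsI(1)] ck_relators_null[OF \<rho> ck_relatorsI(2)]
    ck_relators_null[OF \<rho> ck_relatorsI(5)]
  have p: "\<rho> (ck_p v) \<le> 1" if v: "v \<in> verts E" for v
    using N_idempotent_le_one[of "ck_p v"] null(1)[OF v] null(2)[OF v v] v by (simp add: FA_eq)
  show "\<rho> (gen (Plain x)) \<le> 1"
  proof (cases x)
    case (CK_Proj v)
    then show ?thesis using p x by (auto simp: ck_gens_def ck_p_def)
  next
    case (CK_Iso e)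
    then have e: "e \<in> arcs E" using x by (auto simp: ck_gens_def)
    have "(\<rho> (ck_s e))\<^sup>2 = \<rho> (star (ck_s e) * ck_s e)" using N_cstar[of "ck_s e"] e by (simp add: FA_eq)
    also have "\<dots> = \<rho> (ck_p (head E e))" using null(3)[OF e] e by (intro N_eq) (auto simp: FA_eq)
    also have "\<dots> \<le> 1" using p e by simp
    finally have "\<rho> (ck_s e) \<le> 1" by (simp add: power2_nonneg_ge_1_iff abs_square_le_1)
    then show ?thesis using CK_Iso by (simp add: ck_s_def)
  qed
qed (use ck_relators_in FA_eq in auto)

lemma null_ring_quotient: "ring_quotient FA cstar.null scale"
  using cstar.ring_quotient_null by (simp add: FA_eq)

text \<open>
  Partial isometries with \<open>s\<^sup>*s = p\<close> satisfy \<open>s p = s s\<^sup>*s = s\<close>, and the range projection below the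
  source vertex gives the other relation for \<open>s\<close>; those for the ghost edges are their adjoints.
  Orthogonality of different edges follows by multiplying the product of the range projections by \<open>s\<^sub>e\<^sup>*\<close>
  from the left and by \<open>s\<^sub>f\<close> from the right.
\<close>

lemma null_ck_relations: "ck_relations FA cstar.null scale E ck_p ck_s (\<lambda>e. star (ck_s e))"
proof -
  interpret Q: ring_quotient FA cstar.null scale by (rule null_ring_quotient)
  have rel: "Q.eqK x y" if "x - y \<in> ckR" for x y
    using ck_relators_null[OF cstar.N that] by (simp add: Q.eqK_def)
  have star_eq: "Q.eqK (star x) (star y)" if "Q.eqK x y" for x y
    using cstar.null_star[of "x - y"] that by (simp add: Q.eqK_def star_diff)
  have sss: "Q.eqK (ck_s e * star (ck_s e) * ck_s e) (ck_s e)" if "e \<in> arcs E" for e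
    by (rule rel[OF ck_relatorsI(3)[OF that]])
  have ss: "Q.eqK (star (ck_s e) * ck_s e) (ck_p (head E e))" if "e \<in> arcs E" for e
    by (rule rel[OF ck_relatorsI(5)[OF that]])
  have s_head: "Q.eqK (ck_s e * ck_p (head E e)) (ck_s e)" if e: "e \<in> arcs E" for e
  proof -
    have "Q.eqK (ck_s e * ck_p (head E e)) (ck_s e * (star (ck_s e) * ck_s e))"
      using e by (intro Q.eqK_left Q.eqK_sym[OF ss]) auto
    also have "Q.eqK \<dots> (ck_s e)" using sss[OF e] by (simp add: mult.assoc)
    finally show ?thesis .
  qed
  have tail_s: "Q.eqK (ck_p (tail E e) * ck_s e) (ck_s e)" if e: "e \<in> arcs E" for e
  proof -
    have "Q.eqK (ck_p (tail E e) * ck_s e) (ck_p (tail E e) * (ck_s e * star (ck_s e) * ck_s e))"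
      using e by (intro Q.eqK_left Q.eqK_sym[OF sss]) auto
    also have "\<dots> = ck_p (tail E e) * (ck_s e * star (ck_s e)) * ck_s e" by (simp add: mult.assoc)
    also have "Q.eqK \<dots> (ck_s e * star (ck_s e) * ck_s e)"
      using e by (intro Q.eqK_right rel ck_relatorsI) auto
    also have "Q.eqK \<dots> (ck_s e)" by (rule sss[OF e])
    finally show ?thesis .
  qed
  have star_p: "Q.eqK (star (ck_p v)) (ck_p v)" if "v \<in> verts E" for v
    by (rule rel[OF ck_relatorsI(1)[OF that]])
  show ?thesis
  proof (intro ck_relations.intro ck_relations_axioms.intro null_ring_quotient)
    show "row_finite_graph E" by unfold_locales
    show "Q.eqK (ck_p v * ck_p w) (if v = w then ck_p v else 0)" if "v \<in> verts E" "w \<in> verts E" for v w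
      by (rule rel[OF ck_relatorsI(2)[OF that]])
    show "Q.eqK (ck_p (head E e) * star (ck_s e)) (star (ck_s e))" if e: "e \<in> arcs E" for e
    proof -
      have "Q.eqK (ck_p (head E e) * star (ck_s e)) (star (ck_p (head E e)) * star (ck_s e))"
        using e by (intro Q.eqK_right Q.eqK_sym[OF star_p]) auto
      also have "Q.eqK \<dots> (star (ck_s e))" using star_eq[OF s_head[OF e]] by (simp add: star_mult)
      finally show ?thesis .
    qed
    show "Q.eqK (star (ck_s e) * ck_p (tail E e)) (star (ck_s e))" if e: "e \<in> arcs E" for e
    proof -
      have "Q.eqK (star (ck_s e) * ck_p (tail E e)) (star (ck_s e) * star (ck_p (tail E e)))"
        using e by (intro Q.eqK_left Q.eqK_sym[OF star_p]) auto
      also have "Q.eqK \<dots> (star (ck_s e))" using star_eq[OF tail_s[OF e]] by (simp add: star_mult)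
      finally show ?thesis .
    qed
    show "Q.eqK (star (ck_s e) * ck_s f) (if e = f then ck_p (head E e) else 0)"
      if e: "e \<in> arcs E" and f: "f \<in> arcs E" for e f
    proof (cases "e = f")
      case True
      then show ?thesis using ss[OF e] by simp
    next
      case False
      have t: "Q.eqK (star (ck_s e)) (star (ck_s e) * ck_s e * star (ck_s e))"
        using Q.eqK_sym[OF star_eq[OF sss[OF e]]] by (simp add: star_mult mult.assoc)
      have "Q.eqK (star (ck_s e) * ck_s f)
          ((star (ck_s e) * ck_s e * star (ck_s e)) * (ck_s f * star (ck_s f) * ck_s f))"
        using e f by (intro Q.eqK_mult t Q.eqK_sym[OF sss]) auto
      also have "\<dots> = star (ck_s e) * ((ck_s e * star (ck_s e)) * (ck_s f * star (ck_s f))) * ck_s f"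
        by (simp add: mult.assoc)
      finally have eq: "Q.eqK (star (ck_s e) * ck_s f) \<dots>" .
      have "star (ck_s e) * ((ck_s e * star (ck_s e)) * (ck_s f * star (ck_s f))) * ck_s f \<in> cstar.null"
        using e f by (intro Q.K_right[OF ck_s_in(1)] Q.K_left[OF ck_s_in(2)]
            ck_relators_null[OF cstar.N] ck_relatorsI(4) False)
      then show ?thesis using Q.eqK_in_K[OF eq] False by (simp add: Q.eqK_zero_iff)
    qed
    show "Q.eqK (ck_p v) (\<Sum>e\<in>out_arcs E v. ck_s e * star (ck_s e))" if "v \<in> regular_vertices E" for v
      by (rule rel[OF ck_relatorsI(7)[OF that]])
  qed (use s_head tail_s in auto)
qed

lemma null_ck_generators:
  "ck_generators (Plain ` ck_gens E \<union> Starred ` ck_gens E) cstar.null E ck_p ck_s (\<lambda>e. star (ck_s e))"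
proof (intro ck_generators.intro null_ck_relations ck_generators_axioms.intro)
  interpret Q: ring_quotient FA cstar.null scale by (rule null_ring_quotient)
  have star_p: "Q.eqK (star (ck_p v)) (ck_p v)" if "v \<in> verts E" for v
    using ck_relators_null[OF cstar.N ck_relatorsI(1)[OF that]] by (simp add: Q.eqK_def)
  fix g assume "g \<in> Plain ` ck_gens E \<union> Starred ` ck_gens E"
  then consider v where "v \<in> verts E" "gen g = ck_p v" | e where "e \<in> arcs E" "gen g = ck_s e"
    | v where "v \<in> verts E" "gen g = star (ck_p v)" | e where "e \<in> arcs E" "gen g = star (ck_s e)"
    by (auto simp: ck_gens_def ck_p_def ck_s_def star_gen)
  then show "(\<exists>v\<in>verts E. Q.eqK (gen g) (ck_p v)) \<or> (\<exists>e\<in>arcs E. Q.eqK (gen g) (ck_s e)) \<or>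
      (\<exists>e\<in>arcs E. Q.eqK (gen g) (star (ck_s e)))"
    using Q.eqK_refl star_p by cases metis+
qed

text \<open>
  Letters outside the graph act as zero, because the branching system describes only actual edges.
\<close>

fun ck_op :: "('v, 'e) ck_gen star_letter \<Rightarrow> ('v \<times> nat \<times> int \<Rightarrow> complex) \<Rightarrow> 'v \<times> nat \<times> int \<Rightarrow> complex" where
  "ck_op (Plain (CK_Proj v)) = vertex_op v"
| "ck_op (Starred (CK_Proj v)) = vertex_op v"
| "ck_op (Plain (CK_Iso e)) = (if e \<in> arcs E then edge_op e else (\<lambda>f b. 0))"
| "ck_op (Starred (CK_Iso e)) = (if e \<in> arcs E then ghost_op e else (\<lambda>f b. 0))"

text \<open>
  The injection of the points over the head of \<open>e\<close> that underlies \<open>edge_op e\<close> and \<open>ghost_op e\<close>.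
\<close>

definition edge_point :: "'e \<Rightarrow> 'v \<times> nat \<times> int \<Rightarrow> 'v \<times> nat \<times> int" where
  "edge_point e = (\<lambda>(u, k, i). (tail E e, k * out_deg (tail E e) + edge_index e, i + 1))"

lemma edge_point_inj:
  assumes "e \<in> arcs E"
  shows "inj_on (edge_point e) {b. fst b = head E e}"
  using edge_index_less[OF assms] by (auto simp: inj_on_def edge_point_def)

lemma ghost_op_point: "ghost_op e f b = (if fst b = head E e then f (edge_point e b) else 0)"
  by (cases b) (auto simp: ghost_op_def edge_point_def)

lemma edge_op_point:
  assumes e: "e \<in> arcs E" and b: "fst b = head E e"
  shows "edge_op e f (edge_point e b) = f b"
proof -
  obtain u k i where b': "b = (u, k, i)" by (cases b) auto
  let ?d = "out_deg (tail E e)"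
  have "(k * ?d + edge_index e) mod ?d = edge_index e" "(k * ?d + edge_index e) div ?d = k"
    using edge_index_less[OF e] by auto
  then show ?thesis using b by (simp add: b' edge_op_def edge_point_def)
qed

lemma supp_edge_op:
  assumes e: "e \<in> arcs E"
  shows "supp (edge_op e f) = edge_point e ` {b \<in> supp f. fst b = head E e}"
proof (intro equalityI subsetI)
  fix b assume b: "b \<in> supp (edge_op e f)"
  obtain u k i where b': "b = (u, k, i)" by (cases b) auto
  let ?d = "out_deg (tail E e)" and ?c = "(head E e, k div out_deg (tail E e), i - 1)"
  have c: "u = tail E e" "k mod ?d = edge_index e" "f ?c \<noteq> 0"
    using b by (auto simp: b' supp_def edge_op_def split: if_splits)
  then have "b = edge_point e ?c"
    using div_mult_mod_eq[of k ?d] by (simp add: b' edge_point_def)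
  then show "b \<in> edge_point e ` {b \<in> supp f. fst b = head E e}" using c(3) by (auto simp: supp_def)
next
  fix b assume "b \<in> edge_point e ` {b \<in> supp f. fst b = head E e}"
  then obtain c where c: "b = edge_point e c" "f c \<noteq> 0" "fst c = head E e" by (auto simp: supp_def)
  then show "b \<in> supp (edge_op e f)" using edge_op_point[OF e c(3), of f] by (simp add: supp_def)
qed

lemma finite_supp_op:
  assumes f: "finite (supp f)"
  shows "finite (supp (vertex_op v f))" "e \<in> arcs E \<Longrightarrow> finite (supp (edge_op e f))"
    "e \<in> arcs E \<Longrightarrow> finite (supp (ghost_op e f))"
proof -
  show "finite (supp (vertex_op v f))"
    using f by (rule finite_subset[rotated]) (auto simp: supp_def vertex_op_def split: if_splits)
  assume e: "e \<in> arcs E"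
  show "finite (supp (edge_op e f))" using f by (simp add: supp_edge_op[OF e])
  have "edge_point e ` supp (ghost_op e f) \<subseteq> supp f"
    by (auto simp: supp_def ghost_op_point split: if_splits)
  then have "finite (edge_point e ` supp (ghost_op e f))" using f by (rule finite_subset)
  moreover have "inj_on (edge_point e) (supp (ghost_op e f))"
    by (rule inj_on_subset[OF edge_point_inj[OF e]]) (auto simp: supp_def ghost_op_point split: if_splits)
  ultimately show "finite (supp (ghost_op e f))" by (rule finite_imageD)
qed

lemma edge_ghost_adjoint:
  assumes e: "e \<in> arcs E" and f: "finite (supp f)"
  shows "inner_prod (edge_op e f) h = inner_prod f (ghost_op e h)"
proof -
  let ?B = "{b \<in> supp f. fst b = head E e}"
  have inj: "inj_on (edge_point e) ?B"
    by (rule inj_on_subset[OF edge_point_inj[OF e]]) auto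
  have "inner_prod (edge_op e f) h = (\<Sum>b\<in>?B. edge_op e f (edge_point e b) * cnj (h (edge_point e b)))"
    unfolding inner_prod_def supp_edge_op[OF e] by (simp add: sum.reindex[OF inj])
  also have "\<dots> = (\<Sum>b\<in>?B. f b * cnj (ghost_op e h b))"
    by (rule sum.cong[OF HOL.refl]) (simp add: edge_op_point[OF e] ghost_op_point)
  also have "\<dots> = inner_prod f (ghost_op e h)"
    unfolding inner_prod_def using f by (intro sum.mono_neutral_left) (auto simp: ghost_op_point)
  finally show ?thesis .
qed

lemma ghost_edge_adjoint:
  assumes e: "e \<in> arcs E" and f: "finite (supp f)" and h: "finite (supp h)"
  shows "inner_prod (ghost_op e f) h = inner_prod f (edge_op e h)"
proof -
  have "inner_prod (ghost_op e f) h = cnj (inner_prod h (ghost_op e f))"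
    by (rule inner_prod_commute[OF finite_supp_op(3)[OF f e] h])
  also have "\<dots> = cnj (inner_prod (edge_op e h) f)" by (simp add: edge_ghost_adjoint[OF e h])
  also have "\<dots> = inner_prod f (edge_op e h)" by (rule inner_prod_commute[symmetric, OF f finite_supp_op(2)[OF h e]])
  finally show ?thesis .
qed

text \<open>
  An operator whose product with its adjoint only restricts functions to a subset is a contraction.
\<close>

lemma l2_norm_op_le:
  assumes f: "finite (supp f)" and g: "finite (supp g)" and adj: "inner_prod g g = inner_prod f h"
    and h: "\<And>b. h b = f b \<or> h b = 0"
  shows "l2_norm g \<le> l2_norm f"
proof -
  have hs: "finite (supp h)" using f by (rule finite_subset[rotated]) (use h in \<open>auto simp: supp_def, metis\<close>)
  have "(l2_norm g)\<^sup>2 = cmod (inner_prod g g)" by (simp add: inner_prod_self norm_power)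
  also have "\<dots> \<le> l2_norm f * l2_norm h" unfolding adj by (rule inner_prod_cauchy_schwarz[OF f hs])
  also have "\<dots> \<le> l2_norm f * l2_norm f" by (intro mult_left_mono l2_norm_restrict[OF f h] l2_norm_nonneg)
  finally have "(l2_norm g)\<^sup>2 \<le> (l2_norm f)\<^sup>2" by (simp add: power2_eq_square)
  then show ?thesis using l2_norm_nonneg by (rule power2_le_imp_le)
qed

sublocale rep: contraction_action ck_op
proof unfold_locales
  fix g and f h :: "'v \<times> nat \<times> int \<Rightarrow> complex" and c
  show "ck_op g (\<lambda>b. f b + h b) = (\<lambda>b. ck_op g f b + ck_op g h b)"
    by (cases g rule: ck_op.cases) (simp_all add: op_add)
  show "ck_op g (\<lambda>b. c * f b) = (\<lambda>b. c * ck_op g f b)"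
    by (cases g rule: ck_op.cases) (simp_all add: op_scale)
  assume f: "finite (supp f)"
  have z: "supp (\<lambda>b::'v \<times> nat \<times> int. 0) = {}" "l2_norm (\<lambda>b::'v \<times> nat \<times> int. 0) = 0"
    "inner_prod f (\<lambda>b. 0) = 0" "inner_prod (\<lambda>b. 0) f = 0" for f :: "'v \<times> nat \<times> int \<Rightarrow> complex"
    by (auto simp: supp_def l2_norm_def inner_prod_def)
  show "finite (supp (ck_op g f))"
    by (cases g rule: ck_op.cases) (simp_all add: finite_supp_op[OF f] z)
  have v: "l2_norm (vertex_op v f) \<le> l2_norm f" for v
    by (rule l2_norm_restrict[OF f]) (auto simp: vertex_op_def)
  have e: "l2_norm (edge_op e f) \<le> l2_norm f" if e: "e \<in> arcs E" for e
  proof (rule l2_norm_op_le[OF f finite_supp_op(2)[OF f e] edge_ghost_adjoint[OF e f]])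
    fix b show "ghost_op e (edge_op e f) b = f b \<or> ghost_op e (edge_op e f) b = 0"
      using ghost_edge_op[OF e e, of f b] by (cases b) (auto simp: vertex_op_def)
  qed
  have t: "l2_norm (ghost_op e f) \<le> l2_norm f" if e: "e \<in> arcs E" for e
  proof (rule l2_norm_op_le[OF f finite_supp_op(3)[OF f e] ghost_edge_adjoint[OF e f finite_supp_op(3)[OF f e]]])
    fix b show "edge_op e (ghost_op e f) b = f b \<or> edge_op e (ghost_op e f) b = 0"
      using edge_ghost_op[OF e, of f] by (cases b) auto
  qed
  show "l2_norm (ck_op g f) \<le> l2_norm f"
    by (cases g rule: ck_op.cases) (simp_all add: v e t z)
  assume h: "finite (supp h)"
  have "inner_prod (vertex_op v f) h = inner_prod f (vertex_op v h)" for v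
  proof -
    have "inner_prod (vertex_op v f) h = (\<Sum>b\<in>supp f. vertex_op v f b * cnj (h b))"
      using f by (intro inner_prod_superset) (auto simp: supp_def vertex_op_def split: if_splits)
    also have "\<dots> = inner_prod f (vertex_op v h)"
      unfolding inner_prod_def by (rule sum.cong[OF HOL.refl]) (auto simp: vertex_op_def)
    finally show ?thesis .
  qed
  then show "inner_prod (ck_op g f) h = inner_prod f (ck_op (letter_star g) h)"
    by (cases g rule: ck_op.cases)
      (simp_all add: edge_ghost_adjoint[OF _ f] ghost_edge_adjoint[OF _ f h] z)
qed

lemma rep_act_gens:
  "rep.act (ck_p v) f = vertex_op v f" "rep.act (star (ck_p v)) f = vertex_op v f"
  "e \<in> arcs E \<Longrightarrow> rep.act (ck_s e) f = edge_op e f" "e \<in> arcs E \<Longrightarrow> rep.act (star (ck_s e)) f = ghost_op e f"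
  "rep.act (x * y) f = rep.act x (rep.act y f)"
  by (auto simp: ck_p_def ck_s_def star_gen rep.act_gen rep.act_mult)

lemma rep_act_relators: "r \<in> ckR \<Longrightarrow> rep.act r f b = 0"
proof -
  assume r: "r \<in> ckR"
  have ev: "edge_op e (\<lambda>b. vertex_op (head E e) f b) b = edge_op e f b" for e f b by (rule edge_vertex_op)
  have ge: "ghost_op e (edge_op e f) = vertex_op (head E e) f" if "e \<in> arcs E" for e and f :: "_ \<Rightarrow> complex"
    by (intro ext) (simp add: ghost_edge_op[OF that that])
  have ge0: "ghost_op e (edge_op g f) = (\<lambda>b. 0)" if "e \<in> arcs E" "g \<in> arcs E" "e \<noteq> g" for e g and f :: "_ \<Rightarrow> complex"
    by (intro ext) (simp add: ghost_edge_op[OF that(1,2)] that(3))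
  have e0: "edge_op e (\<lambda>b. 0) b = 0" for e b by (cases b) (simp add: edge_op_def)
  have sum: "rep.act (\<Sum>e\<in>out_arcs E v. ck_s e * star (ck_s e)) f b = vertex_op v f b"
    if v: "v \<in> regular_vertices E" for v
    using edge_ghost_op_sum[OF v, of f b] by (simp add: rep.act_sum rep_act_gens)
  from r show ?thesis
    unfolding ck_relators_def
    by (auto simp: rep.act_diff rep_act_gens vertex_vertex_op ge ge0 edge_vertex_op vertex_edge_op e0 sum)
qed

text \<open>
  The representation fixes the point mass over \<open>v\<close>, so its operator seminorm is at least \<open>1\<close> at
  \<open>ck_p v\<close>.
\<close>

lemma U_ck_p: "v \<in> verts E \<Longrightarrow> 1 \<le> cstar.U (ck_p v)"
proof -
  assume v: "v \<in> verts E"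
  let ?d = "\<lambda>b. if b = (v, 0, 0) then 1 else 0 :: complex"
  have s: "supp ?d = {(v, 0, 0)}" by (auto simp: supp_def)
  have d: "finite (supp ?d)" unfolding s by simp
  have n: "l2_norm ?d = 1" unfolding l2_norm_def s by simp
  have eq: "rep.act (ck_p v) ?d = ?d" by (auto simp: rep_act_gens vertex_op_def)
  have "1 \<le> rep.opnorm (ck_p v)"
    using rep.l2_norm_act_le_one[OF d, of "ck_p v"] unfolding eq n by simp
  also have "\<dots> \<le> cstar.U (ck_p v)"
    by (rule cstar.le_universal[OF rep.cstar_seminorm_opnorm[OF rep_act_relators]])
      (use v in \<open>simp_all add: FA_eq\<close>)
  finally show ?thesis .
qed

sublocale W: ck_words "Plain ` ck_gens E \<union> Starred ` ck_gens E" cstar.null E ck_p ck_s "\<lambda>e. star (ck_s e)"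
proof (intro ck_words.intro null_ck_generators ck_family.intro null_ck_relations ck_family_axioms.intro)
  show "ck_p v \<notin> cstar.null" if "v \<in> verts E" for v using U_ck_p[OF that] by (auto simp: cstar.null_def)
  show "x \<in> cstar.null" if "x \<in> FA" "\<And>v. v \<in> verts E \<Longrightarrow> ck_p v * x \<in> cstar.null" for x
    by (rule ck_generators.nondegenerate_free[OF null_ck_generators that])
qed

end

section \<open>The graph C*-algebra as a completion\<close>

context graph_cstar
begin

abbreviation (input) const :: "('v, 'e) ck_gen star_poly \<Rightarrow> nat \<Rightarrow> ('v, 'e) ck_gen star_poly" where
  "const x \<equiv> (\<lambda>n. x)"

abbreviation ceq (infix "\<simeq>" 50) where
  "f \<simeq> g \<equiv> cstar.completion.eqK f g"

lemma FA_in_C [simp]: "x \<in> FA \<Longrightarrow> const x \<in> cstar.C"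
  using cstar.C_const by (simp add: FA_eq)

lemma C_in_FA [simp]: "f \<in> cstar.C \<Longrightarrow> f n \<in> FA"
  using cstar.C_F by (simp add: FA_eq)

lemma pointwise_null: "f \<in> cstar.C \<Longrightarrow> (\<And>n. f n \<in> cstar.null) \<Longrightarrow> f \<in> cstar.cnull"
  by (simp add: cstar.cnull_def cstar.null_def)

lemma const_eq:
  assumes "W.eqK x y"
  shows "const x \<simeq> const y"
proof -
  have "x - y \<in> cstar.null" using assms by (simp only: W.eqK_def)
  then have "const (x - y) \<in> cstar.cnull" by (simp add: cstar.cnull_def cstar.null_def)
  moreover have "const x - const y = const (x - y)" by (simp add: fun_diff_def)
  ultimately show ?thesis by (simp only: cstar.completion.eqK_def)
qed

lemma const_mult: "const x * const y = const (x * y)"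
  by (simp add: times_fun_def)

lemma const_sum: "(\<Sum>i\<in>A. const (x i)) = const (\<Sum>i\<in>A. x i)"
  by (induction A rule: infinite_finite_induct) (auto simp: zero_fun_def plus_fun_def)

text \<open>
  A finite sum of vertices is again a projection.
\<close>

lemma U_vertex_sum_le:
  assumes F: "finite F" "F \<subseteq> verts E"
  shows "cstar.U (\<Sum>v\<in>F. ck_p v) \<le> 1"
proof (rule cstar.N_idempotent_le_one)
  let ?u = "\<Sum>v\<in>F. ck_p v"
  have u: "?u \<in> FA" using F by (intro free_algebra_sum ck_p_in) auto
  then show "?u \<in> cstar.F" by (simp add: FA_eq)
  have "star (ck_p v) - ck_p v \<in> cstar.null" if "v \<in> F" for v
    using that F ck_relators_null[OF cstar.N ck_relatorsI(1)] by auto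
  then have "(\<Sum>v\<in>F. star (ck_p v) - ck_p v) \<in> cstar.null" by (rule W.K_sum)
  then show "star ?u - ?u \<in> cstar.null" by (simp add: star_sum sum_subtractf)
  have "W.eqK (?u * ck_p v) (ck_p v)" if "v \<in> F" for v
    by (rule W.vertex_sum_unit[OF that F]) (use that F W.p_idem in auto)
  then have "W.eqK (\<Sum>v\<in>F. ?u * ck_p v) ?u" by (rule W.eqK_sum)
  then show "?u * ?u - ?u \<in> cstar.null" by (simp add: W.eqK_def sum_distrib_left)
qed

text \<open>
  Approximate \<open>f\<close> by one of its terms \<open>f M\<close>, and let \<open>u\<close> be a finite sum of vertices with \<open>u f M = f M\<close>.
  As \<open>u f = 0\<close>, the norm of \<open>f M\<close> is at most that of \<open>u (f M - f)\<close>, which is small because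
  \<open>\<parallel>u\<parallel> \<le> 1\<close>.
\<close>

lemma nondegenerate_completion:
  assumes f: "f \<in> cstar.C" and vf: "\<And>v. v \<in> verts E \<Longrightarrow> const (ck_p v) * f \<in> cstar.cnull"
  shows "f \<in> cstar.cnull"
proof -
  have "(\<lambda>n. cstar.U (f n)) \<longlonglongrightarrow> 0"
  proof (rule LIMSEQ_I)
    fix \<epsilon> :: real assume \<epsilon>: "0 < \<epsilon>"
    obtain M where M: "\<forall>m\<ge>M. \<forall>n\<ge>M. cstar.U (f m - f n) < \<epsilon> / 4"
      using f \<epsilon> unfolding cstar.C_iff by (meson divide_pos_pos zero_less_numeral)
    obtain F where F: "finite F" "F \<subseteq> verts E" "W.eqK ((\<Sum>v\<in>F. ck_p v) * f M) (f M)"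
      using W.local_unit[OF C_in_FA[OF f]] by blast
    let ?u = "\<Sum>v\<in>F. ck_p v"
    have u: "?u \<in> cstar.F" using F unfolding FA_eq by (intro free_algebra_sum ck_p_in) auto
    have "(\<lambda>n. \<Sum>v\<in>F. cstar.U (ck_p v * f n)) \<longlonglongrightarrow> (\<Sum>v\<in>F. 0)"
      using vf F by (intro tendsto_sum) (auto simp: cstar.cnull_def times_fun_def)
    then have "\<forall>\<^sub>F n in sequentially. (\<Sum>v\<in>F. cstar.U (ck_p v * f n)) < \<epsilon> / 4"
      using \<epsilon> by (intro order_tendstoD) auto
    then obtain M' where M': "\<And>n. n \<ge> M' \<Longrightarrow> (\<Sum>v\<in>F. cstar.U (ck_p v * f n)) < \<epsilon> / 4"
      by (auto simp: eventually_sequentially)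
    have "norm (cstar.U (f n) - 0) < \<epsilon>" if n: "n \<ge> max M M'" for n
    proof -
      have fF: "f k \<in> cstar.F" for k using f by simp
      have d: "cstar.U (f n - f M) < \<epsilon> / 4" "cstar.U (f M - f n) < \<epsilon> / 4" using M n by auto
      have "cstar.U (f n) \<le> cstar.U (f n - f M) + cstar.U (f M)"
        using cstar.N_add[of "f n - f M" "f M"] fF by simp
      also have "cstar.U (f M) = cstar.U (?u * f M)"
        using cstar.N_eq[of "?u * f M" "f M"] F(3) u fF by (simp add: W.eqK_def)
      also have "?u * f M = ?u * (f M - f n) + ?u * f n" by (simp add: algebra_simps)
      also have "cstar.U (?u * (f M - f n) + ?u * f n) \<le> cstar.U (?u * (f M - f n)) + cstar.U (?u * f n)"
        using u fF by (intro cstar.N_add) auto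
      also have "cstar.U (?u * (f M - f n)) \<le> cstar.U ?u * cstar.U (f M - f n)"
        using u fF by (intro cstar.N_mult) auto
      also have "\<dots> \<le> 1 * cstar.U (f M - f n)"
        using U_vertex_sum_le[OF F(1,2)] fF by (intro mult_right_mono) auto
      also have "cstar.U (?u * f n) \<le> (\<Sum>v\<in>F. cstar.U (ck_p v * f n))"
        unfolding sum_distrib_right using F fF FA_eq by (intro cstar.N_sum) auto
      finally have "cstar.U (f n) < \<epsilon>" using d M'[of n] n \<epsilon> by simp
      then show ?thesis using fF by simp
    qed
    then show "\<exists>M. \<forall>n\<ge>M. norm (cstar.U (f n) - 0) < \<epsilon>" by blast
  qed
  then show ?thesis using f by (simp add: cstar.cnull_def)
qed

sublocale CF: ck_family cstar.C cstar.cnull cstar.cscale E "\<lambda>v. const (ck_p v)" "\<lambda>e. const (ck_s e)"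
  "\<lambda>e. const (star (ck_s e))"
proof unfold_locales
  fix v w e f
  show "const (ck_p v) * const (ck_p w) \<simeq> (if v = w then const (ck_p v) else 0)"
    if "v \<in> verts E" "w \<in> verts E"
    using const_eq[OF W.p_mult[OF that]] by (auto simp: const_mult zero_fun_def)
  show "const (ck_p (tail E e)) * const (ck_s e) \<simeq> const (ck_s e)" if "e \<in> arcs E"
    using const_eq[OF W.tail_s[OF that]] by (simp add: const_mult)
  show "const (ck_s e) * const (ck_p (head E e)) \<simeq> const (ck_s e)" if "e \<in> arcs E"
    using const_eq[OF W.s_head[OF that]] by (simp add: const_mult)
  show "const (ck_p (head E e)) * const (star (ck_s e)) \<simeq> const (star (ck_s e))" if "e \<in> arcs E"
    using const_eq[OF W.head_t[OF that]] by (simp add: const_mult)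
  show "const (star (ck_s e)) * const (ck_p (tail E e)) \<simeq> const (star (ck_s e))" if "e \<in> arcs E"
    using const_eq[OF W.t_tail[OF that]] by (simp add: const_mult)
  show "const (star (ck_s e)) * const (ck_s f) \<simeq> (if e = f then const (ck_p (head E e)) else 0)"
    if "e \<in> arcs E" "f \<in> arcs E"
    using const_eq[OF W.t_s[OF that]] by (auto simp: const_mult zero_fun_def)
  show "const (ck_p v) \<simeq> (\<Sum>e\<in>out_arcs E v. const (ck_s e) * const (star (ck_s e)))"
    if "v \<in> regular_vertices E"
    using const_eq[OF W.ck[OF that]] by (simp add: const_mult const_sum)
  show "const (ck_p v) \<notin> cstar.cnull" if "v \<in> verts E"
    using U_ck_p[OF that] by (simp add: cstar.cnull_iff)
qed (auto intro: nondegenerate_completion)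

subsection \<open>From a splitting of the graph to a splitting of the algebra\<close>

lemma annihilator_closed:
  assumes L: "L \<subseteq> verts E"
    and f: "\<And>n. f n \<in> CF.annihilator L" and x: "x \<in> cstar.C" and lim: "(\<lambda>n. cstar.limit_norm (f n - x)) \<longlonglongrightarrow> 0"
  shows "x \<in> CF.annihilator L"
proof -
  have fC: "f n \<in> cstar.C" for n using f by (simp add: CF.annihilator_def)
  have "const (ck_p w) * (a * x) \<in> cstar.cnull" if w: "w \<in> L" and a: "a \<in> cstar.C" for w a
  proof -
    let ?p = "const (ck_p w)"
    have pC: "?p \<in> cstar.C" using w L by auto
    have le: "cstar.limit_norm (?p * (a * x)) \<le> cstar.limit_norm (?p * a) * cstar.limit_norm (f n - x)" for n
    proof -
      have z: "?p * (a * f n) \<in> cstar.cnull" using f[of n] w a by (simp add: CF.annihilator_def)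
      have eq: "?p * (a * x) = ?p * (a * f n) - (?p * a) * (f n - x)" by (simp add: algebra_simps)
      have "cstar.limit_norm (?p * (a * x)) \<le> cstar.limit_norm (?p * (a * f n)) + cstar.limit_norm ((?p * a) * (f n - x))"
        unfolding eq using pC a fC x by (intro cstar.limit_norm_diff cstar.C_mult cstar.C_diff)
      also have "cstar.limit_norm (?p * (a * f n)) = 0" using z by (simp add: cstar.cnull_iff)
      also have "cstar.limit_norm ((?p * a) * (f n - x)) \<le> cstar.limit_norm (?p * a) * cstar.limit_norm (f n - x)"
        using pC a fC x by (intro cstar.limit_norm_mult cstar.C_mult cstar.C_diff)
      finally show ?thesis by (simp only: add_0)
    qed
    have "(\<lambda>n. cstar.limit_norm (?p * a) * cstar.limit_norm (f n - x)) \<longlonglongrightarrow> 0"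
      using tendsto_mult_left[OF lim, of "cstar.limit_norm (?p * a)"] by simp
    then have "cstar.limit_norm (?p * (a * x)) \<le> 0" by (rule LIMSEQ_le_const) (use le in blast)
    moreover have C: "?p * (a * x) \<in> cstar.C" using pC a x by (intro cstar.C_mult)
    ultimately show ?thesis using cstar.limit_norm_nonneg[OF C] by (simp add: cstar.cnull_iff)
  qed
  then show ?thesis using x by (simp add: CF.annihilator_def)
qed

text \<open>
  The product \<open>d = x\<^sup>*y\<close> vanishes: it lies in \<open>J\<close>, so \<open>x d\<close> lies in \<open>I \<inter> J\<close>, and therefore
  \<open>d\<^sup>*d = y\<^sup>*x d = 0\<close>. Hence
  \<open>\<parallel>x\<parallel>\<^sup>2 = \<parallel>x\<^sup>*x\<parallel> = \<parallel>x\<^sup>*(x + y)\<parallel> \<le> \<parallel>x\<parallel> \<parallel>x + y\<parallel>\<close>.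
\<close>

lemma orthogonal_norm_le:
  assumes split: "W.ideal_splitting I J" and x: "x \<in> I" and y: "y \<in> J"
  shows "cstar.U x \<le> cstar.U (x + y)"
proof -
  have I: "W.full_ideal I" and J: "W.full_ideal J" and int: "I \<inter> J = cstar.null"
    using split by (auto simp: W.ideal_splitting_def)
  have xF: "x \<in> FA" "y \<in> FA" using W.full_idealD(2)[OF I x] W.full_idealD(2)[OF J y] by auto
  then have F: "x \<in> cstar.F" "y \<in> cstar.F" by (simp_all add: FA_eq)
  have xy: "star x * y \<in> J" using W.full_idealD(5)[OF J star_FA[OF xF(1)] y] .
  have "x * (star x * y) \<in> J" using W.full_idealD(5)[OF J xF(1) xy] .
  moreover have "x * (star x * y) \<in> I"
    using W.full_idealD(6)[OF I _ x, of "star x * y"] xF star_FA by simp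
  ultimately have "x * (star x * y) \<in> cstar.null" using int by blast
  then have "star y * (x * (star x * y)) \<in> cstar.null" by (rule W.K_left[OF star_FA[OF xF(2)]])
  moreover have "star (star x * y) * (star x * y) = star y * (x * (star x * y))"
    by (simp add: star_mult mult.assoc)
  ultimately have "(cstar.U (star x * y))\<^sup>2 = 0"
    using cstar.N_cstar[of "star x * y"] F by (simp add: cstar.null_def)
  then have z: "cstar.U (star x * y) = 0" by simp
  have "(cstar.U x)\<^sup>2 = cstar.U (star x * (x + y) - star x * y)"
    using cstar.N_cstar[OF F(1)] by (simp add: algebra_simps)
  also have "\<dots> \<le> cstar.U (star x * (x + y)) + cstar.U (star x * y)"
    using F by (intro cstar.N_diff) auto
  also have "\<dots> \<le> cstar.U x * cstar.U (x + y)"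
    using cstar.N_mult[of "star x" "x + y"] F z by simp
  finally show ?thesis
    using cstar.N_nonneg[OF F(1)] cstar.N_nonneg[of "x + y"] F
    by (cases "cstar.U x = 0") (auto simp: power2_eq_square)
qed

text \<open>
  The annihilators split each term of a Cauchy sequence, and by the norm estimate the two sequences of
  parts are Cauchy again.
\<close>

lemma splits_imp_cstar_decomposable:
  assumes "graph_splits E"
  shows "decomposable_cstar_algebra (graph_cstar_algebra E)"
proof -
  obtain H L where HL: "hereditary E H" "H \<noteq> {}" "hereditary E L" "L \<noteq> {}" "H \<inter> L = {}"
      "verts E \<subseteq> saturation E (H \<union> L)"
    using assms unfolding graph_splits_def by blast
  have sub: "H \<subseteq> verts E" "L \<subseteq> verts E" using HL by (auto simp: hereditary_def)
  note split = W.words_splitting[OF HL]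
  have ann: "a \<in> CF.annihilator M" if a: "a \<in> cstar.C" and M: "M \<subseteq> verts E"
    and pw: "\<And>n. a n \<in> W.annihilator M" for a M
  proof -
    have "const (ck_p w) * (c * a) \<in> cstar.cnull" if w: "w \<in> M" and c: "c \<in> cstar.C" for w c
    proof (rule pointwise_null)
      show "const (ck_p w) * (c * a) \<in> cstar.C" using w M c a by (intro cstar.C_mult FA_in_C ck_p_in) auto
      show "(const (ck_p w) * (c * a)) n \<in> cstar.null" for n
        using pw[of n] w c by (simp add: W.annihilator_def times_fun_def)
    qed
    then show ?thesis using a by (simp add: CF.annihilator_def)
  qed
  have C_split: "\<exists>a\<in>CF.annihilator L. \<exists>b\<in>CF.annihilator H. x = a + b" if x: "x \<in> cstar.C" for x
  proof -
    have "\<forall>n. \<exists>a b. a \<in> W.annihilator L \<and> b \<in> W.annihilator H \<and> x n = a + b"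
      using split C_in_FA[OF x] unfolding W.ideal_splitting_def by blast
    then obtain a b where ab: "\<And>n. a n \<in> W.annihilator L" "\<And>n. b n \<in> W.annihilator H"
        "\<And>n. x n = a n + b n" by metis
    have ideals: "W.full_ideal (W.annihilator L)" "W.full_ideal (W.annihilator H)"
      using split by (auto simp: W.ideal_splitting_def)
    have d: "a m - a n \<in> W.annihilator L" "b m - b n \<in> W.annihilator H" for m n
      using ab W.full_idealD(8)[OF ideals(1)] W.full_idealD(8)[OF ideals(2)] by auto
    have eq: "x m - x n = (a m - a n) + (b m - b n)" "x m - x n = (b m - b n) + (a m - a n)" for m n
      by (simp_all add: ab(3))
    have "cstar.U (a m - a n) \<le> cstar.U (x m - x n)" for m n
      unfolding eq(1) by (rule orthogonal_norm_le[OF split d])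
    moreover have "cstar.U (b m - b n) \<le> cstar.U (x m - x n)" for m n
      unfolding eq(2) by (rule orthogonal_norm_le[OF W.ideal_splitting_sym[OF split] d(2,1)])
    moreover have "a n \<in> cstar.F" "b n \<in> cstar.F" for n
      using ab W.full_idealD(2)[OF ideals(1)] W.full_idealD(2)[OF ideals(2)] by (auto simp: FA_eq)
    ultimately have "a \<in> cstar.C" "b \<in> cstar.C" using cstar.C_dominated[OF x] by blast+
    moreover have "x = a + b" using ab(3) by (auto simp: plus_fun_def)
    ultimately show ?thesis using ann sub ab by blast
  qed
  have orth: "const (ck_p v) * (a * const (ck_p w)) \<in> cstar.cnull \<and> const (ck_p w) * (a * const (ck_p v)) \<in> cstar.cnull"
    if v: "v \<in> H" and w: "w \<in> L" and a: "a \<in> cstar.C" for v w a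
  proof (intro conjI pointwise_null)
    have vw: "v \<in> verts E" "w \<in> verts E" using v w sub by auto
    then show "const (ck_p v) * (a * const (ck_p w)) \<in> cstar.C" "const (ck_p w) * (a * const (ck_p v)) \<in> cstar.C"
      using a by (auto intro!: cstar.C_mult)
    show "(const (ck_p v) * (a * const (ck_p w))) n \<in> cstar.null" for n
      using W.hereditary_orthogonal[OF HL(1,3,5) v w C_in_FA[OF a]] by (simp add: times_fun_def)
    show "(const (ck_p w) * (a * const (ck_p v))) n \<in> cstar.null" for n
      using W.hereditary_orthogonal[OF HL(3,1) _ w v C_in_FA[OF a]] HL(5) by (simp add: times_fun_def Int_commute)
  qed
  have splitC: "cstar.completion.ideal_splitting (CF.annihilator L) (CF.annihilator H)"
    by (rule CF.graph_splits_imp_splitting[OF sub(1) HL(2) sub(2) HL(4,6) orth C_split])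
  note image = cstar.completion_algebra.splitting_image[OF splitC]
  let ?cl = "\<lambda>x. cstar.completion.quotient_cong `` {x}"
  have "closed_ideal (universal_cstar_algebra ckX ckR) (?cl ` CF.annihilator M)" if "M \<subseteq> verts E" for M
    by (rule cstar.closed_ideal_image[OF CF.annihilator_ideal[OF that] annihilator_closed[OF that]])
  from this[OF sub(2)] this[OF sub(1)] image show ?thesis
    unfolding decomposable_cstar_algebra_def graph_cstar_algebra_def
    by (intro exI[of _ "?cl ` CF.annihilator L"] exI[of _ "?cl ` CF.annihilator H"] conjI)
qed

subsection \<open>The gauge action on the completion\<close>

text \<open>
  The relators are homogeneous, so the gauge action permutes the representations of the relations.
\<close>

lemma gauge_relator:
  assumes z: "z \<noteq> 0" and r: "r \<in> ckR"
  shows "gauge z r = r \<or> gauge z r = scale z r"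
proof -
  have s: "gauge z (ck_s e * star (ck_s e)) = ck_s e * star (ck_s e)"
    "gauge z (star (ck_s e) * ck_s e) = star (ck_s e) * ck_s e" for e
    using z by (simp_all add: gauge_mult scale_mult_left_eq scale_mult_right_eq scale_scale)
  have p: "gauge z (star (ck_p v)) = star (ck_p v)" for v
    by (simp add: ck_p_def star_gen) (simp add: gen_def gauge_single word_deg_def)
  have pp: "gauge z (ck_p v * x) = ck_p v * gauge z x" for v x using z by (simp add: gauge_mult)
  from r consider v where "r = star (ck_p v) - ck_p v"
    | v w where "r = ck_p v * ck_p w - (if v = w then ck_p v else 0)"
    | e where "r = ck_s e * star (ck_s e) * ck_s e - ck_s e"
    | e f where "r = (ck_s e * star (ck_s e)) * (ck_s f * star (ck_s f))"
    | e where "r = star (ck_s e) * ck_s e - ck_p (head E e)"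
    | e where "r = ck_p (tail E e) * (ck_s e * star (ck_s e)) - ck_s e * star (ck_s e)"
    | v where "r = ck_p v - (\<Sum>e\<in>out_arcs E v. ck_s e * star (ck_s e))"
    unfolding ck_relators_def by blast
  then show ?thesis
  proof cases
    case 3
    have "gauge z (ck_s e * star (ck_s e) * ck_s e) = scale z (ck_s e * star (ck_s e) * ck_s e)"
      using gauge_mult[OF z, of "ck_s e * star (ck_s e)" "ck_s e"] by (simp add: s scale_mult_right_eq)
    then have "gauge z r = scale z r" by (simp add: 3 gauge_diff scale_diff_right)
    then show ?thesis ..
  next
    case 4
    have "gauge z r = r"
      unfolding 4 using gauge_mult[OF z, of "ck_s e * star (ck_s e)" "ck_s f * star (ck_s f)"]
      by (simp only: s)
    then show ?thesis ..
  qed (simp_all add: gauge_diff gauge_sum s p pp)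
qed

text \<open>
  Composing a C*-seminorm with the gauge automorphism gives another one, which the supremum already
  takes into account.
\<close>

lemma U_gauge:
  assumes z: "cmod z = 1" and x: "x \<in> cstar.F"
  shows "cstar.U (gauge z x) \<le> cstar.U x"
proof (rule cstar.universal_least[OF _ cstar.R_sub])
  have z0: "z \<noteq> 0" using z by auto
  fix \<rho> assume \<rho>: "cstar_seminorm ckX ckR \<rho>"
  interpret N: cstar_norm ckX ckR \<rho> by (rule cstar_norm.intro[OF \<rho>])
  have "cstar_seminorm ckX ckR (\<lambda>x. \<rho> (gauge z x))"
    unfolding cstar_seminorm_def
  proof (intro conjI ballI allI)
    fix x y assume x: "x \<in> free_star_algebra ckX" and y: "y \<in> free_star_algebra ckX"
    show "\<rho> (gauge z (x + y)) \<le> \<rho> (gauge z x) + \<rho> (gauge z y)"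
      using x y by (simp add: gauge_add N.N_add)
    show "\<rho> (gauge z (x * y)) \<le> \<rho> (gauge z x) * \<rho> (gauge z y)"
      using x y by (simp add: gauge_mult[OF z0] N.N_mult)
  next
    fix c x assume x: "x \<in> free_star_algebra ckX"
    show "\<rho> (gauge z (scale c x)) = cmod c * \<rho> (gauge z x)" using x by (simp add: gauge_scale N.N_scale)
  next
    fix x assume x: "x \<in> free_star_algebra ckX"
    show "\<rho> (gauge z (star x * x)) = (\<rho> (gauge z x))\<^sup>2"
      using x N.N_cstar[of "gauge z x"] by (simp add: gauge_mult[OF z0] star_gauge[OF z])
  next
    fix r assume r: "r \<in> ckR"
    then have "r \<in> free_star_algebra ckX" using cstar.R_sub by blast
    then show "\<rho> (gauge z r) = 0"
      using gauge_relator[OF z0 r] N.N_rel[OF r] N.N_scale[of r z] by auto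
  qed
  then show "\<rho> (gauge z x) \<le> cstar.U x" by (rule cstar.le_universal[OF _ x])
qed

definition gaugeC :: "complex \<Rightarrow> (nat \<Rightarrow> ('v, 'e) ck_gen star_poly) \<Rightarrow> nat \<Rightarrow> ('v, 'e) ck_gen star_poly" where
  "gaugeC z f = (\<lambda>n. gauge z (f n))"

lemma gaugeC_closed: "cmod z = 1 \<Longrightarrow> f \<in> cstar.C \<Longrightarrow> gaugeC z f \<in> cstar.C"
  by (rule cstar.C_dominated) (auto simp: gaugeC_def U_gauge simp flip: gauge_diff)

lemma gaugeC_mult: "z \<noteq> 0 \<Longrightarrow> gaugeC z (f * g) = gaugeC z f * gaugeC z g"
  by (auto simp: gaugeC_def times_fun_def gauge_mult)

lemma gaugeC_diff: "gaugeC z (f - g) = gaugeC z f - gaugeC z g"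
  by (auto simp: gaugeC_def gauge_diff)

lemma gaugeC_p [simp]: "gaugeC z (const (ck_p v)) = const (ck_p v)"
  by (simp add: gaugeC_def)

lemma gaugeC_gaugeC: "gaugeC z (gaugeC u f) = gaugeC (z * u) f"
  by (simp add: gaugeC_def gauge_gauge)

lemma limit_norm_gaugeC: "cmod z = 1 \<Longrightarrow> f \<in> cstar.C \<Longrightarrow> cstar.limit_norm (gaugeC z f) \<le> cstar.limit_norm f"
  by (rule LIMSEQ_le[OF cstar.limit_norm_LIMSEQ[OF gaugeC_closed] cstar.limit_norm_LIMSEQ])
    (auto simp: gaugeC_def U_gauge)

lemma gaugeC_eq:
  assumes z: "cmod z = 1" and fg: "f \<simeq> g" and C: "f \<in> cstar.C" "g \<in> cstar.C"
  shows "gaugeC z f \<simeq> gaugeC z g"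
proof -
  have d: "f - g \<in> cstar.C" using C by (rule cstar.C_diff)
  have "cstar.limit_norm (gaugeC z (f - g)) \<le> 0"
    using limit_norm_gaugeC[OF z d] fg by (simp add: cstar.completion.eqK_def cstar.cnull_iff)
  then have "cstar.limit_norm (gaugeC z (f - g)) = 0"
    using cstar.limit_norm_nonneg[OF gaugeC_closed[OF z d]] by linarith
  then have "gaugeC z (f - g) \<in> cstar.cnull" using gaugeC_closed[OF z d] by (simp add: cstar.cnull_iff)
  then show ?thesis by (simp only: cstar.completion.eqK_def gaugeC_diff)
qed

definition loop_deg :: "bool \<times> 'e list \<Rightarrow> int" where
  "loop_deg i = (if fst i then int (length (snd i)) else - int (length (snd i)))"

lemma gauge_walk:
  assumes z: "z \<noteq> 0"
  shows "gauge z (W.walk_s \<alpha> u) = scale (z ^ length \<alpha>) (W.walk_s \<alpha> u)"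
    and "gauge z (W.walk_t \<alpha> u) = scale (inverse z ^ length \<alpha>) (W.walk_t \<alpha> u)"
  by (induction \<alpha>)
    (simp_all add: gauge_mult[OF z] scale_mult_left_eq scale_mult_right_eq scale_scale mult.commute)

lemma gauge_loop: "z \<noteq> 0 \<Longrightarrow> gauge z (W.loop w i) = scale (z powi loop_deg i) (W.loop w i)"
  by (auto simp: W.loop_def loop_deg_def gauge_walk power_int_minus power_inverse)

lemma U_walk:
  "awalk v \<alpha> u \<Longrightarrow> cstar.U (W.walk_s \<alpha> u) \<le> 1 \<and> cstar.U (W.walk_t \<alpha> u) \<le> 1"
proof (induction \<alpha> arbitrary: v)
  case Nil
  then have "u \<in> verts E" by (auto simp: awalk_Nil_iff)
  then show ?case using U_vertex_sum_le[of "{u}"] by simp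
next
  case (Cons e \<alpha>)
  then have e: "e \<in> arcs E" and aw: "awalk (head E e) \<alpha> u" by (auto simp: awalk_Cons_iff)
  have F: "ck_s e \<in> cstar.F" "W.walk_s \<alpha> u \<in> cstar.F" "W.walk_t \<alpha> u \<in> cstar.F"
    using W.walk_in[OF aw] e by (simp_all add: FA_eq)
  have "CK_Iso e \<in> ckX" using e by (simp add: ck_gens_def)
  then have s: "cstar.U (ck_s e) \<le> 1" using cstar.generators_bounded[OF cstar.N, of "CK_Iso e"] by (simp add: ck_s_def)
  have "cstar.U (ck_s e * W.walk_s \<alpha> u) \<le> cstar.U (ck_s e) * cstar.U (W.walk_s \<alpha> u)"
    using F by (intro cstar.N_mult)
  also have "\<dots> \<le> 1 * 1" using s Cons.IH[OF aw] F by (intro mult_mono) auto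
  finally have 1: "cstar.U (ck_s e * W.walk_s \<alpha> u) \<le> 1" by simp
  have "cstar.U (W.walk_t \<alpha> u * star (ck_s e)) \<le> cstar.U (W.walk_t \<alpha> u) * cstar.U (star (ck_s e))"
    using F by (intro cstar.N_mult) auto
  also have "\<dots> \<le> 1 * 1" using s Cons.IH[OF aw] F by (intro mult_mono) auto
  finally show ?case using 1 by simp
qed

lemma CF_walk: "CF.walk_s \<alpha> u = const (W.walk_s \<alpha> u)" "CF.walk_t \<alpha> u = const (W.walk_t \<alpha> u)"
  by (induction \<alpha>) (simp_all add: const_mult)

text \<open>
  Since \<open>\<parallel>d\<parallel> \<le> \<parallel>d\<parallel>\<^sup>2\<close>, the norm of an idempotent is \<open>0\<close> or at least \<open>1\<close>.
\<close>

lemma idempotent_small: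
  assumes d: "d \<in> cstar.C" "d * d \<simeq> d" "cstar.limit_norm d < 1"
  shows "d \<in> cstar.cnull"
proof -
  have "cstar.limit_norm d = cstar.limit_norm (d * d)" using cstar.limit_norm_eqK[OF d(2)] d(1) cstar.C_mult by simp
  also have "\<dots> \<le> cstar.limit_norm d * cstar.limit_norm d" using d(1) by (intro cstar.limit_norm_mult)
  finally have le: "cstar.limit_norm d \<le> cstar.limit_norm d * cstar.limit_norm d" .
  have "cstar.limit_norm d = 0"
  proof (rule ccontr)
    assume "cstar.limit_norm d \<noteq> 0"
    then have "cstar.limit_norm d > 0" using cstar.limit_norm_nonneg[OF d(1)] by linarith
    then show False using mult_strict_left_mono[OF d(3), of "cstar.limit_norm d"] le by simp
  qed
  then show ?thesis using d by (simp add: cstar.cnull_iff)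
qed

text \<open>
  For commuting idempotents, \<open>d = a - b\<close> satisfies \<open>d\<^sup>3 = d\<close>, so that \<open>d\<^sup>2\<close> is an idempotent of norm
  less than \<open>1\<close>.
\<close>

lemma commuting_idempotents_close:
  assumes a: "a \<in> cstar.C" "a * a \<simeq> a" and b: "b \<in> cstar.C" "b * b \<simeq> b"
    and ab: "a * b \<simeq> b * a" and close: "cstar.limit_norm (a - b) < 1"
  shows "a \<simeq> b"
proof -
  let ?d = "a - b"
  note C = cstar.C_mult cstar.C_diff cstar.C_add
  note Qdiff = cstar.completion.eqK_diff and Qadd = cstar.completion.eqK_add
    and Qrefl = cstar.completion.eqK_refl and Qsym = cstar.completion.eqK_sym
    and Qtrans = cstar.completion.eqK_trans and Qleft = cstar.completion.eqK_left
    and Qright = cstar.completion.eqK_right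
  have d: "?d \<in> cstar.C" using a b by (intro C)
  \<comment> \<open>The square of the difference is \<open>a + b - 2ab\<close>; multiplying by \<open>a - b\<close> once more gives \<open>a - b\<close>.\<close>
  have "?d * ?d = (a * a + b * b) - (a * b + b * a)" by (simp add: algebra_simps)
  then have dd: "?d * ?d \<simeq> (a + b) - (a * b + a * b)"
    using Qdiff[OF Qadd[OF a(2) b(2)] Qadd[OF Qrefl Qsym[OF ab]]] by simp
  have aab: "a * (a * b) \<simeq> a * b" using Qright[OF a(2) b(1)] by (simp add: mult.assoc)
  have abb: "a * b * b \<simeq> a * b" using Qleft[OF b(2) a(1)] by (simp add: mult.assoc)
  have "b * a * b \<simeq> a * b"
    by (rule Qtrans[OF Qright[OF Qsym[OF ab] b(1)] abb])
  then have aba: "b * (a * b) \<simeq> a * b" by (simp add: mult.assoc)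
  have eq: "?d * ((a + b) - (a * b + a * b)) = (a * a + a * b - (a * (a * b) + a * (a * b))) -
      (b * a + b * b - (b * (a * b) + b * (a * b)))"
    by (simp add: algebra_simps)
  have "?d * ((a + b) - (a * b + a * b)) \<simeq>
      (a + a * b - (a * b + a * b)) - (a * b + b - (a * b + a * b))"
    unfolding eq
    by (rule Qdiff[OF Qdiff[OF Qadd[OF a(2) Qrefl] Qadd[OF aab aab]]
          Qdiff[OF Qadd[OF Qsym[OF ab] b(2)] Qadd[OF aba aba]]])
  then have "?d * ((a + b) - (a * b + a * b)) \<simeq> ?d" by simp
  then have ddd: "?d * (?d * ?d) \<simeq> ?d" by (rule Qtrans[OF Qleft[OF dd d]])
  have idem: "(?d * ?d) * (?d * ?d) \<simeq> ?d * ?d"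
    using cstar.completion.eqK_left[OF ddd d] by (simp add: mult.assoc)
  have "cstar.limit_norm (?d * ?d) \<le> cstar.limit_norm ?d * cstar.limit_norm ?d" by (rule cstar.limit_norm_mult[OF d d])
  also have "\<dots> \<le> cstar.limit_norm ?d * 1" using close cstar.limit_norm_nonneg[OF d] by (intro mult_left_mono) auto
  also have "\<dots> < 1" using close by simp
  finally have "?d * ?d \<in> cstar.cnull" using idem d C by (intro idempotent_small) auto
  then have "?d * (?d * ?d) \<in> cstar.cnull" by (rule cstar.completion.K_left[OF d])
  then show ?thesis using cstar.completion.eqK_in_K[OF ddd] by (simp add: cstar.completion.eqK_def)
qed

text \<open>
  A root of unity close enough to \<open>1\<close> to move a given finite combination only a little, and of order large
  enough to tell all its nonzero degrees from \<open>0\<close>.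
\<close>

lemma root_of_unity_close:
  fixes c :: "'i \<Rightarrow> complex" and d :: "'i \<Rightarrow> int"
  assumes D: "finite D" and \<epsilon>: "\<epsilon> > 0"
  shows "\<exists>M > 0. (\<forall>i\<in>D. \<bar>d i\<bar> < int M) \<and>
    (\<Sum>i\<in>D. cmod (c i) * cmod (1 - cis (2 * pi / real M) powi d i)) < \<epsilon>"
proof -
  have "(\<lambda>M. cis (2 * pi / real M)) \<longlonglongrightarrow> cis 0"
    by (intro tendsto_cis real_tendsto_divide_at_top[OF tendsto_const] filterlim_real_sequentially)
  then have "(\<lambda>M. \<Sum>i\<in>D. cmod (c i) * cmod (1 - cis (2 * pi / real M) powi d i)) \<longlonglongrightarrow>
      (\<Sum>i\<in>D. cmod (c i) * cmod (1 - 1 powi d i))"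
    by (intro tendsto_intros) auto
  then have 1: "\<forall>\<^sub>F M in sequentially. (\<Sum>i\<in>D. cmod (c i) * cmod (1 - cis (2 * pi / real M) powi d i)) < \<epsilon>"
    using \<epsilon> by (intro order_tendstoD) auto
  have 2: "\<forall>\<^sub>F M in sequentially. \<forall>i\<in>D. nat \<bar>d i\<bar> < M"
    using D by (intro eventually_ball_finite ballI eventually_gt_at_top)
  obtain M where "(\<Sum>i\<in>D. cmod (c i) * cmod (1 - cis (2 * pi / real M) powi d i)) < \<epsilon>"
      "\<forall>i\<in>D. nat \<bar>d i\<bar> < M" "M > 0"
    using eventually_happens[OF eventually_conj[OF 1 eventually_conj[OF 2 eventually_gt_at_top[of 0]]]] by auto
  then show ?thesis by (intro exI[of _ M]) auto
qed

lemma root_of_unity_sum: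
  assumes M: "M > 0" and d: "\<bar>d\<bar> < int M"
  shows "(\<Sum>j<M. (cis (2 * pi / real M) ^ j) powi d) = (if d = 0 then of_nat M else 0)"
proof -
  let ?z = "cis (2 * pi / real M)"
  let ?w = "?z powi d"
  have eq: "(?z ^ j) powi d = ?w ^ j" for j
    by (metis power_int_mult power_int_of_nat mult.commute)
  have z: "?z ^ M = 1" using M by (simp add: DeMoivre)
  have w1: "?w ^ M = 1" by (metis eq z power_int_1_left)
  show ?thesis
  proof (cases "d = 0")
    case False
    have "?w \<noteq> 1"
    proof
      assume "?w = 1"
      then have "cis (of_int d * (2 * pi / real M)) = 1" by (simp add: cis_power_int)
      then have "cos (of_int d * (2 * pi / real M)) = 1" by (metis cis.simps(1) one_complex.simps(1))
      then obtain n :: int where "of_int d * (2 * pi / real M) = of_int n * 2 * pi"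
        unfolding cos_one_2pi_int by auto
      then have "of_int d = real_of_int (n * int M)" using M by (simp add: field_simps)
      then have "d = n * int M" by linarith
      then have "n \<noteq> 0" "\<bar>d\<bar> = \<bar>n\<bar> * int M" using False by (auto simp: abs_mult)
      then have "int M \<le> \<bar>d\<bar>" using M mult_right_mono[of 1 "\<bar>n\<bar>" "int M"] by simp
      then show False using d by simp
    qed
    then have "(\<Sum>j<M. ?w ^ j) = 0" using geometric_sum[of ?w M] w1 by simp
    then show ?thesis using False eq by simp
  qed (simp add: M)
qed

text \<open>
  The hypothesis \<open>comm\<close> says that \<open>b\<close> is central in the corner at \<open>w\<close>, as components of \<open>p\<^sub>w\<close> are.
  The combination \<open>x\<close> of closed walks is within \<open>1/16\<close> of \<open>b\<close>. For a root of unity \<open>z\<close> close to \<open>1\<close> the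
  idempotents \<open>b\<close> and \<open>\<gamma>\<^sub>z(b)\<close> are at distance at most \<open>3/16\<close>; they commute, so they are equal. Averaging
  \<open>\<gamma>\<^sub>z\<^sup>j(x)\<close> over all powers keeps the distance to \<open>b\<close> and leaves a multiple \<open>r p\<^sub>w\<close>. Put
  \<open>h = b - r p\<^sub>w\<close>. From \<open>b h = (1 - r) b\<close> it follows that \<open>b = 0\<close> or \<open>\<bar>1 - r\<bar> \<le> 1/16\<close>, and in the latter
  case \<open>p\<^sub>w - b\<close> is an idempotent of norm at most \<open>1/8\<close>.
\<close>

lemma loop_idempotent_close:
  assumes w: "w \<in> verts E" and b: "b \<in> cstar.C" "b * b \<simeq> b" "b * const (ck_p w) \<simeq> b"
    "const (ck_p w) * b \<simeq> b"
    and comm: "\<And>c. c \<in> cstar.C \<Longrightarrow> const (ck_p w) * c \<simeq> c \<Longrightarrow> c * const (ck_p w) \<simeq> c \<Longrightarrow> b * c \<simeq> c * b"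
    and y: "y \<in> FA" "y \<in> W.kspan (W.loops w)" "cstar.limit_norm (b - const y) \<le> 1 / 16"
  shows "b \<in> cstar.cnull \<or> const (ck_p w) \<simeq> b"
proof -
  note C = cstar.C_mult cstar.C_diff cstar.C_add
  let ?P = "const (ck_p w)"
  have P: "?P \<in> cstar.C" using w by simp
  obtain D c where D: "finite D" "\<forall>i\<in>D. awalk w (snd i) w"
      "W.eqK y (\<Sum>i\<in>D. scale (c i) (W.loop w i))"
    using W.loops_combination[OF y(2)] by blast
  \<comment> \<open>Replace \<open>y\<close> by the congruent \<open>x\<close>, on which the gauge action is explicit.\<close>
  define x where "x = (\<Sum>i\<in>D. scale (c i) (W.loop w i))"
  have loopF: "W.loop w i \<in> FA" if "i \<in> D" for i using W.loop_in D(2) that by blast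
  have x: "x \<in> FA" unfolding x_def using loopF by (intro free_algebra_sum free_algebra_scale)
  have loopU: "cstar.U (W.loop w i) \<le> 1" if "i \<in> D" for i
    using U_walk D(2) that by (auto simp: W.loop_def)
  have bx: "cstar.limit_norm (b - const x) \<le> 1 / 16"
  proof -
    have "b - const y \<simeq> b - const x"
      unfolding x_def by (rule cstar.completion.eqK_diff[OF cstar.completion.eqK_refl const_eq[OF D(3)]])
    then have "cstar.limit_norm (b - const y) = cstar.limit_norm (b - const x)"
      using b x y by (intro cstar.limit_norm_eqK C) auto
    then show ?thesis using y(3) by simp
  qed
  obtain M where M: "M > 0" "\<forall>i\<in>D. \<bar>loop_deg i\<bar> < int M"
      "(\<Sum>i\<in>D. cmod (c i) * cmod (1 - cis (2 * pi / real M) powi loop_deg i)) < 1 / 16"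
    using root_of_unity_close[OF D(1), of "1 / 16" loop_deg c] by auto
  define z where "z = cis (2 * pi / real M)"
  have z: "cmod z = 1" "z \<noteq> 0" by (simp_all add: z_def)
  have gx: "gauge u x = (\<Sum>i\<in>D. scale (c i * u powi loop_deg i) (W.loop w i))" if "u \<noteq> 0" for u
    unfolding x_def gauge_sum by (rule sum.cong[OF HOL.refl]) (simp add: gauge_scale gauge_loop[OF that] scale_scale)
  have xgx: "cstar.U (x - gauge z x) \<le> 1 / 16"
  proof -
    have "x - gauge z x = (\<Sum>i\<in>D. scale (c i * (1 - z powi loop_deg i)) (W.loop w i))"
      by (subst gx[OF z(2)]) (simp add: x_def right_diff_distrib scale_diff_left sum_subtractf)
    also have "cstar.U \<dots> \<le> (\<Sum>i\<in>D. cstar.U (scale (c i * (1 - z powi loop_deg i)) (W.loop w i)))"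
      using loopF by (intro cstar.N_sum) (simp add: FA_eq)
    also have "\<dots> \<le> (\<Sum>i\<in>D. cmod (c i) * cmod (1 - z powi loop_deg i))"
    proof (rule sum_mono)
      fix i assume i: "i \<in> D"
      have "cstar.U (scale (c i * (1 - z powi loop_deg i)) (W.loop w i)) =
          cmod (c i * (1 - z powi loop_deg i)) * cstar.U (W.loop w i)"
        using loopF[OF i] by (intro cstar.N_scale) (simp add: FA_eq)
      also have "\<dots> \<le> cmod (c i * (1 - z powi loop_deg i)) * 1"
        using loopU[OF i] by (intro mult_left_mono) auto
      finally show "cstar.U (scale (c i * (1 - z powi loop_deg i)) (W.loop w i)) \<le>
          cmod (c i) * cmod (1 - z powi loop_deg i)" by (simp add: norm_mult)
    qed
    finally show ?thesis using M(3) unfolding z_def by linarith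
  qed
  let ?q = "gaugeC z b"
  have q: "?q \<in> cstar.C" using gaugeC_closed[OF z(1) b(1)] .
  have qq: "?q * ?q \<simeq> ?q"
    using gaugeC_eq[OF z(1) b(2)] b(1) C by (simp add: gaugeC_mult[OF z(2)])
  have Pq: "?P * ?q \<simeq> ?q"
    using gaugeC_eq[OF z(1) b(4)] b(1) P C by (simp add: gaugeC_mult[OF z(2)])
  have qP: "?q * ?P \<simeq> ?q"
    using gaugeC_eq[OF z(1) b(3)] b(1) P C by (simp add: gaugeC_mult[OF z(2)])
  have gxC: "const (gauge u x) \<in> cstar.C" for u
    using gauge_closed[of x ckX] x by (intro cstar.C_const) (simp add: FA_eq)
  have "cstar.limit_norm (b - ?q) \<le> 3 / 16"
  proof -
    have eq: "b - ?q = ((b - const x) + const (x - gauge z x)) - gaugeC z (b - const x)"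
      unfolding gaugeC_diff by (simp add: gaugeC_def fun_eq_iff)
    have xg: "const (x - gauge z x) \<in> cstar.C"
      using x gauge_closed[of x ckX] by (intro cstar.C_const cstar.F_closed) (auto simp: FA_eq)
    have bxC: "b - const x \<in> cstar.C" using b x by (intro C) auto
    have "cstar.limit_norm (b - ?q) \<le> cstar.limit_norm ((b - const x) + const (x - gauge z x)) + cstar.limit_norm (gaugeC z (b - const x))"
      unfolding eq by (intro cstar.limit_norm_diff cstar.C_add xg bxC gaugeC_closed[OF z(1)])
    also have "cstar.limit_norm ((b - const x) + const (x - gauge z x)) \<le> cstar.limit_norm (b - const x) + cstar.limit_norm (const (x - gauge z x))"
      using xg bxC by (intro cstar.limit_norm_add)
    finally show ?thesis using bx xgx limit_norm_gaugeC[OF z(1) bxC] unfolding cstar.limit_norm_const by linarith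
  qed
  then have "cstar.limit_norm (b - ?q) < 1" by linarith
  then have bq: "b \<simeq> ?q"
    by (rule commuting_idempotents_close[OF b(1,2) q qq comm[OF q Pq qP]])
  have inv: "b \<simeq> gaugeC (z ^ j) b" for j
  proof (induction j)
    case 0
    then show ?case by (simp add: gaugeC_def)
  next
    case (Suc j)
    have zj: "cmod (z ^ j) = 1" using z by (simp add: norm_power)
    from cstar.completion.eqK_trans[OF bq gaugeC_eq[OF z(1) Suc.IH b(1) gaugeC_closed[OF zj b(1)]]]
    show ?case by (simp add: gaugeC_gaugeC)
  qed
  have bgx: "cstar.limit_norm (b - const (gauge (z ^ j) x)) \<le> 1 / 16" for j
  proof -
    have zj: "cmod (z ^ j) = 1" using z by (simp add: norm_power)
    have bxC: "b - const x \<in> cstar.C" using b x by (intro C) auto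
    have "b - const (gauge (z ^ j) x) \<simeq> gaugeC (z ^ j) b - const (gauge (z ^ j) x)"
      by (rule cstar.completion.eqK_diff[OF inv cstar.completion.eqK_refl])
    then have "cstar.limit_norm (b - const (gauge (z ^ j) x)) = cstar.limit_norm (gaugeC (z ^ j) b - const (gauge (z ^ j) x))"
      using b gxC gaugeC_closed[OF zj b(1)] by (intro cstar.limit_norm_eqK C) auto
    also have "gaugeC (z ^ j) b - const (gauge (z ^ j) x) = gaugeC (z ^ j) (b - const x)"
      unfolding gaugeC_diff by (simp add: gaugeC_def)
    also have "cstar.limit_norm \<dots> \<le> cstar.limit_norm (b - const x)" by (rule limit_norm_gaugeC[OF zj bxC])
    finally show ?thesis using bx by linarith
  qed
  \<comment> \<open>Degree \<open>0\<close> means the empty walk, in either direction; both stand for \<open>p\<^sub>w\<close>.\<close>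
  define r where "r = (\<Sum>i\<in>{i \<in> D. loop_deg i = 0}. c i)"
  have avg: "(\<Sum>j<M. gauge (z ^ j) x) = scale (of_nat M * r) (ck_p w)"
  proof -
    have "(\<Sum>j<M. gauge (z ^ j) x) = (\<Sum>j<M. \<Sum>i\<in>D. scale (c i * (z ^ j) powi loop_deg i) (W.loop w i))"
      using z(2) by (intro sum.cong gx) auto
    also have "\<dots> = (\<Sum>i\<in>D. \<Sum>j<M. scale (c i * (z ^ j) powi loop_deg i) (W.loop w i))" by (rule sum.swap)
    also have "\<dots> = (\<Sum>i\<in>D. scale (c i * (\<Sum>j<M. (z ^ j) powi loop_deg i)) (W.loop w i))"
      by (intro sum.cong HOL.refl) (simp add: sum_distrib_left scale_sum_coeffs)
    also have "\<dots> = (\<Sum>i\<in>D. if loop_deg i = 0 then scale (c i * of_nat M) (ck_p w) else 0)"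
    proof (intro sum.cong HOL.refl)
      fix i assume i: "i \<in> D"
      have "(\<Sum>j<M. (z ^ j) powi loop_deg i) = (if loop_deg i = 0 then of_nat M else 0)"
        unfolding z_def using M i by (intro root_of_unity_sum) auto
      moreover have "W.loop w i = ck_p w" if "loop_deg i = 0"
        using that by (auto simp: loop_deg_def W.loop_def split: if_splits)
      ultimately show "scale (c i * (\<Sum>j<M. (z ^ j) powi loop_deg i)) (W.loop w i) =
          (if loop_deg i = 0 then scale (c i * of_nat M) (ck_p w) else 0)" by simp
    qed
    also have "\<dots> = (\<Sum>i\<in>{i \<in> D. loop_deg i = 0}. scale (c i * of_nat M) (ck_p w))"
      using D(1) by (simp add: sum.inter_filter)
    also have "\<dots> = scale (\<Sum>i\<in>{i \<in> D. loop_deg i = 0}. c i * of_nat M) (ck_p w)"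
      by (simp only: scale_sum_coeffs)
    finally show ?thesis by (simp add: r_def sum_distrib_left mult.commute)
  qed
  define h where "h = b - cstar.cscale r ?P"
  have h: "h \<in> cstar.C" unfolding h_def using b P by (intro C cstar.C_scale)
  have nh: "cstar.limit_norm h \<le> 1 / 16"
  proof -
    have sum_le: "cstar.limit_norm (\<Sum>j<m. g j) \<le> real m / 16 \<and> (\<Sum>j<m. g j) \<in> cstar.C"
      if g: "\<And>j. g j \<in> cstar.C" "\<And>j. cstar.limit_norm (g j) \<le> 1 / 16" for g :: "nat \<Rightarrow> _" and m
    proof (induction m)
      case (Suc m)
      have "cstar.limit_norm ((\<Sum>j<m. g j) + g m) \<le> cstar.limit_norm (\<Sum>j<m. g j) + cstar.limit_norm (g m)"
        using Suc.IH g(1) by (intro cstar.limit_norm_add) auto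
      also have "\<dots> \<le> real m / 16 + 1 / 16" using Suc.IH g(2) by (intro add_mono) auto
      finally have le: "cstar.limit_norm ((\<Sum>j<m. g j) + g m) \<le> real (Suc m) / 16"
        by (simp only: of_nat_Suc add_divide_distrib add.commute)
      have "(\<Sum>j<m. g j) + g m \<in> cstar.C" using conjunct2[OF Suc.IH] g(1) by (rule C(3))
      with le show ?case unfolding sum.lessThan_Suc by (rule conjI)
    qed simp
    have "b - const (gauge (z ^ j) x) \<in> cstar.C" for j using b(1) gxC by (rule C(2))
    note fin = sum_le[of "\<lambda>j. b - const (gauge (z ^ j) x)", OF this bgx]
    have eq: "(\<Sum>j<M. b - const (gauge (z ^ j) x)) = cstar.cscale (of_nat M) h"
    proof -
      have "(\<Sum>j<M. b - const (gauge (z ^ j) x)) = (\<Sum>j<M. b) - const (\<Sum>j<M. gauge (z ^ j) x)"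
        by (simp only: sum_subtractf const_sum)
      also have "(\<Sum>j<M. b) = cstar.cscale (of_nat M) b"
      proof -
        have "(\<Sum>j<m. b) = cstar.cscale (of_nat m) b" for m
        proof (induction m)
          case 0
          show ?case by (simp add: cstar.cscale_def zero_fun_def)
        next
          case (Suc m)
          show ?case
            unfolding sum.lessThan_Suc Suc.IH
            by (simp add: cstar.cscale_def plus_fun_def scale_add_left add.commute)
        qed
        then show ?thesis by blast
      qed
      finally have sum: "(\<Sum>j<M. b - const (gauge (z ^ j) x)) =
          cstar.cscale (of_nat M) b - const (\<Sum>j<M. gauge (z ^ j) x)" .
      have const: "const (scale (of_nat M * r) (ck_p w)) = cstar.cscale (of_nat M) (cstar.cscale r ?P)"
        by (simp only: cstar.cscale_def scale_scale)
      show ?thesis by (simp only: sum avg h_def cstar.cscale_diff const)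
    qed
    have "cstar.limit_norm (cstar.cscale (of_nat M) h) \<le> real M / 16"
      using conjunct1[OF fin[of M]] unfolding eq .
    then have "real M * cstar.limit_norm h \<le> real M / 16" using h by (simp add: cstar.limit_norm_scale)
    then show ?thesis using M(1) by (simp add: field_simps)
  qed
  have bh_eq: "b * h = b * b - cstar.cscale r (b * ?P)"
    by (simp add: h_def right_diff_distrib cstar.cscale_mult_right)
  have "b * h \<simeq> b - cstar.cscale r b"
    unfolding bh_eq
    by (rule cstar.completion.eqK_diff[OF b(2) cstar.completion.eqK_scale[OF b(3)]])
  moreover have "b - cstar.cscale r b = cstar.cscale (1 - r) b"
    by (auto simp: cstar.cscale_def scale_diff_left)
  ultimately have bh: "b * h \<simeq> cstar.cscale (1 - r) b" by simp
  have "cmod (1 - r) * cstar.limit_norm b = cstar.limit_norm (b * h)"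
    using cstar.limit_norm_eqK[OF bh] b h C cstar.C_scale by (simp add: cstar.limit_norm_scale)
  also have "\<dots> \<le> cstar.limit_norm b * cstar.limit_norm h" using b h by (intro cstar.limit_norm_mult)
  also have "\<dots> \<le> cstar.limit_norm b * (1 / 16)" using nh b by (intro mult_left_mono) auto
  finally have le: "cmod (1 - r) * cstar.limit_norm b \<le> cstar.limit_norm b * (1 / 16)" .
  show ?thesis
  proof (cases "cstar.limit_norm b = 0")
    case True
    then show ?thesis using b by (simp add: cstar.cnull_iff)
  next
    case False
    then have "cstar.limit_norm b > 0" using cstar.limit_norm_nonneg[OF b(1)] by linarith
    then have r1: "cmod (1 - r) \<le> 1 / 16" using le by (simp add: mult.commute)
    have d: "?P - b \<in> cstar.C" using P b by (intro C)
    have eq: "(?P - b) * (?P - b) = (?P * ?P - ?P * b) - (b * ?P - b * b)" by (simp add: algebra_simps)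
    have "(?P - b) * (?P - b) \<simeq> (?P - b) - (b - b)"
      unfolding eq
      by (rule cstar.completion.eqK_diff[OF cstar.completion.eqK_diff[OF CF.p_idem[OF w] b(4)]
            cstar.completion.eqK_diff[OF b(3) b(2)]])
    then have idem: "(?P - b) * (?P - b) \<simeq> ?P - b" by simp
    have "?P - b = cstar.cscale (1 - r) ?P - h"
      by (auto simp: h_def cstar.cscale_def scale_diff_left fun_eq_iff)
    then have "cstar.limit_norm (?P - b) \<le> cstar.limit_norm (cstar.cscale (1 - r) ?P) + cstar.limit_norm h"
      using cstar.limit_norm_diff[OF cstar.C_scale[OF P] h] by simp
    also have "cstar.limit_norm (cstar.cscale (1 - r) ?P) \<le> 1 / 16 * 1"
      using r1 cstar.limit_norm_nonneg[OF P] U_vertex_sum_le[of "{w}"] w unfolding cstar.limit_norm_scale[OF P]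
      by (intro mult_mono) auto
    finally have "cstar.limit_norm (?P - b) < 1" using nh by simp
    then have "?P - b \<in> cstar.cnull" using idempotent_small[OF d idem] by simp
    then show ?thesis by (simp add: cstar.completion.eqK_def)
  qed
qed

text \<open>
  The component \<open>a\<close> of a vertex is a limit of elements \<open>x\<close> of the free *-algebra. Compressing by walks is
  contractive, so one \<open>x\<close> close to \<open>a\<close> serves for all walks from \<open>v\<close> at once, and the required length
  depends only on \<open>x\<close>.
\<close>

lemma cstar_decomposable_imp_splits:
  assumes "decomposable_cstar_algebra (graph_cstar_algebra E)"
  shows "graph_splits E"
proof -
  obtain I J where "two_sided_ideal (universal_cstar_algebra ckX ckR) I" "I \<noteq> {alg_zero (universal_cstar_algebra ckX ckR)}"
      "two_sided_ideal (universal_cstar_algebra ckX ckR) J" "J \<noteq> {alg_zero (universal_cstar_algebra ckX ckR)}"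
      "direct_sum_of (universal_cstar_algebra ckX ckR) I J"
    using assms unfolding decomposable_cstar_algebra_def graph_cstar_algebra_def closed_ideal_def
    by (elim exE conjE) (rule that)
  from cstar.completion_algebra.splitting_preim[OF this]
  obtain I J where IJ: "cstar.completion.ideal_splitting I J" by blast
  show ?thesis
  proof (rule CF.splitting_imp_graph_splits[OF IJ])
    fix v assume v: "v \<in> verts E"
    let ?P = "\<lambda>v. const (ck_p v)"
    obtain a where a: "CF.ideal_part I J (?P v) a" using CF.part_ex[OF IJ] v by fastforce
    have aC: "a \<in> cstar.C" by (rule CF.part_in_S[OF IJ a])
    obtain k where k: "\<forall>m\<ge>k. \<forall>n\<ge>k. cstar.U (a m - a n) < 1 / 16"
      using aC unfolding cstar.C_iff by (meson divide_pos_pos zero_less_one zero_less_numeral)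
    define x where "x = a k"
    have x: "x \<in> FA" using aC by (simp add: x_def)
    have axC: "a - const x \<in> cstar.C" using aC x by (intro cstar.C_diff) auto
    have ax: "cstar.limit_norm (a - const x) \<le> 1 / 16"
      by (rule LIMSEQ_le_const2[OF cstar.limit_norm_LIMSEQ[OF axC]])
        (use k in \<open>auto simp: x_def intro!: exI[of _ k] less_imp_le\<close>)
    obtain n where n0: "out_arcs E v = {} \<longrightarrow> n = 0" and
        n: "\<forall>\<gamma> w. awalk v \<gamma> w \<and> length \<gamma> = n \<longrightarrow> W.walk_t \<gamma> w * x * W.walk_s \<gamma> w \<in> W.kspan (W.loops w)"
      using W.compress[OF x v] by (elim exE conjE)
    have "?P w \<in> I \<or> ?P w \<in> J" if \<gamma>: "awalk v \<gamma> w \<and> length \<gamma> = n" for \<gamma> w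
    proof -
      have aw: "awalk v \<gamma> w" using \<gamma> by simp
      have w: "w \<in> verts E" using W.awalk_verts_ends[OF aw] by simp
      obtain b where b: "CF.ideal_part I J (?P w) b" using CF.part_ex[OF IJ] w by fastforce
      have bC: "b \<in> cstar.C" by (rule CF.part_in_S[OF IJ b])
      let ?T = "const (W.walk_t \<gamma> w)" and ?S = "const (W.walk_s \<gamma> w)"
      let ?y = "W.walk_t \<gamma> w * x * W.walk_s \<gamma> w"
      have TS: "?T \<in> cstar.C" "?S \<in> cstar.C" using W.walk_in[OF aw] by simp_all
      have y: "?y \<in> FA" using W.walk_in[OF aw] x by simp
      have tr: "?T * a * ?S \<simeq> b" using CF.part_transport[OF IJ aw a b] by (simp add: CF_walk)
      have "cstar.limit_norm (b - const ?y) = cstar.limit_norm (?T * a * ?S - const ?y)"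
        using TS aC bC y
        by (intro cstar.limit_norm_eqK[OF cstar.completion.eqK_diff[OF cstar.completion.eqK_sym[OF tr]
                cstar.completion.eqK_refl]] cstar.C_diff cstar.C_mult) auto
      also have "?T * a * ?S - const ?y = ?T * (a - const x) * ?S"
        by (auto simp: times_fun_def fun_eq_iff algebra_simps)
      also have "cstar.limit_norm \<dots> \<le> cstar.limit_norm (?T * (a - const x)) * cstar.limit_norm ?S"
        using TS axC by (intro cstar.limit_norm_mult cstar.C_mult)
      also have "\<dots> \<le> cstar.limit_norm (?T * (a - const x)) * 1"
        using U_walk[OF aw] TS axC by (intro mult_left_mono) (auto intro: cstar.C_mult)
      also have "cstar.limit_norm (?T * (a - const x)) \<le> cstar.limit_norm ?T * cstar.limit_norm (a - const x)"
        using TS axC by (intro cstar.limit_norm_mult)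
      also have "\<dots> \<le> 1 * (1 / 16)"
        using U_walk[OF aw] ax axC by (intro mult_mono) auto
      finally have close: "cstar.limit_norm (b - const ?y) \<le> 1 / 16" by (simp only: mult_1_left mult_1_right)
      \<comment> \<open>Both products are components of \<open>p\<^sub>w c\<close> and \<open>c p\<^sub>w\<close>, which agree.\<close>
      have comm: "b * c \<simeq> c * b" if c: "c \<in> cstar.C" "?P w * c \<simeq> c" "c * ?P w \<simeq> c" for c
        by (rule CF.part_unique[OF IJ CF.part_right[OF IJ b c(1)] CF.part_left[OF IJ b c(1)]
              cstar.completion.eqK_trans[OF c(2) cstar.completion.eqK_sym[OF c(3)]]])
      note idem = CF.part_p_idem[OF IJ w b]
      have "b \<in> cstar.cnull \<or> ?P w \<simeq> b"
        using n \<gamma> by (intro loop_idempotent_close[OF w bC idem(1,3,2) comm y _ close]) auto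
      then show ?thesis using CF.part_zero_imp[OF IJ b] CF.part_one_imp[OF IJ b] by blast
    qed
    then show "\<exists>n. (out_arcs E v = {} \<longrightarrow> n = 0) \<and>
        (\<forall>\<gamma> w. awalk v \<gamma> w \<and> length \<gamma> = n \<longrightarrow> ?P w \<in> I \<or> ?P w \<in> J)"
      using n0 by (intro exI[of _ n] conjI allI impI) blast+
  qed
qed

theorem cstar_decomposable_iff: "decomposable_cstar_algebra (graph_cstar_algebra E) \<longleftrightarrow> graph_splits E"
  using splits_imp_cstar_decomposable cstar_decomposable_imp_splits by blast

end

theorem corollary5p3:
  fixes E :: "('v, 'e) pre_digraph"
  assumes "wf_digraph E"
    and "countable (verts E)"
    and "countable (arcs E)"
    and "row_finite E"
  shows "(talented_decomposable E \<longleftrightarrow>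
            decomposable_algebra
              (leavitt_path_algebra E ::
                 ('k::field, (('v, 'e) leavitt_gen free_word \<Rightarrow>\<^sub>0 'k) set) nu_algebra)) \<and>
         (talented_decomposable E \<longleftrightarrow>
            decomposable_cstar_algebra (graph_cstar_algebra E))"
proof -
  interpret row_finite_graph E
    using assms by (simp add: row_finite_graph_def row_finite_graph_axioms_def)
  interpret graph_cstar E by unfold_locales
  have "decomposable_algebra (leavitt_path_algebra E ::
      ('k, (('v, 'e) leavitt_gen free_word \<Rightarrow>\<^sub>0 'k) set) nu_algebra) \<longleftrightarrow> graph_splits E"
    by (rule leavitt_decomposable_iff)
  then show ?thesis using talented_decomposable_iff cstar_decomposable_iff by simp
qed

end
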